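(* Let $\varepsilon_i>0$ with $\varepsilon_i\to0$ and $k_i\in\mathbb{N}$ with $k_i\to\infty$, let $A_i\in\mathfrak{A}_{ad}$, $f\in L^2(\Omega)$, and let $y_i\in H^1_0(\Omega)$ be the weak solution of $$\int_\Omega\big[\varepsilon_i+\mathcal{F}_{k_i}(|A_i^{1/2}\nabla y_i|^2)\big]^{\frac{p-2}{2}}(A_i\nabla y_i,\nabla v)_{\mathbb{R}^N}\,dx=\int_\Omega fv\,dx\quad\forall v\in H^1_0(\Omega).$$ If $y_i\rightharpoonup y$ weakly in $H^1_0(\Omega)$, then $y\in W^{1,p}_0(\Omega)$.
   Context: $\Omega\subset\mathbb{R}^N$ bounded open with Lipschitz boundary; $2\le p<\infty$. $\mathbb{S}^N$: real symmetric $N\times N$ matrices. $\xi_1,\xi_2\in L^\infty(\Omega)\cap BV(\Omega)$ with $0<\alpha\le\xi_1\le\xi_2$ a.e., $\gamma>0$, $\mathfrak{A}_{ad}=\{A\in L^\infty(\Omega;\mathbb{S}^N):\ \xi_1^2|\eta|^2\le(\eta,A\eta)\le\xi_2^2|\eta|^2$ a.e. $\forall\eta$, $A^{1/2}\in BV(\Omega;\mathbb{S}^N)$, $\int_\Omega|DA^{1/2}|\le\gamma\}$ ($A^{1/2}$ the positive square root, $\int|DA|$ the sum over $i\le j$ of total variations of entries). For $k\in\mathbb{N}$, $\mathcal{F}_k:[0,\infty)\to[0,\infty)$ is a fixed nondecreasing $C^1$ function with $\mathcal{F}_k(t)=t$ on $[0,k^2]$, $\mathcal{F}_k(t)=k^2+1$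 for $t>k^2+1$, $t\le\mathcal{F}_k(t)\le t+\delta$ on $[k^2,k^2+1)$, some $\delta\in(0,1)$. *)

theory Defs
  imports "HOL-Analysis.Analysis"
begin

definition pd :: "'n::finite \<Rightarrow> (real^'n \<Rightarrow> real) \<Rightarrow> real^'n \<Rightarrow> real" where
  "pd j f x = frechet_derivative f (at x) (axis j 1)"

definition grad :: "(real^'n::finite \<Rightarrow> real) \<Rightarrow> real^'n \<Rightarrow> real^'n" where
  "grad f x = (\<chi> j. pd j f x)"

definition smooth_fun :: "(real^'n::finite \<Rightarrow> real) \<Rightarrow> bool" where
  "smooth_fun f \<longleftrightarrow> (\<forall>js x. (foldr pd js f) differentiable (at x))"

definition test_fun :: "(real^'n::finite) set \<Rightarrow> (real^'n \<Rightarrow> real) \<Rightarrow> bool" where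
  "test_fun \<Omega> \<phi> \<longleftrightarrow> smooth_fun \<phi> \<and> compact (closure {x. \<phi> x \<noteq> 0})
      \<and> closure {x. \<phi> x \<noteq> 0} \<subseteq> \<Omega>"

definition locint :: "(real^'n::finite) set \<Rightarrow> (real^'n \<Rightarrow> real) \<Rightarrow> bool" where
  "locint \<Omega> u \<longleftrightarrow> u \<in> borel_measurable (lebesgue_on \<Omega>) \<and>
     (\<forall>K. compact K \<and> K \<subseteq> \<Omega> \<longrightarrow> integrable (lebesgue_on K) u)"

definition Lp :: "(real^'n::finite) set \<Rightarrow> real \<Rightarrow> (real^'n \<Rightarrow> real) \<Rightarrow> bool" where
  "Lp \<Omega> p u \<longleftrightarrow> u \<in> borel_measurable (lebesgue_on \<Omega>) \<and>
     integrable (lebesgue_on \<Omega>) (\<lambda>x. \<bar>u x\<bar> powr p)"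

definition Linf :: "(real^'n::finite) set \<Rightarrow> (real^'n \<Rightarrow> real) \<Rightarrow> bool" where
  "Linf \<Omega> u \<longleftrightarrow> u \<in> borel_measurable (lebesgue_on \<Omega>) \<and>
     (\<exists>C. AE x in lebesgue_on \<Omega>. \<bar>u x\<bar> \<le> C)"

definition weak_grad :: "(real^'n::finite) set \<Rightarrow> (real^'n \<Rightarrow> real) \<Rightarrow> (real^'n \<Rightarrow> real^'n) \<Rightarrow> bool" where
  "weak_grad \<Omega> u g \<longleftrightarrow> locint \<Omega> u \<and> (\<forall>j. locint \<Omega> (\<lambda>x. g x $ j)) \<and>
     (\<forall>\<phi> j. test_fun \<Omega> \<phi> \<longrightarrow>
        (LINT x|lebesgue_on \<Omega>. u x * pd j \<phi> x) = - (LINT x|lebesgue_on \<Omega>. g x $ j * \<phi> x))"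

definition wgrad :: "(real^'n::finite) set \<Rightarrow> (real^'n \<Rightarrow> real) \<Rightarrow> real^'n \<Rightarrow> real^'n" where
  "wgrad \<Omega> u = (SOME g. weak_grad \<Omega> u g)"

definition sob :: "(real^'n::finite) set \<Rightarrow> real \<Rightarrow> (real^'n \<Rightarrow> real) \<Rightarrow> bool" where
  "sob \<Omega> p u \<longleftrightarrow> Lp \<Omega> p u \<and> (\<exists>g. weak_grad \<Omega> u g \<and> Lp \<Omega> p (\<lambda>x. norm (g x)))"

definition sob0 :: "(real^'n::finite) set \<Rightarrow> real \<Rightarrow> (real^'n \<Rightarrow> real) \<Rightarrow> bool" where
  "sob0 \<Omega> p u \<longleftrightarrow> sob \<Omega> p u \<and>
     (\<exists>\<phi>. (\<forall>n. test_fun \<Omega> (\<phi> n)) \<and>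
        (\<lambda>n. LINT x|lebesgue_on \<Omega>. \<bar>\<phi> n x - u x\<bar> powr p) \<longlonglongrightarrow> 0 \<and>
        (\<lambda>n. LINT x|lebesgue_on \<Omega>. norm (grad (\<phi> n) x - wgrad \<Omega> u x) powr p) \<longlonglongrightarrow> 0)"

text \<open>Weak convergence in the Hilbert space H^1_0(Omega) (inner product of H^1, Riesz).\<close>
definition weak_conv_H10 :: "(real^'n::finite) set \<Rightarrow> (nat \<Rightarrow> real^'n \<Rightarrow> real) \<Rightarrow> (real^'n \<Rightarrow> real) \<Rightarrow> bool" where
  "weak_conv_H10 \<Omega> ys y \<longleftrightarrow> (\<forall>i. sob0 \<Omega> 2 (ys i)) \<and> sob0 \<Omega> 2 y \<and>
     (\<forall>v. sob0 \<Omega> 2 v \<longrightarrow>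
        (\<lambda>i. LINT x|lebesgue_on \<Omega>. ys i x * v x + wgrad \<Omega> (ys i) x \<bullet> wgrad \<Omega> v x)
          \<longlonglongrightarrow> (LINT x|lebesgue_on \<Omega>. y x * v x + wgrad \<Omega> y x \<bullet> wgrad \<Omega> v x))"

definition divg :: "(real^'n::finite \<Rightarrow> real^'n) \<Rightarrow> real^'n \<Rightarrow> real" where
  "divg \<phi> x = (\<Sum>j\<in>UNIV. pd j (\<lambda>z. \<phi> z $ j) x)"

definition total_var :: "(real^'n::finite) set \<Rightarrow> (real^'n \<Rightarrow> real) \<Rightarrow> ereal" where
  "total_var \<Omega> u = (SUP \<phi> \<in> {\<phi>. (\<forall>j. test_fun \<Omega> (\<lambda>x. \<phi> x $ j)) \<and> (\<forall>x. norm (\<phi> x) \<le> 1)}.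
      ereal (LINT x|lebesgue_on \<Omega>. u x * divg \<phi> x))"

definition BV :: "(real^'n::finite) set \<Rightarrow> (real^'n \<Rightarrow> real) \<Rightarrow> bool" where
  "BV \<Omega> u \<longleftrightarrow> integrable (lebesgue_on \<Omega>) u \<and> total_var \<Omega> u < \<infinity>"

definition lipschitz_boundary :: "(real^'n::finite) set \<Rightarrow> bool" where
  "lipschitz_boundary \<Omega> \<longleftrightarrow> (\<forall>x\<in>frontier \<Omega>. \<exists>r>0. \<exists>(R::real^'n\<Rightarrow>real^'n) (j::'n) (g::real^'n\<Rightarrow>real) L.
     orthogonal_transformation R \<and> L-lipschitz_on UNIV g \<and>
     (\<forall>y. g y = g (\<chi> i. if i = j then 0 else y $ i)) \<and>
     \<Omega> \<inter> ball x r = {y \<in> ball x r. (R y) $ j < g (R y)})"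

definition psd :: "real^('n::finite)^'n \<Rightarrow> bool" where
  "psd B \<longleftrightarrow> (\<forall>\<eta>. 0 \<le> \<eta> \<bullet> (B *v \<eta>))"

definition msqrt :: "real^('n::finite)^'n \<Rightarrow> real^'n^'n" where
  "msqrt A = (THE B. transpose B = B \<and> psd B \<and> B ** B = A)"

definition admissible ::
  "((real, 'n::{finite,linorder}) vec) set \<Rightarrow> ((real, 'n) vec \<Rightarrow> real) \<Rightarrow> ((real, 'n) vec \<Rightarrow> real) \<Rightarrow> real
    \<Rightarrow> ((real, 'n) vec \<Rightarrow> ((real, 'n) vec, 'n) vec) \<Rightarrow> bool" where
  "admissible \<Omega> \<xi>1 \<xi>2 \<gamma> A \<longleftrightarrow>
     A \<in> borel_measurable (lebesgue_on \<Omega>) \<and>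
     (\<exists>C. AE x in lebesgue_on \<Omega>. norm (A x) \<le> C) \<and>
     (AE x in lebesgue_on \<Omega>. transpose (A x) = A x) \<and>
     (AE x in lebesgue_on \<Omega>. \<forall>\<eta>. (\<xi>1 x)\<^sup>2 * (norm \<eta>)\<^sup>2 \<le> \<eta> \<bullet> (A x *v \<eta>)
                                  \<and> \<eta> \<bullet> (A x *v \<eta>) \<le> (\<xi>2 x)\<^sup>2 * (norm \<eta>)\<^sup>2) \<and>
     (\<forall>i j. BV \<Omega> (\<lambda>x. msqrt (A x) $ i $ j)) \<and>
     (\<Sum>(i,j)\<in>{(i,j). i \<le> j}. total_var \<Omega> (\<lambda>x. msqrt (A x) $ i $ j)) \<le> ereal \<gamma>"

end

theory Submission
  imports Defs
begin

text \<open>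
  Testing the equation with \<open>y i\<close> and using the Poincare inequality bounds the gradients of \<open>y i\<close> in
  \<open>L\<^sup>2\<close>, and bounds their truncations to the sets where \<open>F\<close> is the identity in \<open>L\<^sup>p\<close>; the
  truncation error is \<open>O(1 / k i)\<close> in \<open>L\<^sup>1\<close>. By the Banach--Saks argument, averages of a subsequence of
  the \<open>y i\<close> converge strongly to \<open>y0\<close> in \<open>H\<^sup>1\<close>, and Fatou's lemma puts the gradient of \<open>y0\<close> into
  \<open>L\<^sup>p\<close>. Finally \<open>y0\<close>, extended by zero, is a Sobolev function on the whole space. Since the boundary
  is Lipschitz, every boundary point has a cone of inward directions; localising with a partition of
  unity and mollifying with kernels supported in these cones gives test functions on \<open>\<Omega>\<close> converging
  to \<open>y0\<close> in \<open>W\<^sup>1\<^sup>,\<^sup>p\<close>.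
\<close>

section \<open>Smooth functions and test functions\<close>

text \<open>\<open>wgrad\<close> and \<open>msqrt\<close> are choice operators, so the estimates
  need a.e. uniqueness of weak gradients and existence and uniqueness of positive square roots; the
  latter give |A^(1/2) w|^2 = (w, A w). Write t for this quantity. Where t <= k^2, the weight is at
  least t^((p-2)/2), so the energy density dominates t^(p/2) and hence a multiple of |w|^p. Where t
  > k^2, one has \<alpha> k |w| <= t, and t has bounded integral: this is the origin of 1/k. Weak
  convergence is known only through H^1 inner products with functions of H^1_0. The Gram matrix of
  the differences \<open>y i - y0\<close> involves no others, and averaging respects the L^p bound
  by convexity. The approximants of \<open>y0\<close> that \<open>sob0\<close> supplies for exponent
  2 say nothing about exponent \<open>p\<close>. They serve to show that the extension by zero is
  weakly differentiable across the boundary; its L^p bound follows from a Poincare inequality, and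
  new approximants are built. Centred kernels would spread the support out of \<Omega>; kernels
  aimed inwards keep it inside.\<close>

lemma smooth_fun_coinduct:
  assumes "f \<in> K" and d: "\<And>f x. f \<in> K \<Longrightarrow> f differentiable (at x)"
    and p: "\<And>f j. f \<in> K \<Longrightarrow> pd j f \<in> K"
  shows "smooth_fun f"
proof -
  have "foldr pd js f \<in> K" for js
    by (induction js) (auto simp: assms)
  then show ?thesis unfolding smooth_fun_def using d by blast
qed

lemma smooth_fun_differentiable: "smooth_fun f \<Longrightarrow> f differentiable (at x)"
  unfolding smooth_fun_def by (metis foldr_Nil id_apply)

lemma smooth_fun_pd: "smooth_fun f \<Longrightarrow> smooth_fun (pd j f)"
proof -
  assume a: "smooth_fun f"
  have "foldr pd js (pd j f) = foldr pd (js @ [j]) f" for js by simp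
  with a show ?thesis unfolding smooth_fun_def by metis
qed

lemma pd_eq_derivative:
  assumes "(f has_derivative D) (at x)" shows "pd j f x = D (axis j 1)"
  using frechet_derivative_at[OF assms] by (simp add: pd_def)

lemma has_derivative_pd:
  fixes f :: "real^'n::finite \<Rightarrow> real"
  assumes "f differentiable (at x)"
  shows "(f has_derivative (\<lambda>h. \<Sum>j\<in>UNIV. h $ j * pd j f x)) (at x)"
proof -
  have D: "(f has_derivative frechet_derivative f (at x)) (at x)"
    using assms frechet_derivative_works by blast
  then interpret bounded_linear "frechet_derivative f (at x)"
    by (rule has_derivative_bounded_linear)
  have "frechet_derivative f (at x) h = (\<Sum>j\<in>UNIV. h $ j * pd j f x)" for h
  proof -
    have "h = (\<Sum>j\<in>UNIV. h $ j *\<^sub>R axis j 1)"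
      by (simp add: basis_expansion[symmetric] scalar_mult_eq_scaleR[symmetric])
    then have "frechet_derivative f (at x) h = (\<Sum>j\<in>UNIV. h $ j *\<^sub>R frechet_derivative f (at x) (axis j 1))"
      by (metis (no_types, lifting) scaleR sum sum.cong)
    then show ?thesis by (simp add: pd_def)
  qed
  then have "frechet_derivative f (at x) = (\<lambda>h. \<Sum>j\<in>UNIV. h $ j * pd j f x)" by blast
  with D show ?thesis by simp
qed

text \<open>The generated algebra consists of smooth functions as soon as it contains the partial
  derivatives of its (differentiable) generators.\<close>

inductive_set fun_alg :: "(real^'n::finite \<Rightarrow> real) set \<Rightarrow> (real^'n \<Rightarrow> real) set" for S where
  gen: "f \<in> S \<Longrightarrow> f \<in> fun_alg S"
| const: "(\<lambda>x. c) \<in> fun_alg S"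
| add: "f \<in> fun_alg S \<Longrightarrow> g \<in> fun_alg S \<Longrightarrow> (\<lambda>x. f x + g x) \<in> fun_alg S"
| mult: "f \<in> fun_alg S \<Longrightarrow> g \<in> fun_alg S \<Longrightarrow> (\<lambda>x. f x * g x) \<in> fun_alg S"

lemma pd_const: "pd j (\<lambda>x. c) = (\<lambda>x. 0)"
  by (auto simp: pd_def)

lemma pd_add:
  assumes "f differentiable (at x)" "g differentiable (at x)"
  shows "pd j (\<lambda>x. f x + g x) x = pd j f x + pd j g x"
proof -
  have "((\<lambda>x. f x + g x) has_derivative
     (\<lambda>h. frechet_derivative f (at x) h + frechet_derivative g (at x) h)) (at x)"
    using assms frechet_derivative_works by (intro has_derivative_add) blast+
  from pd_eq_derivative[OF this] show ?thesis by (simp add: pd_def)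
qed

lemma pd_mult:
  fixes f g :: "real^'n::finite \<Rightarrow> real"
  assumes "f differentiable (at x)" "g differentiable (at x)"
  shows "pd j (\<lambda>x. f x * g x) x = f x * pd j g x + pd j f x * g x"
proof -
  have "((\<lambda>x. f x * g x) has_derivative
     (\<lambda>h. f x * frechet_derivative g (at x) h + frechet_derivative f (at x) h * g x)) (at x)"
    using assms frechet_derivative_works by (intro has_derivative_mult) blast+
  from pd_eq_derivative[OF this] show ?thesis by (simp add: pd_def)
qed

text \<open>Sum and product rule carry membership of \<open>pd j f\<close> in the algebra from the
  generators to all elements; \<open>smooth_fun_coinduct\<close> then applies to the algebra
  itself.\<close>

lemma smooth_fun_alg:
  assumes d: "\<And>f x. f \<in> S \<Longrightarrow> f differentiable (at x)"
    and p: "\<And>f j. f \<in> S \<Longrightarrow> pd j f \<in> fun_alg S" and f: "f \<in> fun_alg S"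
  shows "smooth_fun f"
proof (rule smooth_fun_coinduct[OF f])
  have "\<forall>x. f differentiable (at x)" if "f \<in> fun_alg S" for f
    using that by induction (auto intro: d)
  then show D: "f differentiable (at x)" if "f \<in> fun_alg S" for f x using that by blast
  show "pd j f \<in> fun_alg S" if "f \<in> fun_alg S" for f j
    using that
  proof induction
    case (add f g)
    have "pd j (\<lambda>x. f x + g x) = (\<lambda>x. pd j f x + pd j g x)"
      using add by (auto intro!: pd_add D)
    with add show ?case by (auto intro: fun_alg.intros)
  next
    case (mult f g)
    have "pd j (\<lambda>x. f x * g x) = (\<lambda>x. f x * pd j g x + pd j f x * g x)"
      using mult by (auto intro!: pd_mult D)
    with mult show ?case by (auto intro: fun_alg.intros)
  qed (auto simp: p pd_const fun_alg.const)
qed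

lemma smooth_fun_alg_smooth: "f \<in> fun_alg (Collect smooth_fun) \<Longrightarrow> smooth_fun f"
  by (rule smooth_fun_alg[of "Collect smooth_fun"]) (simp_all add: smooth_fun_differentiable smooth_fun_pd fun_alg.gen)

lemma smooth_fun_const: "smooth_fun (\<lambda>x. c)"
  by (rule smooth_fun_alg_smooth) (rule fun_alg.const)

lemma smooth_fun_add: "smooth_fun f \<Longrightarrow> smooth_fun g \<Longrightarrow> smooth_fun (\<lambda>x. f x + g x)"
  by (rule smooth_fun_alg_smooth, rule fun_alg.add; rule fun_alg.gen; simp)

lemma smooth_fun_mult: "smooth_fun f \<Longrightarrow> smooth_fun g \<Longrightarrow> smooth_fun (\<lambda>x. f x * g x)"
  by (rule smooth_fun_alg_smooth, rule fun_alg.mult; rule fun_alg.gen; simp)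

lemma smooth_fun_sum: "(\<And>i. i \<in> I \<Longrightarrow> smooth_fun (f i)) \<Longrightarrow> smooth_fun (\<lambda>x. \<Sum>i\<in>I. f i x)"
  by (induction I rule: infinite_finite_induct) (simp_all add: smooth_fun_const smooth_fun_add)

lemma pd_sum:
  fixes f :: "'i \<Rightarrow> real^'n::finite \<Rightarrow> real"
  assumes "\<And>i. i \<in> I \<Longrightarrow> f i differentiable (at x)"
  shows "pd j (\<lambda>x. \<Sum>i\<in>I. f i x) x = (\<Sum>i\<in>I. pd j (f i) x)"
proof -
  have "((\<lambda>x. \<Sum>i\<in>I. f i x) has_derivative (\<lambda>h. \<Sum>i\<in>I. frechet_derivative (f i) (at x) h)) (at x)"
    using assms frechet_derivative_works by (intro has_derivative_sum) blast
  from pd_eq_derivative[OF this] show ?thesis by (simp add: pd_def)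
qed

lemma pd_affine:
  fixes f :: "real^'n::finite \<Rightarrow> real"
  assumes "smooth_fun f"
  shows "((\<lambda>x. f (a + c *\<^sub>R x)) differentiable (at x))"
    and "pd j (\<lambda>x. f (a + c *\<^sub>R x)) x = c * pd j f (a + c *\<^sub>R x)"
proof -
  let ?D = "frechet_derivative f (at (a + c *\<^sub>R x))"
  have "(f has_derivative ?D) (at (a + c *\<^sub>R x))"
    using smooth_fun_differentiable[OF assms] frechet_derivative_works by blast
  then have *: "((\<lambda>x. f (a + c *\<^sub>R x)) has_derivative (\<lambda>h. ?D (c *\<^sub>R h))) (at x)"
    by (rule has_derivative_compose[rotated]) (auto intro!: derivative_eq_intros)
  then show "((\<lambda>x. f (a + c *\<^sub>R x)) differentiable (at x))" by (rule differentiableI)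
  interpret bounded_linear ?D
    using \<open>(f has_derivative ?D) _\<close> by (rule has_derivative_bounded_linear)
  show "pd j (\<lambda>x. f (a + c *\<^sub>R x)) x = c * pd j f (a + c *\<^sub>R x)"
    using pd_eq_derivative[OF *, of j] by (simp add: pd_def scaleR)
qed

text \<open>The functions x -> f (a + c x) with smooth f are closed under \<open>pd\<close> up to
  the factor \<open>c\<close>. The case c = -1 serves the reflections inside convolutions, c = 1/r
  the scaling of the bump.\<close>

lemma smooth_fun_affine:
  fixes f :: "real^'n::finite \<Rightarrow> real"
  assumes "smooth_fun f" shows "smooth_fun (\<lambda>x. f (a + c *\<^sub>R x))"
proof (rule smooth_fun_alg)
  let ?S = "{\<lambda>x. f (a + c *\<^sub>R x) |f. smooth_fun f}"
  show "(\<lambda>x. f (a + c *\<^sub>R x)) \<in> fun_alg ?S" using assms by (auto intro: fun_alg.gen)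
  show "g differentiable (at x)" if "g \<in> ?S" for g x using that by (auto intro: pd_affine)
  show "pd j g \<in> fun_alg ?S" if g: "g \<in> ?S" for g j
  proof -
    obtain f where f: "smooth_fun f" "g = (\<lambda>x. f (a + c *\<^sub>R x))" using g by blast
    then have "pd j g = (\<lambda>x. c * pd j f (a + c *\<^sub>R x))" by (auto simp: pd_affine)
    moreover have "(\<lambda>x. pd j f (a + c *\<^sub>R x)) \<in> ?S" using f smooth_fun_pd by blast
    ultimately show ?thesis by (simp only:) (rule fun_alg.mult[OF fun_alg.const fun_alg.gen])
  qed
qed

text \<open>This is exp(-1/t) / t^m for t > 0, the flat function behind the usual bump. The index
  \<open>m\<close> makes the family closed under differentiation up to linear combinations.\<close>

definition flat_exp :: "nat \<Rightarrow> real \<Rightarrow> real" where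
  "flat_exp m t = (if t > 0 then exp (- inverse t) * inverse t ^ m else 0)"

text \<open>A single term of the exponential series at s = 1/t gives s^(m+2) / (m+2)! <= exp s. The
  two spare powers of t make the difference quotient at 0 tend to 0.\<close>

lemma flat_exp_le: "\<bar>flat_exp m t\<bar> \<le> fact (m + 2) * t\<^sup>2"
proof (cases "t > 0")
  case True
  define s where "s = inverse t"
  have s: "s > 0" using True by (simp add: s_def)
  have "(\<Sum>n\<in>{m+2}. s ^ n /\<^sub>R fact n) \<le> exp s"
    unfolding exp_def by (rule sum_le_suminf[OF summable_exp_generic]) (use s in auto)
  then have "s ^ (m+2) / fact (m+2) \<le> exp s" by (simp add: divide_inverse mult.commute del: fact_Suc)
  then have "s ^ (m+2) \<le> fact (m+2) * exp s" by (simp add: field_simps del: fact_Suc)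
  then have "exp (-s) * s ^ m \<le> fact (m+2) * inverse (s\<^sup>2)"
    using s by (simp add: exp_minus field_simps power2_eq_square del: fact_Suc)
  then show ?thesis using True by (simp add: flat_exp_def s_def power_inverse)
qed (simp add: flat_exp_def)

text \<open>Away from 0 this is the product rule. At 0 the quadratic bound makes the difference
  quotient O(|h|), and the right-hand side is 0 there by definition.\<close>

lemma flat_exp_deriv:
  "(flat_exp m has_real_derivative (flat_exp (m+2) t - m * flat_exp (m+1) t)) (at t)"
proof -
  consider "t > 0" | "t < 0" | "t = 0" by linarith
  then show ?thesis
  proof cases
    case 1
    have "((\<lambda>t. exp (- inverse t) * inverse t ^ m) has_real_derivative
        (flat_exp (m+2) t - m * flat_exp (m+1) t)) (at t)"
    proof -
      have i: "(inverse has_real_derivative - (inverse t)\<^sup>2) (at t)"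
        using DERIV_inverse[of t] 1 by (simp add: numeral_2_eq_2)
      have "((\<lambda>t. inverse t ^ m) has_real_derivative - (m * inverse t ^ (m+1))) (at t)"
      proof (cases m)
        case (Suc k)
        with DERIV_power_Suc[OF i, of k] show ?thesis by (simp add: power2_eq_square algebra_simps)
      qed simp
      moreover have "((\<lambda>t. exp (- inverse t)) has_real_derivative exp (- inverse t) * (inverse t)\<^sup>2) (at t)"
        using i 1 by (auto intro!: derivative_eq_intros simp: power2_eq_square)
      ultimately show ?thesis
        by (rule DERIV_cong[OF DERIV_mult[rotated]]) (use 1 in \<open>simp add: flat_exp_def algebra_simps power2_eq_square\<close>)
    qed
    then show ?thesis
      by (rule has_field_derivative_transform_within_open[of _ _ _ "{0<..}"])
         (use 1 in \<open>auto simp: flat_exp_def\<close>)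
  next
    case 2
    have "((\<lambda>t. 0) has_real_derivative 0) (at t)" by simp
    then have "(flat_exp m has_real_derivative 0) (at t)"
      by (rule has_field_derivative_transform_within_open[of _ _ _ "{..<0}"])
         (use 2 in \<open>auto simp: flat_exp_def\<close>)
    then show ?thesis using 2 by (simp add: flat_exp_def)
  next
    case 3
    have "((\<lambda>h. flat_exp m h / h) \<longlongrightarrow> 0) (at 0)"
    proof (rule Lim_null_comparison)
      show "\<forall>\<^sub>F h in at 0. norm (flat_exp m h / h) \<le> fact (m+2) * \<bar>h\<bar>"
      proof (rule always_eventually, rule allI)
        fix h :: real
        have "fact (m+2) * h\<^sup>2 = fact (m+2) * \<bar>h\<bar> * \<bar>h\<bar>" by (simp add: power2_eq_square)
        then show "norm (flat_exp m h / h) \<le> fact (m+2) * \<bar>h\<bar>"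
          using flat_exp_le[of m h]
          by (cases "h = 0") (auto simp: divide_le_eq)
      qed
      show "((\<lambda>h. fact (m+2) * \<bar>h\<bar>) \<longlongrightarrow> 0) (at (0::real))"
        by (auto intro!: tendsto_eq_intros)
    qed
    then show ?thesis using 3 by (simp add: flat_exp_def has_field_derivative_iff)
  qed
qed

lemma pd_coord: "pd j (\<lambda>x::real^'n::finite. x $ i) = (\<lambda>x. if i = j then 1 else 0)"
proof
  fix x :: "real^'n"
  have "((\<lambda>x::real^'n. x $ i) has_derivative (\<lambda>h. h $ i)) (at x)"
    by (intro bounded_linear_imp_has_derivative bounded_linear_vec_nth)
  from pd_eq_derivative[OF this] show "pd j (\<lambda>x::real^'n. x $ i) x = (if i = j then 1 else 0)"
    by (simp add: axis_def)
qed

text \<open>The chain rule produces the factor -2 x_j, so the coordinate functions have to join the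
  flat functions as generators.\<close>

lemma smooth_fun_flat_exp_norm:
  "smooth_fun (\<lambda>x::real^'n::finite. flat_exp m (1 - (norm x)\<^sup>2))"
proof (rule smooth_fun_alg)
  let ?S = "{\<lambda>x. flat_exp m (1 - (norm x)\<^sup>2) |m. True} \<union> range (\<lambda>i (x::real^'n). x $ i)"
  have D: "((\<lambda>x::real^'n. flat_exp m (1 - (norm x)\<^sup>2)) has_derivative
     (\<lambda>h. (flat_exp (m+2) (1 - (norm x)\<^sup>2) - m * flat_exp (m+1) (1 - (norm x)\<^sup>2)) * (- 2 * (x \<bullet> h)))) (at x)"
    for m and x :: "real^'n"
  proof -
    have *: "((\<lambda>x::real^'n. 1 - (norm x)\<^sup>2) has_derivative (\<lambda>h. - 2 * (x \<bullet> h))) (at x)"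
      unfolding power2_norm_eq_inner by (auto intro!: derivative_eq_intros simp: inner_commute)
    show ?thesis
      using has_derivative_compose[OF * flat_exp_deriv[of m, unfolded has_field_derivative_def]]
      by simp
  qed
  show "(\<lambda>x. flat_exp m (1 - (norm x)\<^sup>2)) \<in> fun_alg ?S" by (auto intro: fun_alg.gen)
  show "f differentiable (at x)" if "f \<in> ?S" for f x
    using that
    by (auto intro: differentiableI[OF D] bounded_linear_imp_differentiable bounded_linear_vec_nth)
  show "pd j f \<in> fun_alg ?S" if "f \<in> ?S" for f j
    using that
  proof (elim UnE)
    assume "f \<in> range (\<lambda>i (x::real^'n). x $ i)"
    then show ?thesis by (auto simp: pd_coord fun_alg.const)
  next
    assume "f \<in> {\<lambda>x. flat_exp m (1 - (norm x)\<^sup>2) |m. True}"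
    then obtain m where f: "f = (\<lambda>x. flat_exp m (1 - (norm x)\<^sup>2))" by blast
    have "pd j f = (\<lambda>x. (flat_exp (m+2) (1 - (norm x)\<^sup>2) + (- real m) * flat_exp (m+1) (1 - (norm x)\<^sup>2)) * ((- 2) * x $ j))"
      by (auto simp: f pd_eq_derivative[OF D] inner_axis)
    then show ?thesis
      by (simp only:) (intro fun_alg.add fun_alg.mult fun_alg.const; rule fun_alg.gen; blast)
  qed
qed

section \<open>Test functions and smooth kernels\<close>

lemma test_fun_UNIV: "test_fun UNIV \<phi> \<longleftrightarrow> smooth_fun \<phi> \<and> bounded {x. \<phi> x \<noteq> 0}"
  by (auto simp: test_fun_def compact_eq_bounded_closed intro: bounded_subset[OF _ closure_subset])

lemma test_fun_zero_outside: "test_fun \<Omega> \<phi> \<Longrightarrow> x \<notin> \<Omega> \<Longrightarrow> \<phi> x = 0"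
  using closure_subset[of "{x. \<phi> x \<noteq> 0}"] unfolding test_fun_def by blast

lemma test_fun_smooth: "test_fun \<Omega> \<phi> \<Longrightarrow> smooth_fun \<phi>"
  by (simp add: test_fun_def)

lemma smooth_fun_continuous: "smooth_fun f \<Longrightarrow> continuous_on S f"
  by (intro continuous_at_imp_continuous_on ballI differentiable_imp_continuous_within smooth_fun_differentiable)

lemma smooth_fun_borel[measurable]: "smooth_fun f \<Longrightarrow> f \<in> borel_measurable borel"
  by (intro borel_measurable_continuous_onI smooth_fun_continuous)

lemma pd_zero_open:
  assumes "open U" "x \<in> U" "\<And>z. z \<in> U \<Longrightarrow> f z = 0" shows "pd j f x = 0"
proof -
  have "((\<lambda>z. 0) has_derivative (\<lambda>h. 0)) (at x)" by simp
  then have "(f has_derivative (\<lambda>h. 0)) (at x)"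
    by (rule has_derivative_transform_within_open[OF _ assms(1,2)]) (simp add: assms(3))
  from pd_eq_derivative[OF this] show ?thesis .
qed

lemma pd_support_subset: "{x. pd j f x \<noteq> 0} \<subseteq> closure {x. f x \<noteq> 0}"
proof (safe, rule ccontr)
  fix x assume "pd j f x \<noteq> 0" "x \<notin> closure {x. f x \<noteq> 0}"
  moreover from this have "pd j f x = 0"
    by (intro pd_zero_open[of "- closure {x. f x \<noteq> 0}"]) (use closure_subset[of "{x. f x \<noteq> 0}"] in auto)
  ultimately show False by simp
qed

lemma test_fun_pd: "test_fun \<Omega> \<phi> \<Longrightarrow> test_fun \<Omega> (pd j \<phi>)"
proof -
  assume a: "test_fun \<Omega> \<phi>"
  have "closure {x. pd j \<phi> x \<noteq> 0} \<subseteq> closure {x. \<phi> x \<noteq> 0}"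
    using pd_support_subset by (metis closed_closure closure_minimal)
  then have "compact (closure {x. pd j \<phi> x \<noteq> 0})"
    using a unfolding test_fun_def by (auto simp: compact_eq_bounded_closed intro: bounded_subset)
  then show ?thesis using a \<open>_ \<subseteq> _\<close> unfolding test_fun_def by (auto intro: smooth_fun_pd)
qed

lemma test_fun_mult_smooth:
  assumes "test_fun \<Omega> \<phi>" "smooth_fun \<psi>" shows "test_fun \<Omega> (\<lambda>x. \<psi> x * \<phi> x)"
proof -
  have "closure {x. \<psi> x * \<phi> x \<noteq> 0} \<subseteq> closure {x. \<phi> x \<noteq> 0}"
    by (intro closure_mono) auto
  moreover from this have "compact (closure {x. \<psi> x * \<phi> x \<noteq> 0})"
    using assms unfolding test_fun_def by (auto simp: compact_eq_bounded_closed intro: bounded_subset)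
  ultimately show ?thesis using assms unfolding test_fun_def by (auto intro: smooth_fun_mult)
qed

lemma test_fun_bounded:
  assumes "test_fun \<Omega> \<phi>" obtains M where "M > 0" "\<And>x. \<bar>\<phi> x\<bar> \<le> M"
proof -
  let ?K = "closure {x. \<phi> x \<noteq> 0}"
  have "compact (\<phi> ` ?K)"
    using assms by (intro compact_continuous_image smooth_fun_continuous) (auto simp: test_fun_def)
  then obtain M where M: "M > 0" "\<And>x. x \<in> ?K \<Longrightarrow> \<bar>\<phi> x\<bar> \<le> M"
    using compact_imp_bounded bounded_pos by (metis image_eqI real_norm_def)
  have "\<bar>\<phi> x\<bar> \<le> M" for x
    using M closure_subset[of "{x. \<phi> x \<noteq> 0}"] by (cases "\<phi> x = 0") auto
  with M that show thesis by blast
qed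

lemma test_fun_support_ball:
  assumes "test_fun \<Omega> \<phi>" obtains R where "R > 0" "\<And>x. \<phi> x \<noteq> 0 \<Longrightarrow> norm x \<le> R"
proof -
  have "bounded {x. \<phi> x \<noteq> 0}"
    using assms unfolding test_fun_def by (metis bounded_subset closure_subset compact_imp_bounded)
  then show thesis using that by (auto simp: bounded_pos)
qed

lemma bounded_support_integrable:
  fixes f :: "real^'n::finite \<Rightarrow> real"
  assumes "f \<in> borel_measurable borel" "\<And>x. \<bar>f x\<bar> \<le> M" "\<And>x. f x \<noteq> 0 \<Longrightarrow> norm x \<le> R"
  shows "integrable lborel f"
proof (rule Bochner_Integration.integrable_bound)
  show "integrable lborel (\<lambda>x::real^'n. M * indicator (cball 0 R) x)"
    by (auto intro!: integrable_mult_right integrable_real_indicator emeasure_lborel_cball_finite)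
  show "AE x in lborel. norm (f x) \<le> norm (M * indicator (cball 0 R) x)"
  proof (intro AE_I2)
    fix x
    show "norm (f x) \<le> norm (M * indicator (cball 0 R) x)"
      using assms(2,3)[of x] by (cases "f x = 0") (auto simp: indicator_def)
  qed
qed (use assms in auto)

lemma test_fun_integrable:
  fixes \<phi> :: "real^'n::finite \<Rightarrow> real"
  assumes "test_fun \<Omega> \<phi>" shows "integrable lborel \<phi>"
proof -
  obtain M R where "\<And>x. \<bar>\<phi> x\<bar> \<le> M" "\<And>x. \<phi> x \<noteq> 0 \<Longrightarrow> norm x \<le> R"
    using test_fun_bounded[OF assms] test_fun_support_ball[OF assms] by metis
  then show ?thesis using assms
    by (intro bounded_support_integrable) (auto intro: test_fun_smooth smooth_fun_borel)
qed

text \<open>The bump exp(-1/(1 - |(x-a)/r|^2)) is positive exactly on the ball and is divided by its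
  integral. An arbitrary centre \<open>a\<close> is allowed because later kernels sit inside a cone
  away from the origin.\<close>

lemma smooth_kernel_exists:
  assumes "r > 0"
  obtains \<eta> :: "real^'n::finite \<Rightarrow> real" where "test_fun UNIV \<eta>" "\<And>x. \<eta> x \<ge> 0"
    "(LINT x|lborel. \<eta> x) = 1" "\<And>x. \<eta> x \<noteq> 0 \<Longrightarrow> x \<in> ball a r"
proof -
  define b :: "real^'n \<Rightarrow> real" where "b x = flat_exp 0 (1 - (norm ((- (1/r)) *\<^sub>R a + (1/r) *\<^sub>R x))\<^sup>2)" for x
  have nn: "b x \<ge> 0" for x by (simp add: b_def flat_exp_def)
  have sp: "b x \<noteq> 0 \<longleftrightarrow> x \<in> ball a r" for x
  proof -
    have "(- (1/r)) *\<^sub>R a + (1/r) *\<^sub>R x = (1/r) *\<^sub>R (x - a)" by (simp add: algebra_simps)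
    then have "norm ((- (1/r)) *\<^sub>R a + (1/r) *\<^sub>R x) = dist a x / r"
      using assms by (simp add: dist_norm norm_minus_commute)
    then show ?thesis using assms
      by (auto simp: b_def flat_exp_def power_less_one_iff abs_square_less_1)
  qed
  have "{x. b x \<noteq> 0} = ball a r" by (rule set_eqI) (simp only: mem_Collect_eq sp)
  then have "bounded {x. b x \<noteq> 0}" by (metis bounded_ball)
  moreover have "smooth_fun b"
    using smooth_fun_affine[OF smooth_fun_flat_exp_norm, of 0 "(- (1/r)) *\<^sub>R a" "1/r"]
    unfolding b_def[abs_def] .
  ultimately have b: "test_fun UNIV b" by (simp add: test_fun_UNIV)
  have int: "integrable lborel b" by (rule test_fun_integrable[OF b])
  define I where "I = (LINT x|lborel. b x)"
  have "I > 0"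
  proof -
    have "I \<noteq> 0"
    proof
      assume "I = 0"
      then have "AE x in lborel. b x = 0"
        using integral_nonneg_eq_0_iff_AE[OF int] nn by (simp add: I_def)
      then have "AE x in lborel. x \<notin> ball a r" by eventually_elim (use sp in blast)
      then have "ball a r \<in> null_sets lborel"
        by (subst AE_iff_null_sets) auto
      then show False
        using assms content_ball_pos[of r a] by (simp add: null_sets_def measure_def)
    qed
    moreover have "I \<ge> 0" using nn by (simp add: I_def)
    ultimately show ?thesis by simp
  qed
  show thesis
  proof
    show "test_fun UNIV (\<lambda>x. inverse I * b x)" by (rule test_fun_mult_smooth[OF b smooth_fun_const])
    show "(LINT x|lborel. inverse I * b x) = 1" using \<open>I > 0\<close> by (simp flip: I_def)
    show "inverse I * b x \<ge> 0" for x using nn \<open>I > 0\<close> by simp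
    show "inverse I * b x \<noteq> 0 \<Longrightarrow> x \<in> ball a r" for x using sp by auto
  qed
qed

section \<open>Integration by parts and the Poincare inequality\<close>

lemma nn_integral_lborel_shift:
  fixes f :: "'a::euclidean_space \<Rightarrow> ennreal"
  assumes [measurable]: "f \<in> borel_measurable borel"
  shows "(\<integral>\<^sup>+x. f (x + h) \<partial>lborel) = (\<integral>\<^sup>+x. f x \<partial>lborel)"
proof -
  have "(\<integral>\<^sup>+x. f x \<partial>lborel) = (\<integral>\<^sup>+x. f x \<partial>distr lborel borel ((+) h))"
    by (simp add: lborel_distr_plus)
  also have "\<dots> = (\<integral>\<^sup>+x. f (h + x) \<partial>lborel)" by (subst nn_integral_distr) auto
  finally show ?thesis by (simp add: add.commute)
qed

lemma integral_lborel_shift: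
  fixes f :: "'a::euclidean_space \<Rightarrow> real"
  assumes [measurable]: "f \<in> borel_measurable borel"
  shows "(LINT x|lborel. f (x + h)) = (LINT x|lborel. f x)"
proof -
  have "(LINT x|lborel. f x) = (LINT x|distr lborel borel ((+) h). f x)"
    by (simp add: lborel_distr_plus)
  also have "\<dots> = (LINT x|lborel. f (h + x))" by (subst integral_distr) auto
  finally show ?thesis by (simp add: add.commute)
qed

lemma integrable_lborel_shift:
  fixes f :: "'a::euclidean_space \<Rightarrow> real"
  assumes "integrable lborel f" shows "integrable lborel (\<lambda>x. f (x + h))"
proof -
  have "integrable (distr lborel borel ((+) h)) f"
    using assms by (simp add: lborel_distr_plus)
  then show ?thesis using assms by (subst (asm) integrable_distr_eq) (auto simp: add.commute)
qed

lemma lborel_distr_reflect: "distr lborel borel (\<lambda>x. c - x) = (lborel :: 'a::euclidean_space measure)"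
proof -
  have "lborel = density (distr lborel borel (\<lambda>x::'a. c + (-1) *\<^sub>R x)) (\<lambda>_. 1)"
    by (subst lborel_affine[of "-1" c]) auto
  then show ?thesis by (simp add: density_1)
qed

lemma integral_lborel_reflect:
  fixes f :: "'a::euclidean_space \<Rightarrow> real"
  assumes [measurable]: "f \<in> borel_measurable borel"
  shows "(LINT x|lborel. f (c - x)) = (LINT x|lborel. f x)"
proof -
  have "(LINT x|lborel. f x) = (LINT x|distr lborel borel (\<lambda>x. c - x). f x)"
    by (simp add: lborel_distr_reflect)
  also have "\<dots> = (LINT x|lborel. f (c - x))" by (subst integral_distr) auto
  finally show ?thesis by simp
qed

text \<open>The integral of a difference quotient vanishes by translation invariance.\<close>

lemma integral_directional_derivative_zero:
  fixes f g :: "'a::euclidean_space \<Rightarrow> real"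
  assumes f[measurable]: "f \<in> borel_measurable borel" and f0: "\<And>x. f x \<noteq> 0 \<Longrightarrow> norm x \<le> R"
    and der: "\<And>x. ((\<lambda>t. f (x + t *\<^sub>R e)) has_real_derivative g x) (at 0)"
    and M: "\<And>x. \<bar>g x\<bar> \<le> M" and int: "integrable lborel f"
  shows "(LINT x|lborel. g x) = 0"
proof -
  define D where "D n x = real (Suc n) * (f (x + inverse (Suc n) *\<^sub>R e) - f x)" for n x
  have [measurable]: "D n \<in> borel_measurable borel" for n unfolding D_def by measurable
  have lim: "(\<lambda>n. D n x) \<longlonglongrightarrow> g x" for x
  proof -
    have "((\<lambda>h. (f (x + h *\<^sub>R e) - f x) / h) \<longlongrightarrow> g x) (at 0)"
      using der[of x] by (simp add: DERIV_def)
    moreover have "filterlim (\<lambda>n. inverse (real (Suc n))) (at 0) sequentially"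
      using LIMSEQ_inverse_real_of_nat by (auto simp: filterlim_at)
    ultimately have "(\<lambda>n. (f (x + inverse (real (Suc n)) *\<^sub>R e) - f x) / inverse (real (Suc n))) \<longlonglongrightarrow> g x"
      by (rule filterlim_compose)
    then show ?thesis by (simp add: D_def divide_inverse mult.commute)
  qed
  have dert: "((\<lambda>t. f (x + t *\<^sub>R e)) has_real_derivative g (x + t *\<^sub>R e)) (at t)" for x t
  proof -
    have "((\<lambda>s. f ((x + t *\<^sub>R e) + s *\<^sub>R e)) has_real_derivative g (x + t *\<^sub>R e)) (at (t - t))"
      using der by simp
    then have "((\<lambda>s. f ((x + t *\<^sub>R e) + (s - t) *\<^sub>R e)) has_real_derivative g (x + t *\<^sub>R e) * 1) (at t)"
      by (rule DERIV_chain2) (auto intro!: derivative_eq_intros)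
    then show ?thesis by (simp add: algebra_simps)
  qed
  \<comment> \<open>The mean value theorem turns the bound on the derivative into a bound on all
    difference quotients, uniform in \<open>n\<close>.\<close>
  have bd: "\<bar>D n x\<bar> \<le> M" for n x
  proof -
    obtain z where "f (x + inverse (Suc n) *\<^sub>R e) - f (x + 0 *\<^sub>R e) = (inverse (Suc n) - 0) * g (x + z *\<^sub>R e)"
      using MVT2[of 0 "inverse (real (Suc n))" "\<lambda>t. f (x + t *\<^sub>R e)" "\<lambda>t. g (x + t *\<^sub>R e)"] dert by auto
    then have "D n x = g (x + z *\<^sub>R e)" by (simp add: D_def)
    then show ?thesis using M by simp
  qed
  \<comment> \<open>All steps have length at most |e|, so every quotient vanishes outside one fixed
    ball; \<open>M\<close> times its indicator is the dominating function.\<close>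
  have supp: "norm x \<le> R + norm e" if "D n x \<noteq> 0" for n x
  proof -
    have "norm (inverse (real (Suc n)) *\<^sub>R e) \<le> norm e"
      by (simp add: mult_left_le_one_le inverse_le_1_iff)
    moreover have "f x \<noteq> 0 \<or> f (x + inverse (Suc n) *\<^sub>R e) \<noteq> 0" using that by (auto simp: D_def)
    ultimately show ?thesis
      using f0[of x] f0[of "x + inverse (Suc n) *\<^sub>R e"]
        norm_triangle_ineq4[of "x + inverse (Suc n) *\<^sub>R e" "inverse (Suc n) *\<^sub>R e"]
      by (auto intro: order_trans)
  qed
  have "(\<lambda>n. LINT x|lborel. D n x) \<longlonglongrightarrow> (LINT x|lborel. g x)"
  proof (rule integral_dominated_convergence)
    show "g \<in> borel_measurable lborel"
      by (rule borel_measurable_LIMSEQ_real[OF lim]) auto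
    show "integrable lborel (\<lambda>x::'a. M * indicator (cball 0 (R + norm e)) x)"
      by (auto intro!: integrable_mult_right integrable_real_indicator emeasure_lborel_cball_finite)
    show "AE x in lborel. norm (D n x) \<le> M * indicator (cball 0 (R + norm e)) x" for n
      using bd[of n] supp[of n] by (auto simp: indicator_def)
  qed (auto simp: lim)
  moreover have "(LINT x|lborel. D n x) = 0" for n
    using integral_lborel_shift[OF f] int integrable_lborel_shift[OF int] by (simp add: D_def)
  ultimately show ?thesis by (simp add: LIMSEQ_const_iff)
qed

lemma has_derivative_along:
  assumes "(f has_derivative D) (at x)"
  shows "((\<lambda>t. f (x + t *\<^sub>R e)) has_real_derivative D e) (at 0)"
proof -
  interpret bounded_linear D using assms by (rule has_derivative_bounded_linear)
  have "((\<lambda>t. x + t *\<^sub>R e) has_derivative (\<lambda>t. t *\<^sub>R e)) (at 0)"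
    by (auto intro!: derivative_eq_intros)
  from has_derivative_compose[OF this, of f D] assms
  have "((\<lambda>t. f (x + t *\<^sub>R e)) has_derivative (\<lambda>t. D (t *\<^sub>R e))) (at 0)" by simp
  then show ?thesis by (simp add: has_field_derivative_def scaleR mult_commute_abs)
qed

lemma integral_pd_test_fun:
  fixes \<phi> :: "real^'n::finite \<Rightarrow> real"
  assumes "test_fun \<Omega> \<phi>" shows "(LINT x|lborel. pd j \<phi> x) = 0"
proof -
  obtain R where R: "\<And>x. \<phi> x \<noteq> 0 \<Longrightarrow> norm x \<le> R" using test_fun_support_ball[OF assms] by metis
  obtain M where M: "\<And>x. \<bar>pd j \<phi> x\<bar> \<le> M" using test_fun_bounded[OF test_fun_pd[OF assms]] by metis
  have "((\<lambda>t. \<phi> (x + t *\<^sub>R axis j 1)) has_real_derivative pd j \<phi> x) (at 0)" for x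
    unfolding pd_def
    by (intro has_derivative_along) (use assms smooth_fun_differentiable frechet_derivative_works test_fun_smooth in blast)
  then show ?thesis
    using assms R M by (intro integral_directional_derivative_zero) (auto intro: smooth_fun_borel test_fun_smooth test_fun_integrable)
qed

section \<open>Poincare inequality for test functions\<close>

lemma abs_powr_has_derivative:
  assumes "1 < p"
  shows "((\<lambda>t. \<bar>t\<bar> powr p) has_real_derivative p * \<bar>t\<bar> powr (p - 1) * sgn t) (at t)"
proof -
  consider "t > 0" | "t < 0" | "t = 0" by linarith
  then show ?thesis
  proof cases
    case 1
    have "((\<lambda>t. t powr p) has_real_derivative p * t powr (p - 1)) (at t)"
      using 1 by (auto intro!: derivative_eq_intros)
    then have "((\<lambda>t. \<bar>t\<bar> powr p) has_real_derivative p * t powr (p - 1)) (at t)"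
      by (rule has_field_derivative_transform_within_open[of _ _ _ "{0<..}"]) (use 1 in auto)
    then show ?thesis using 1 by simp
  next
    case 2
    have "((\<lambda>t. (-t) powr p) has_real_derivative - (p * (-t) powr (p - 1))) (at t)"
      using 2 by (auto intro!: derivative_eq_intros)
    then have "((\<lambda>t. \<bar>t\<bar> powr p) has_real_derivative - (p * (-t) powr (p - 1))) (at t)"
      by (rule has_field_derivative_transform_within_open[of _ _ _ "{..<0}"]) (use 2 in auto)
    then show ?thesis using 2 by simp
  next
    case 3
    have "((\<lambda>h. \<bar>h\<bar> powr p / h) \<longlongrightarrow> 0) (at 0)"
    proof (rule Lim_null_comparison)
      show "\<forall>\<^sub>F h in at 0. norm (\<bar>h\<bar> powr p / h) \<le> \<bar>h\<bar> powr (p - 1)"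
        by (rule always_eventually) (auto simp: powr_diff)
      have "((\<lambda>h::real. \<bar>h\<bar> powr (p - 1)) \<longlongrightarrow> \<bar>0\<bar> powr (p - 1)) (at 0)"
        using assms by (intro tendsto_powr' tendsto_intros) auto
      then show "((\<lambda>h::real. \<bar>h\<bar> powr (p - 1)) \<longlongrightarrow> 0) (at 0)" by simp
    qed
    then show ?thesis using 3 assms by (simp add: has_field_derivative_iff)
  qed
qed

text \<open>Distinguish c b <= a/2 and a < 2 c b. The coefficient 1/2 of a^p is the point: it lets
  this term be absorbed in the Poincare inequality.\<close>

lemma young_powr:
  fixes a b c p :: real
  assumes "0 \<le> a" "0 \<le> b" "0 \<le> c" "1 < p"
  shows "a powr (p - 1) * (c * b) \<le> (a powr p + (2 * c) powr p * b powr p) / 2"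
proof (cases "c * b \<le> a / 2")
  case True
  have "a powr (p - 1) * (c * b) \<le> a powr (p - 1) * (a / 2)" using True by (intro mult_left_mono) auto
  also have "\<dots> = a powr p / 2" using assms by (cases "a = 0") (auto simp: powr_diff)
  finally show ?thesis by (simp add: add_increasing2)
next
  case False
  then have a: "a \<le> 2 * (c * b)" and pos: "c * b > 0" using assms by auto
  have "a powr (p - 1) * (c * b) \<le> (2 * (c * b)) powr (p - 1) * (c * b)"
    using a pos assms by (intro mult_right_mono powr_mono2) auto
  also have "\<dots> = (2 * (c * b)) powr p / 2" using pos by (simp add: powr_diff)
  also have "\<dots> = (2 * c) powr p * b powr p / 2" using assms by (simp add: powr_mult[symmetric] mult.assoc)
  finally show ?thesis by (simp add: add_increasing)
qed

text \<open>Integrate the derivative of \<open>x $ j * \<bar>\<phi> x\<bar> powr p\<close> in direction \<open>j\<close>.\<close>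

lemma poincare_test_fun:
  fixes \<phi> :: "real^'n::finite \<Rightarrow> real"
  assumes \<phi>: "test_fun \<Omega> \<phi>" and R: "\<And>x. \<phi> x \<noteq> 0 \<Longrightarrow> norm x \<le> R" "R > 0" and p: "1 < p"
  shows "(LINT x|lborel. \<bar>\<phi> x\<bar> powr p) \<le> (2 * p * R) powr p * (LINT x|lborel. \<bar>pd j \<phi> x\<bar> powr p)"
proof -
  define g where "g x = \<bar>\<phi> x\<bar> powr p + x $ j * (p * \<bar>\<phi> x\<bar> powr (p - 1) * sgn (\<phi> x) * pd j \<phi> x)" for x
  obtain M where M: "\<And>x. \<bar>\<phi> x\<bar> \<le> M" "M > 0" using test_fun_bounded[OF \<phi>] by metis
  obtain M' where M': "\<And>x. \<bar>pd j \<phi> x\<bar> \<le> M'" "M' > 0" using test_fun_bounded[OF test_fun_pd[OF \<phi>]] by metis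
  have [measurable]: "\<phi> \<in> borel_measurable borel" "pd j \<phi> \<in> borel_measurable borel"
    using \<phi> by (auto intro: smooth_fun_borel test_fun_smooth smooth_fun_pd)
  have [measurable]: "(\<lambda>x::real^'n. x $ j) \<in> borel_measurable borel"
    by (intro borel_measurable_continuous_onI continuous_intros)
  have int1: "integrable lborel (\<lambda>x. \<bar>\<phi> x\<bar> powr p)"
    using R M p by (intro bounded_support_integrable[of _ "M powr p" R]) (auto intro!: powr_mono2 split: if_splits)
  have R': "norm x \<le> R" if "pd j \<phi> x \<noteq> 0" for x
  proof -
    have "closure {x. \<phi> x \<noteq> 0} \<subseteq> cball 0 R" using R(1) by (intro closure_minimal) auto
    then show ?thesis using pd_support_subset[of j \<phi>] that by auto
  qed
  have int2: "integrable lborel (\<lambda>x. \<bar>pd j \<phi> x\<bar> powr p)"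
    using R' M' p by (intro bounded_support_integrable[of _ "M' powr p" R]) (auto intro!: powr_mono2 split: if_splits)
  have comp: "\<bar>x $ j\<bar> \<le> R" if "\<phi> x \<noteq> 0" for x
    using component_le_norm_cart[of x j] R(1)[OF that] by linarith
  \<comment> \<open>On the support |x_j| <= R, and Young's inequality with c = p R leaves only half
    of |\<phi>|^p.\<close>
  have bd: "\<bar>x $ j * (p * \<bar>\<phi> x\<bar> powr (p - 1) * sgn (\<phi> x) * pd j \<phi> x)\<bar>
      \<le> (\<bar>\<phi> x\<bar> powr p + (2 * (p * R)) powr p * \<bar>pd j \<phi> x\<bar> powr p) / 2" for x
  proof (cases "\<phi> x = 0")
    case False
    have "\<bar>x $ j * (p * \<bar>\<phi> x\<bar> powr (p - 1) * sgn (\<phi> x) * pd j \<phi> x)\<bar>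
       = \<bar>x $ j\<bar> * (\<bar>\<phi> x\<bar> powr (p - 1) * (p * \<bar>pd j \<phi> x\<bar>))"
      using p False by (simp add: abs_mult abs_sgn_eq)
    also have "\<dots> \<le> R * (\<bar>\<phi> x\<bar> powr (p - 1) * (p * \<bar>pd j \<phi> x\<bar>))"
      using p comp[OF False] by (intro mult_right_mono) auto
    also have "\<dots> = \<bar>\<phi> x\<bar> powr (p - 1) * ((p * R) * \<bar>pd j \<phi> x\<bar>)" by simp
    also have "\<dots> \<le> (\<bar>\<phi> x\<bar> powr p + (2 * (p * R)) powr p * \<bar>pd j \<phi> x\<bar> powr p) / 2"
      using p R by (intro young_powr) auto
    finally show ?thesis .
  qed auto
  have g_int: "(LINT x|lborel. g x) = 0"
  proof (rule integral_directional_derivative_zero[where f="\<lambda>x. x $ j * \<bar>\<phi> x\<bar> powr p" and e = "axis j 1" and R = R])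
    show "x $ j * \<bar>\<phi> x\<bar> powr p \<noteq> 0 \<Longrightarrow> norm x \<le> R" for x using R by auto
    show "integrable lborel (\<lambda>x. x $ j * \<bar>\<phi> x\<bar> powr p)"
    proof (rule bounded_support_integrable[of _ "R * M powr p" R])
      show "\<bar>x $ j * \<bar>\<phi> x\<bar> powr p\<bar> \<le> R * M powr p" for x
        using comp[of x] M p R by (cases "\<phi> x = 0") (auto simp: abs_mult intro!: mult_mono powr_mono2)
    qed (use R in auto)
    show "\<bar>g x\<bar> \<le> M powr p + (M powr p + (2 * (p * R)) powr p * M' powr p) / 2" for x
    proof -
      have *: "\<bar>\<phi> x\<bar> powr p \<le> M powr p" "\<bar>pd j \<phi> x\<bar> powr p \<le> M' powr p"
        using M M' p by (auto intro!: powr_mono2)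
      then have "(2 * (p * R)) powr p * \<bar>pd j \<phi> x\<bar> powr p \<le> (2 * (p * R)) powr p * M' powr p"
        by (intro mult_left_mono) auto
      then show ?thesis using bd[of x] * unfolding g_def
        by (intro order_trans[OF abs_triangle_ineq] add_mono order_trans[OF bd] divide_right_mono) auto
    qed
    show "((\<lambda>t. (x + t *\<^sub>R axis j 1) $ j * \<bar>\<phi> (x + t *\<^sub>R axis j 1)\<bar> powr p) has_real_derivative g x) (at 0)" for x
    proof -
      have "((\<lambda>t. \<phi> (x + t *\<^sub>R axis j 1)) has_real_derivative pd j \<phi> x) (at 0)"
        unfolding pd_def
        by (intro has_derivative_along) (use \<phi> smooth_fun_differentiable frechet_derivative_works test_fun_smooth in blast)
      moreover have "((\<lambda>t. \<bar>t\<bar> powr p) has_real_derivative p * \<bar>\<phi> x\<bar> powr (p - 1) * sgn (\<phi> x)) (at (\<phi> (x + 0 *\<^sub>R axis j 1)))"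
        using abs_powr_has_derivative[OF p] by simp
      ultimately have "((\<lambda>t. \<bar>\<phi> (x + t *\<^sub>R axis j 1)\<bar> powr p) has_real_derivative
          p * \<bar>\<phi> x\<bar> powr (p - 1) * sgn (\<phi> x) * pd j \<phi> x) (at 0)"
        by (rule DERIV_chain2[rotated])
      moreover have "((\<lambda>t. (x + t *\<^sub>R axis j 1) $ j) has_real_derivative 1) (at 0)"
        by (auto intro!: derivative_eq_intros simp: axis_def)
      ultimately show ?thesis
        by (rule DERIV_cong[OF DERIV_mult[rotated]]) (simp add: g_def)
    qed
  qed auto
  have int3: "integrable lborel (\<lambda>x. x $ j * (p * \<bar>\<phi> x\<bar> powr (p - 1) * sgn (\<phi> x) * pd j \<phi> x))"
    by (rule Bochner_Integration.integrable_bound[where f="\<lambda>x. (\<bar>\<phi> x\<bar> powr p + (2 * (p * R)) powr p * \<bar>pd j \<phi> x\<bar> powr p) / 2"])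
       (use int1 int2 bd in \<open>auto intro!: AE_I2 order_trans[OF _ abs_ge_self] simp del: times_divide_eq_right\<close>)
  \<comment> \<open>The derivative \<open>g\<close> integrates to 0, and half of the integral of
    |\<phi>|^p reappears on the right; moving it to the left leaves the constant (2 p R)^p.\<close>
  have "(LINT x|lborel. \<bar>\<phi> x\<bar> powr p) = - (LINT x|lborel. x $ j * (p * \<bar>\<phi> x\<bar> powr (p - 1) * sgn (\<phi> x) * pd j \<phi> x))"
    using g_int Bochner_Integration.integral_add[OF int1 int3] by (simp add: g_def)
  also have "\<dots> \<le> (LINT x|lborel. (\<bar>\<phi> x\<bar> powr p + (2 * (p * R)) powr p * \<bar>pd j \<phi> x\<bar> powr p) / 2)"
    unfolding Bochner_Integration.integral_minus[symmetric]
    by (intro integral_mono order_trans[OF abs_ge_minus_self bd]) (use int1 int2 int3 in auto)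
  also have "\<dots> = ((LINT x|lborel. \<bar>\<phi> x\<bar> powr p) + (2 * (p * R)) powr p * (LINT x|lborel. \<bar>pd j \<phi> x\<bar> powr p)) / 2"
    using int1 int2 by simp
  finally show ?thesis by (simp add: mult.assoc)
qed

section \<open>Translations and mollification in \<open>L\<^sup>p\<close>\<close>

text \<open>Compact inner regularity is used for a finite measure, namely Lebesgue measure
  restricted to \<open>A\<close>. A null set is treated apart because the strict inequality
  \<open>emeasure lborel A - e < emeasure lborel A\<close> fails for it.\<close>

lemma inner_compact_lborel:
  fixes A :: "'a::euclidean_space set"
  assumes A[measurable]: "A \<in> sets borel" and fin: "emeasure lborel A < \<infinity>" and "0 < (e::real)"
  obtains K where "compact K" "K \<subseteq> A" "emeasure lborel (A - K) < e"
proof (cases "emeasure lborel A = 0")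
  case True then show ?thesis using that[of "{}"] assms by simp
next
  case False
  let ?M = "density lborel (indicator A)"
  have em: "emeasure ?M X = emeasure lborel (A \<inter> X)" if "X \<in> sets borel" for X
    using that by (simp add: emeasure_density indicator_inter_arith[symmetric])
  have "emeasure ?M (space ?M) \<noteq> \<infinity>" using em[of UNIV] fin by simp
  then have "emeasure ?M A = (SUP K \<in> {K. K \<subseteq> A \<and> compact K}. emeasure ?M K)"
    by (intro inner_regular) auto
  moreover have "emeasure lborel A - e < emeasure lborel A"
    using fin False \<open>0 < e\<close> by (intro ennreal_between) (auto simp: zero_less_iff_neq_zero)
  ultimately obtain K where K: "K \<subseteq> A" "compact K" "emeasure lborel A - e < emeasure ?M K"
    using em[OF A] by (auto simp: less_SUP_iff)
  have [measurable]: "K \<in> sets borel" using K by (simp add: borel_compact)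
  have "A \<inter> K = K" using K by auto
  then have *: "emeasure lborel A - e < emeasure lborel K" using K em[of K] by simp
  have kf: "emeasure lborel K < \<infinity>" using K emeasure_mono[of K A lborel] fin by (auto intro: le_less_trans)
  have "emeasure lborel (A - K) = emeasure lborel A - emeasure lborel K"
    using K kf by (intro emeasure_Diff) auto
  also have "\<dots> < e"
  proof -
    obtain a where a: "emeasure lborel A = ennreal a" "a \<ge> 0" using fin by (cases "emeasure lborel A") auto
    obtain b where b: "emeasure lborel K = ennreal b" "b \<ge> 0" using kf by (cases "emeasure lborel K") auto
    have "a - e < b" using * \<open>0 < e\<close> unfolding a b
      by (cases "a \<ge> e") (use a b in \<open>auto simp: ennreal_minus ennreal_less_iff\<close>)
    then show ?thesis using \<open>0 < e\<close> unfolding a b by (simp add: ennreal_minus b ennreal_lessI)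
  qed
  finally show ?thesis using that K by blast
qed

text \<open>Squeeze \<open>A\<close> between a compact \<open>K\<close> and an open
  \<open>U\<close>. If |h| is below the distance from \<open>K\<close> to the complement of
  \<open>U\<close>, a point x whose membership in \<open>A\<close> changes under the shift has x or
  x + h in \<open>U - K\<close>.\<close>

lemma translation_indicator_L1:
  fixes A :: "'a::euclidean_space set"
  assumes A[measurable]: "A \<in> sets borel" and fin: "emeasure lborel A < \<infinity>" and e: "0 < (e::real)"
  shows "\<exists>d>0. \<forall>h. norm h < d \<longrightarrow>
    (\<integral>\<^sup>+x. ennreal \<bar>indicator A (x + h) - indicator A x\<bar> \<partial>lborel) \<le> ennreal e"
proof -
  obtain K where K: "compact K" "K \<subseteq> A" "emeasure lborel (A - K) < e/4"
    using inner_compact_lborel[OF A fin, of "e/4"] e by auto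
  obtain U where U: "open U" "A \<subseteq> U" "emeasure lborel (U - A) < e/4"
    using outer_regular_lborel[OF A, of "e/4"] e by auto
  have [measurable]: "K \<in> sets borel" "U \<in> sets borel" using K U by (auto simp: borel_compact)
  have "emeasure lborel (U - K) \<le> emeasure lborel (U - A) + emeasure lborel (A - K)"
    using U K by (intro order_trans[OF _ emeasure_subadditive] emeasure_mono) auto
  also have "\<dots> \<le> ennreal (e/4) + ennreal (e/4)" using U K by (intro add_mono) auto
  also have "\<dots> = ennreal (e/2)" using e by (simp add: ennreal_plus[symmetric] del: ennreal_plus)
  finally have UK: "emeasure lborel (U - K) \<le> ennreal (e/2)" .
  obtain d where d: "d > 0" "\<And>x y. x \<in> K \<Longrightarrow> y \<in> - U \<Longrightarrow> d \<le> dist x y"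
    using separate_compact_closed[OF K(1), of "- U"] U K by (metis Compl_disjoint closed_Compl disjoint_eq_subset_Compl double_complement order_trans)
  have near: "y \<in> U" if "x \<in> K" "dist x y < d" for x y using d(2)[of x y] that by force
  show ?thesis
  proof (intro exI[of _ d] conjI allI impI)
    fix h :: 'a assume h: "norm h < d"
    have le: "ennreal \<bar>indicator A (x + h) - indicator A x\<bar> \<le> indicator (U - K) (x + h) + indicator (U - K) x" for x
      using near[of x "x + h"] near[of "x + h" x] h U K
      by (auto simp: indicator_def dist_norm)
    have "(\<integral>\<^sup>+x. ennreal \<bar>indicator A (x + h) - indicator A x\<bar> \<partial>lborel)
       \<le> (\<integral>\<^sup>+x. indicator (U - K) (x + h) + indicator (U - K) x \<partial>lborel)"
      by (intro nn_integral_mono le)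
    also have "\<dots> = (\<integral>\<^sup>+x. indicator (U - K) (x + h) \<partial>lborel) + (\<integral>\<^sup>+x. indicator (U - K) x \<partial>lborel)"
      by (intro nn_integral_add) auto
    also have "\<dots> = 2 * emeasure lborel (U - K)"
      by (subst nn_integral_lborel_shift) (auto simp: mult_2)
    also have "\<dots> \<le> 2 * ennreal (e/2)" using UK by (intro mult_left_mono) auto
    also have "\<dots> = ennreal e" using e by (simp flip: ennreal_numeral ennreal_mult')
    finally show "(\<integral>\<^sup>+x. ennreal \<bar>indicator A (x + h) - indicator A x\<bar> \<partial>lborel) \<le> ennreal e" .
  qed (rule d(1))
qed

text \<open>The induction rule for integrable functions reduces this to indicators, sums and
  dominated limits; in the last case the shifted error has the same integral as the unshifted one by
  translation invariance.\<close>

lemma translation_continuous_L1: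
  fixes f :: "'a::euclidean_space \<Rightarrow> real"
  assumes "integrable lborel f"
  shows "\<forall>e>0. \<exists>d>0. \<forall>h. norm h < d \<longrightarrow>
    (\<integral>\<^sup>+x. ennreal \<bar>f (x + h) - f x\<bar> \<partial>lborel) \<le> ennreal e"
  using assms
proof induction
  case (base A c)
  show ?case
  proof (intro allI impI)
    fix e :: real assume e: "e > 0"
    have A: "A \<in> sets borel" using base by simp
    then have [measurable]: "A \<in> sets borel" .
    obtain d where d: "d > 0" "\<And>h. norm h < d \<Longrightarrow>
        (\<integral>\<^sup>+x. ennreal \<bar>indicator A (x + h) - indicator A x\<bar> \<partial>lborel) \<le> ennreal (e / (\<bar>c\<bar> + 1))"
      using translation_indicator_L1[OF A base(2), of "e / (\<bar>c\<bar> + 1)"] e by auto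
    show "\<exists>d>0. \<forall>h. norm h < d \<longrightarrow>
      (\<integral>\<^sup>+x. ennreal \<bar>indicator A (x + h) *\<^sub>R c - indicator A x *\<^sub>R c\<bar> \<partial>lborel) \<le> ennreal e"
    proof (intro exI[of _ d] conjI allI impI)
      fix h :: 'a assume h: "norm h < d"
      have "(\<integral>\<^sup>+x. ennreal \<bar>indicator A (x + h) *\<^sub>R c - indicator A x *\<^sub>R c\<bar> \<partial>lborel)
        = (\<integral>\<^sup>+x. ennreal \<bar>c\<bar> * ennreal \<bar>indicator A (x + h) - indicator A x\<bar> \<partial>lborel)"
        by (simp add: ennreal_mult'[symmetric] abs_mult[symmetric] algebra_simps)
      also have "\<dots> = ennreal \<bar>c\<bar> * (\<integral>\<^sup>+x. ennreal \<bar>indicator A (x + h) - indicator A x\<bar> \<partial>lborel)"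
        by (intro nn_integral_cmult) auto
      also have "\<dots> \<le> ennreal \<bar>c\<bar> * ennreal (e / (\<bar>c\<bar> + 1))" using d h by (intro mult_left_mono) auto
      also have "\<dots> \<le> ennreal e" using e by (simp add: ennreal_mult'[symmetric] field_simps)
      finally show "(\<integral>\<^sup>+x. ennreal \<bar>indicator A (x + h) *\<^sub>R c - indicator A x *\<^sub>R c\<bar> \<partial>lborel) \<le> ennreal e" .
    qed (rule d(1))
  qed
next
  case (add f g)
  have [measurable]: "f \<in> borel_measurable borel" "g \<in> borel_measurable borel"
    using add by auto
  show ?case
  proof (intro allI impI)
    fix e :: real assume e: "e > 0"
    obtain d1 where d1: "d1 > 0" "\<And>h. norm h < d1 \<Longrightarrow> (\<integral>\<^sup>+x. ennreal \<bar>f (x + h) - f x\<bar> \<partial>lborel) \<le> ennreal (e/2)"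
      using add.IH(1) e by (meson half_gt_zero)
    obtain d2 where d2: "d2 > 0" "\<And>h. norm h < d2 \<Longrightarrow> (\<integral>\<^sup>+x. ennreal \<bar>g (x + h) - g x\<bar> \<partial>lborel) \<le> ennreal (e/2)"
      using add.IH(2) e by (meson half_gt_zero)
    show "\<exists>d>0. \<forall>h. norm h < d \<longrightarrow>
      (\<integral>\<^sup>+x. ennreal \<bar>f (x + h) + g (x + h) - (f x + g x)\<bar> \<partial>lborel) \<le> ennreal e"
    proof (intro exI[of _ "min d1 d2"] conjI allI impI)
      fix h :: 'a assume h: "norm h < min d1 d2"
      have "(\<integral>\<^sup>+x. ennreal \<bar>f (x + h) + g (x + h) - (f x + g x)\<bar> \<partial>lborel)
        \<le> (\<integral>\<^sup>+x. ennreal \<bar>f (x + h) - f x\<bar> + ennreal \<bar>g (x + h) - g x\<bar> \<partial>lborel)"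
        by (intro nn_integral_mono) (auto simp: ennreal_plus[symmetric] simp del: ennreal_plus intro!: ennreal_leI)
      also have "\<dots> = (\<integral>\<^sup>+x. ennreal \<bar>f (x + h) - f x\<bar> \<partial>lborel) + (\<integral>\<^sup>+x. ennreal \<bar>g (x + h) - g x\<bar> \<partial>lborel)"
        by (intro nn_integral_add) auto
      also have "\<dots> \<le> ennreal (e/2) + ennreal (e/2)" using d1 d2 h by (intro add_mono) auto
      also have "\<dots> = ennreal e" using e by (simp add: ennreal_plus[symmetric] del: ennreal_plus)
      finally show "(\<integral>\<^sup>+x. ennreal \<bar>f (x + h) + g (x + h) - (f x + g x)\<bar> \<partial>lborel) \<le> ennreal e" .
    qed (use d1 d2 in auto)
  qed
next
  case (lim f s)
  have [measurable]: "f \<in> borel_measurable borel" "s i \<in> borel_measurable borel" for i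
    using lim by auto
  show ?case
  proof (intro allI impI)
    fix e :: real assume e: "e > 0"
    have "(\<lambda>i. \<integral>\<^sup>+x. ennreal (norm (f x - s i x)) \<partial>lborel) \<longlonglongrightarrow> 0"
    proof (rule nn_integral_dominated_convergence_norm[where w="\<lambda>x. 2 * norm (f x)"])
      show "(\<integral>\<^sup>+x. ennreal (2 * norm (f x)) \<partial>lborel) < \<infinity>"
        using \<open>integrable lborel f\<close> integrable_iff_bounded[of lborel "\<lambda>x. 2 * f x"] by (auto simp: abs_mult)
    qed (use lim in auto)
    then have "\<forall>\<^sub>F i in sequentially. (\<integral>\<^sup>+x. ennreal (norm (f x - s i x)) \<partial>lborel) < ennreal (e/3)"
      using e by (intro order_tendstoD) auto
    then obtain i where i: "(\<integral>\<^sup>+x. ennreal \<bar>f x - s i x\<bar> \<partial>lborel) < ennreal (e/3)"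
      by (auto simp: eventually_sequentially)
    obtain d where d: "d > 0" "\<And>h. norm h < d \<Longrightarrow> (\<integral>\<^sup>+x. ennreal \<bar>s i (x + h) - s i x\<bar> \<partial>lborel) \<le> ennreal (e/3)"
      using lim.IH[of i] e by (meson divide_pos_pos zero_less_numeral)
    show "\<exists>d>0. \<forall>h. norm h < d \<longrightarrow> (\<integral>\<^sup>+x. ennreal \<bar>f (x + h) - f x\<bar> \<partial>lborel) \<le> ennreal e"
    proof (intro exI[of _ d] conjI allI impI)
      fix h :: 'a assume h: "norm h < d"
      have "(\<integral>\<^sup>+x. ennreal \<bar>f (x + h) - f x\<bar> \<partial>lborel)
        \<le> (\<integral>\<^sup>+x. (ennreal \<bar>f (x + h) - s i (x + h)\<bar> + ennreal \<bar>s i (x + h) - s i x\<bar>) + ennreal \<bar>f x - s i x\<bar> \<partial>lborel)"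
        by (intro nn_integral_mono) (auto simp: ennreal_plus[symmetric] simp del: ennreal_plus intro!: ennreal_leI)
      also have "\<dots> = ((\<integral>\<^sup>+x. ennreal \<bar>f (x + h) - s i (x + h)\<bar> \<partial>lborel) + (\<integral>\<^sup>+x. ennreal \<bar>s i (x + h) - s i x\<bar> \<partial>lborel))
          + (\<integral>\<^sup>+x. ennreal \<bar>f x - s i x\<bar> \<partial>lborel)"
        by (subst nn_integral_add; (subst nn_integral_add)?) auto
      also have "(\<integral>\<^sup>+x. ennreal \<bar>f (x + h) - s i (x + h)\<bar> \<partial>lborel) = (\<integral>\<^sup>+x. ennreal \<bar>f x - s i x\<bar> \<partial>lborel)"
        by (rule nn_integral_lborel_shift[where f="\<lambda>x. ennreal \<bar>f x - s i x\<bar>"]) auto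
      also have "(\<integral>\<^sup>+x. ennreal \<bar>f x - s i x\<bar> \<partial>lborel) + (\<integral>\<^sup>+x. ennreal \<bar>s i (x + h) - s i x\<bar> \<partial>lborel)
          + (\<integral>\<^sup>+x. ennreal \<bar>f x - s i x\<bar> \<partial>lborel) \<le> (ennreal (e/3) + ennreal (e/3)) + ennreal (e/3)"
        using d h i by (intro add_mono) auto
      also have "\<dots> = ennreal e" using e by (simp add: ennreal_plus[symmetric] del: ennreal_plus)
      finally show "(\<integral>\<^sup>+x. ennreal \<bar>f (x + h) - f x\<bar> \<partial>lborel) \<le> ennreal e" .
    qed (rule d(1))
  qed
qed

lemma powr_superadditive:
  fixes s t p :: real
  assumes "0 \<le> s" "0 \<le> t" "1 \<le> p" shows "s powr p + t powr p \<le> (s + t) powr p"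
proof (cases "s = 0 \<or> t = 0")
  case False
  then have pos: "s > 0" "t > 0" using assms by auto
  have "s powr p + t powr p = s * s powr (p - 1) + t * t powr (p - 1)"
    using pos by (simp add: powr_diff)
  also have "\<dots> \<le> s * (s + t) powr (p - 1) + t * (s + t) powr (p - 1)"
    using pos assms by (intro add_mono mult_left_mono powr_mono2) auto
  also have "\<dots> = (s + t) * (s + t) powr (p - 1)" by (simp add: algebra_simps)
  also have "\<dots> = (s + t) powr p" using pos by (simp add: powr_diff)
  finally show ?thesis .
qed auto

lemma powr_add_le:
  fixes s t p :: real
  assumes "0 \<le> s" "0 \<le> t" "0 \<le> p" shows "(s + t) powr p \<le> 2 powr p * (s powr p + t powr p)"
proof -
  have "(s + t) powr p \<le> (2 * max s t) powr p" using assms by (intro powr_mono2) auto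
  also have "\<dots> = 2 powr p * (max s t) powr p" using assms by (simp add: powr_mult)
  also have "\<dots> \<le> 2 powr p * (s powr p + t powr p)" by (intro mult_left_mono) (auto simp: max_def)
  finally show ?thesis .
qed

text \<open>Composition with \<open>signed_powr p\<close> turns \<open>L\<^sup>p\<close> functions into \<open>L\<^sup>1\<close> functions and reduces
  continuity of translations in \<open>L\<^sup>p\<close> to the case of \<open>L\<^sup>1\<close>.\<close>

definition signed_powr :: "real \<Rightarrow> real \<Rightarrow> real" where
  "signed_powr p a = sgn a * \<bar>a\<bar> powr p"

text \<open>For equal signs, superadditivity of the power gives the constant 1. For opposite signs
  |a - b| = |a| + |b|, and \<open>powr_add_le\<close> costs the factor 2^p.\<close>

lemma powr_abs_diff_le_signed:
  fixes a b p :: real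
  assumes p: "1 \<le> p"
  shows "\<bar>a - b\<bar> powr p \<le> 2 powr p * \<bar>signed_powr p a - signed_powr p b\<bar>"
proof -
  have two: "1 \<le> 2 powr p" using p by (simp add: ge_one_powr_ge_zero)
  have same: "\<bar>a - b\<bar> powr p \<le> a powr p - b powr p" if "0 \<le> b" "b \<le> a" for a b :: real
    using powr_superadditive[of "a - b" b p] that p by simp
  have base: "\<bar>a - b\<bar> powr p \<le> 2 powr p * \<bar>signed_powr p a - signed_powr p b\<bar>" if "b \<le> a" for a b
  proof -
    consider "0 \<le> b" | "a \<le> 0" | "b < 0" "0 < a" using \<open>b \<le> a\<close> by linarith
    then show ?thesis
    proof cases
      case 1
      then have "\<bar>a - b\<bar> powr p \<le> signed_powr p a - signed_powr p b"
        using same[of b a] that by (auto simp: signed_powr_def sgn_if)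
      also have "\<dots> \<le> 1 * \<bar>signed_powr p a - signed_powr p b\<bar>" by simp
      also have "\<dots> \<le> 2 powr p * \<bar>signed_powr p a - signed_powr p b\<bar>" using two by (intro mult_right_mono) auto
      finally show ?thesis .
    next
      case 2
      then have "\<bar>a - b\<bar> powr p \<le> signed_powr p a - signed_powr p b"
        using same[of "-a" "-b"] that by (auto simp: signed_powr_def sgn_if)
      also have "\<dots> \<le> 1 * \<bar>signed_powr p a - signed_powr p b\<bar>" by simp
      also have "\<dots> \<le> 2 powr p * \<bar>signed_powr p a - signed_powr p b\<bar>" using two by (intro mult_right_mono) auto
      finally show ?thesis .
    next
      case 3
      then have "\<bar>a - b\<bar> powr p \<le> 2 powr p * (a powr p + (-b) powr p)"
        using powr_add_le[of a "-b" p] p by simp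
      then show ?thesis using 3 by (simp add: signed_powr_def)
    qed
  qed
  show ?thesis using base[of a b] base[of b a] by (cases "b \<le> a") (auto simp: abs_minus_commute)
qed

lemma signed_powr_measurable[measurable]: "signed_powr p \<in> borel_measurable borel"
  unfolding signed_powr_def[abs_def] by measurable

lemma translation_continuous_Lp:
  fixes f :: "'a::euclidean_space \<Rightarrow> real"
  assumes f[measurable]: "f \<in> borel_measurable borel" and int: "integrable lborel (\<lambda>x. \<bar>f x\<bar> powr p)"
    and p: "1 \<le> p" and e: "e > 0"
  shows "\<exists>d>0. \<forall>h. norm h < d \<longrightarrow>
    (\<integral>\<^sup>+x. ennreal (\<bar>f (x + h) - f x\<bar> powr p) \<partial>lborel) \<le> ennreal e"
proof -
  have "integrable lborel (\<lambda>x. signed_powr p (f x))"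
    by (rule Bochner_Integration.integrable_bound[OF int]) (auto simp: signed_powr_def abs_mult abs_sgn_eq)
  from translation_continuous_L1[OF this, rule_format, of "e / 2 powr p"] e
  obtain d where d: "d > 0" "\<And>h. norm h < d \<Longrightarrow>
    (\<integral>\<^sup>+x. ennreal \<bar>signed_powr p (f (x + h)) - signed_powr p (f x)\<bar> \<partial>lborel) \<le> ennreal (e / 2 powr p)"
    by auto
  show ?thesis
  proof (intro exI[of _ d] conjI allI impI)
    fix h :: 'a assume h: "norm h < d"
    have "(\<integral>\<^sup>+x. ennreal (\<bar>f (x + h) - f x\<bar> powr p) \<partial>lborel)
      \<le> (\<integral>\<^sup>+x. ennreal (2 powr p) * ennreal \<bar>signed_powr p (f (x + h)) - signed_powr p (f x)\<bar> \<partial>lborel)"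
      by (intro nn_integral_mono) (auto simp: ennreal_mult'[symmetric] intro!: ennreal_leI powr_abs_diff_le_signed p)
    also have "\<dots> = ennreal (2 powr p) * (\<integral>\<^sup>+x. ennreal \<bar>signed_powr p (f (x + h)) - signed_powr p (f x)\<bar> \<partial>lborel)"
      by (intro nn_integral_cmult) auto
    also have "\<dots> \<le> ennreal (2 powr p) * ennreal (e / 2 powr p)" using d h by (intro mult_left_mono) auto
    also have "\<dots> = ennreal e" using e by (simp add: ennreal_mult'[symmetric])
    finally show "(\<integral>\<^sup>+x. ennreal (\<bar>f (x + h) - f x\<bar> powr p) \<partial>lborel) \<le> ennreal e" .
  qed (rule d(1))
qed

text \<open>The tangent at \<open>m\<close> of the convex power function. Averaged against weights
  of mass 1 it gives Jensen's inequality, both for integrals and for finite sums. At t = 0, outside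
  the open half-line of the convexity argument, the bound is checked by hand.\<close>

lemma powr_tangent:
  fixes t m p :: real
  assumes "0 \<le> t" "0 < m" "1 \<le> p"
  shows "m powr p + p * m powr (p - 1) * (t - m) \<le> t powr p"
proof (cases "t = 0")
  case True
  have "m powr p = m powr (p - 1) * m" using assms by (simp add: powr_diff)
  moreover have "1 * (m powr (p - 1) * m) \<le> p * (m powr (p - 1) * m)" using assms by (intro mult_right_mono) auto
  ultimately show ?thesis using True assms by (simp add: algebra_simps)
next
  case False
  have "t powr p - m powr p \<ge> p * m powr (p - 1) * (t - m)"
  proof (rule convex_on_imp_above_tangent[where A = "{0<..}"])
    show "convex_on {0<..} (\<lambda>x. x powr p)" using assms by (intro powr_convex) auto
    show "((\<lambda>x. x powr p) has_real_derivative p * m powr (p - 1)) (at m within {0<..})"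
      using assms by (auto intro!: derivative_eq_intros)
  qed (use assms False in \<open>auto simp: interior_open\<close>)
  then show ?thesis by simp
qed

text \<open>A non-integrable product has integral \<open>0\<close>, so its integrability is not assumed.\<close>

lemma jensen_powr_kernel:
  fixes h \<eta> :: "'a \<Rightarrow> real"
  assumes [measurable]: "h \<in> borel_measurable M" and int: "integrable M \<eta>"
    and nn: "\<And>x. 0 \<le> \<eta> x" and one: "(LINT x|M. \<eta> x) = 1" and p: "1 \<le> p"
  shows "ennreal (\<bar>LINT x|M. h x * \<eta> x\<bar> powr p) \<le> (\<integral>\<^sup>+x. ennreal (\<bar>h x\<bar> powr p * \<eta> x) \<partial>M)"
proof (cases "integrable M (\<lambda>x. h x * \<eta> x) \<and> (\<integral>\<^sup>+x. ennreal (\<bar>h x\<bar> powr p * \<eta> x) \<partial>M) < \<infinity> \<and> (LINT x|M. h x * \<eta> x) \<noteq> 0")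
  case True
  have [measurable]: "\<eta> \<in> borel_measurable M" using int by auto
  have int2: "integrable M (\<lambda>x. \<bar>h x\<bar> powr p * \<eta> x)"
    using True nn by (intro integrableI_bounded) auto
  have int3: "integrable M (\<lambda>x. \<bar>h x\<bar> * \<eta> x)"
    using integrable_abs[of M "\<lambda>x. h x * \<eta> x"] True nn by (simp add: abs_mult)
  define m where "m = \<bar>LINT x|M. h x * \<eta> x\<bar>"
  have m: "m > 0" using True by (simp add: m_def)
  have m_le: "m \<le> (LINT x|M. \<bar>h x\<bar> * \<eta> x)"
    unfolding m_def using integral_abs_bound[of M "\<lambda>x. h x * \<eta> x"] nn by (simp add: abs_mult)
  let ?k = "p * m powr (p - 1)"
  \<comment> \<open>\<open>m\<close> is the modulus of the mean of \<open>h\<close>, hence at most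
    the mean of |h|, so the added tangent term is nonnegative; integrating the tangent inequality at
    \<open>m\<close> finishes the estimate.\<close>
  have "m powr p \<le> m powr p + ?k * ((LINT x|M. \<bar>h x\<bar> * \<eta> x) - m)"
    using m_le p by simp
  also have "\<dots> = (m powr p - ?k * m) * (LINT x|M. \<eta> x) + ?k * (LINT x|M. \<bar>h x\<bar> * \<eta> x)"
    unfolding one by (simp add: algebra_simps)
  also have "\<dots> = (LINT x|M. (m powr p - ?k * m) * \<eta> x + ?k * (\<bar>h x\<bar> * \<eta> x))"
    using int int3 by simp
  also have "\<dots> \<le> (LINT x|M. \<bar>h x\<bar> powr p * \<eta> x)"
  proof (intro integral_mono)
    fix x
    have "(m powr p + ?k * (\<bar>h x\<bar> - m)) * \<eta> x \<le> \<bar>h x\<bar> powr p * \<eta> x"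
      using m p nn by (intro mult_right_mono powr_tangent) auto
    then show "(m powr p - ?k * m) * \<eta> x + ?k * (\<bar>h x\<bar> * \<eta> x) \<le> \<bar>h x\<bar> powr p * \<eta> x"
      by (simp add: algebra_simps)
  qed (use int int2 int3 in auto)
  finally show ?thesis
    unfolding m_def[symmetric] using int2 nn by (subst nn_integral_eq_integral) (auto intro: ennreal_leI)
next
  case False
  then show ?thesis by (auto simp: not_integrable_integral_eq top_unique not_less)
qed

text \<open>Convolution, written so that \<open>x\<close> occurs only in the kernel: derivatives in
  \<open>x\<close> fall on the kernel, and \<open>u\<close> need only be integrable.\<close>

definition mollify :: "('a::euclidean_space \<Rightarrow> real) \<Rightarrow> ('a \<Rightarrow> real) \<Rightarrow> 'a \<Rightarrow> real" where
  "mollify u \<eta> x = (LINT y|lborel. u y * \<eta> (x - y))"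

text \<open>The centre \<open>a\<close> is a parameter: approximation asks for support in a small
  ball around 0, whereas keeping the mollified function inside \<Omega> asks for support in an
  off-centre ball.\<close>

definition smooth_kernel :: "real^'n::finite \<Rightarrow> real \<Rightarrow> (real^'n \<Rightarrow> real) \<Rightarrow> bool" where
  "smooth_kernel a r \<eta> \<longleftrightarrow> test_fun UNIV \<eta> \<and> (\<forall>x. 0 \<le> \<eta> x) \<and> (LINT x|lborel. \<eta> x) = 1
     \<and> (\<forall>x. \<eta> x \<noteq> 0 \<longrightarrow> x \<in> ball a r)"

lemma integrable_mult_bounded:
  fixes u \<eta> :: "'a \<Rightarrow> real"
  assumes "integrable M u" "\<eta> \<in> borel_measurable M" "\<And>x. \<bar>\<eta> x\<bar> \<le> B"
  shows "integrable M (\<lambda>x. u x * \<eta> x)"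
proof (rule Bochner_Integration.integrable_bound)
  show "integrable M (\<lambda>x. B * u x)" using assms by simp
  show "AE x in M. norm (u x * \<eta> x) \<le> norm (B * u x)"
  proof (intro AE_I2)
    fix x have "\<bar>u x\<bar> * \<bar>\<eta> x\<bar> \<le> \<bar>u x\<bar> * \<bar>B\<bar>" using assms(3)[of x] by (intro mult_left_mono) auto
    then show "norm (u x * \<eta> x) \<le> norm (B * u x)" by (simp add: abs_mult mult.commute)
  qed
qed (use assms in measurable)

lemma mollify_reflect:
  assumes [measurable]: "u \<in> borel_measurable borel" "\<eta> \<in> borel_measurable borel"
  shows "mollify u \<eta> x = (LINT z|lborel. u (x - z) * \<eta> z)"
  using integral_lborel_reflect[of "\<lambda>z. u (x - z) * \<eta> z" x] by (simp add: mollify_def)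

lemma mollify_measurable:
  assumes [measurable]: "u \<in> borel_measurable borel" "\<eta> \<in> borel_measurable borel"
  shows "mollify u \<eta> \<in> borel_measurable borel"
  unfolding mollify_def[abs_def] by measurable

text \<open>Since the kernel has mass 1, the error is a weighted mean of u(x - z) - u(x). Jensen's
  inequality and Fubini bound the integral of its p-th power by a mean of translation errors with
  |z| < r.\<close>

lemma mollify_diff_Lp_le:
  fixes u :: "real^'n::finite \<Rightarrow> real"
  assumes u: "integrable lborel u" and k: "smooth_kernel 0 r \<eta>" and p: "1 \<le> p"
    and E: "\<And>h. norm h < r \<Longrightarrow> (\<integral>\<^sup>+x. ennreal (\<bar>u (x + h) - u x\<bar> powr p) \<partial>lborel) \<le> ennreal E"
  shows "(\<integral>\<^sup>+x. ennreal (\<bar>mollify u \<eta> x - u x\<bar> powr p) \<partial>lborel) \<le> ennreal E"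
proof -
  have \<eta>: "test_fun UNIV \<eta>" "\<And>x. 0 \<le> \<eta> x" "(LINT x|lborel. \<eta> x) = 1" "\<And>x. \<eta> x \<noteq> 0 \<Longrightarrow> norm x < r"
    using k by (auto simp: smooth_kernel_def)
  have int: "integrable lborel \<eta>" by (rule test_fun_integrable[OF \<eta>(1)])
  have um[measurable]: "u \<in> borel_measurable borel" and em[measurable]: "\<eta> \<in> borel_measurable borel"
    using u int by auto
  obtain B where B: "\<And>x. \<bar>\<eta> x\<bar> \<le> B" using test_fun_bounded[OF \<eta>(1)] by metis
  have eq: "mollify u \<eta> x - u x = (LINT z|lborel. (u (x - z) - u x) * \<eta> z)" for x
  proof -
    have "integrable lborel (\<lambda>y. u y * \<eta> (x - y))" using B by (intro integrable_mult_bounded u) auto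
    then have "integrable (distr lborel borel (\<lambda>y. x - y)) (\<lambda>y. u y * \<eta> (x - y))"
      by (simp add: lborel_distr_reflect)
    then have i: "integrable lborel (\<lambda>z. u (x - z) * \<eta> z)"
      by (subst (asm) integrable_distr_eq) auto
    have "(LINT z|lborel. (u (x - z) - u x) * \<eta> z) = (LINT z|lborel. u (x - z) * \<eta> z - u x * \<eta> z)"
      by (simp add: algebra_simps)
    also have "\<dots> = (LINT z|lborel. u (x - z) * \<eta> z) - (LINT z|lborel. u x * \<eta> z)"
      by (rule Bochner_Integration.integral_diff[OF i]) (use int in simp)
    finally show ?thesis using \<eta>(3) by (simp add: mollify_reflect)
  qed
  have "(\<integral>\<^sup>+x. ennreal (\<bar>mollify u \<eta> x - u x\<bar> powr p) \<partial>lborel)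
    \<le> (\<integral>\<^sup>+x. (\<integral>\<^sup>+z. ennreal (\<bar>u (x - z) - u x\<bar> powr p * \<eta> z) \<partial>lborel) \<partial>lborel)"
    unfolding eq using int \<eta> p by (intro nn_integral_mono jensen_powr_kernel) auto
  also have "\<dots> = (\<integral>\<^sup>+z. (\<integral>\<^sup>+x. ennreal (\<bar>u (x - z) - u x\<bar> powr p * \<eta> z) \<partial>lborel) \<partial>lborel)"
    by (rule lborel_pair.Fubini'[symmetric]) measurable
  also have "\<dots> \<le> (\<integral>\<^sup>+z. ennreal E * ennreal (\<eta> z) \<partial>lborel)"
  proof (intro nn_integral_mono)
    fix z :: "real^'n"
    have "(\<integral>\<^sup>+x. ennreal (\<bar>u (x - z) - u x\<bar> powr p * \<eta> z) \<partial>lborel)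
       = (\<integral>\<^sup>+x. ennreal (\<bar>u (x + (- z)) - u x\<bar> powr p) \<partial>lborel) * ennreal (\<eta> z)"
      using \<eta>(2) by (subst nn_integral_multc[symmetric]) (auto simp: ennreal_mult')
    also have "\<dots> \<le> ennreal E * ennreal (\<eta> z)"
      using E[of "- z"] \<eta>(4)[of z] by (cases "\<eta> z = 0") (auto intro!: mult_right_mono)
    finally show "(\<integral>\<^sup>+x. ennreal (\<bar>u (x - z) - u x\<bar> powr p * \<eta> z) \<partial>lborel) \<le> ennreal E * ennreal (\<eta> z)" .
  qed
  also have "\<dots> = ennreal E * (\<integral>\<^sup>+z. ennreal (\<eta> z) \<partial>lborel)" by (intro nn_integral_cmult) auto
  also have "(\<integral>\<^sup>+z. ennreal (\<eta> z) \<partial>lborel) = 1"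
    using int \<eta> by (subst nn_integral_eq_integral) auto
  finally show ?thesis by simp
qed

text \<open>The radius \<open>d\<close> is uniform over all kernels supported in that ball. A single
  kernel, possibly off-centre, can thus serve a function and all its weak derivatives.\<close>

lemma mollify_tendsto_Lp:
  fixes u :: "real^'n::finite \<Rightarrow> real"
  assumes u: "integrable lborel u" and up: "integrable lborel (\<lambda>x. \<bar>u x\<bar> powr p)" and p: "1 \<le> p" and e: "e > 0"
  shows "\<exists>d>0. \<forall>\<eta>. smooth_kernel 0 d \<eta> \<longrightarrow>
    (\<integral>\<^sup>+x. ennreal (\<bar>mollify u \<eta> x - u x\<bar> powr p) \<partial>lborel) \<le> ennreal e"
proof -
  have "u \<in> borel_measurable borel" using u by auto
  from translation_continuous_Lp[OF this up p e]
  obtain d where "d > 0" "\<And>h. norm h < d \<Longrightarrow>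
    (\<integral>\<^sup>+x. ennreal (\<bar>u (x + h) - u x\<bar> powr p) \<partial>lborel) \<le> ennreal e" by blast
  then show ?thesis using mollify_diff_Lp_le[OF u _ p] by blast
qed

section \<open>Mollification and weak derivatives\<close>

lemma test_fun_lipschitz:
  fixes \<phi> :: "real^'n::finite \<Rightarrow> real"
  assumes "test_fun \<Omega> \<phi>"
  obtains L where "L \<ge> 0" "\<And>x y. \<bar>\<phi> x - \<phi> y\<bar> \<le> L * norm (x - y)"
proof -
  have "\<exists>M. \<forall>x. \<bar>pd j \<phi> x\<bar> \<le> M" for j
    using test_fun_bounded[OF test_fun_pd[OF assms]] by metis
  then obtain M where M: "\<And>j x. \<bar>pd j \<phi> x\<bar> \<le> M j" by metis
  show thesis
  proof (rule that[of "\<Sum>j\<in>UNIV. M j"])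
    show "0 \<le> (\<Sum>j\<in>UNIV. M j)" using M by (intro sum_nonneg) (meson abs_ge_zero order_trans)
    fix x y
    have "norm (\<phi> x - \<phi> y) \<le> (\<Sum>j\<in>UNIV. M j) * norm (x - y)"
    proof (rule differentiable_bound[of UNIV])
      show "(\<phi> has_derivative (\<lambda>h. \<Sum>j\<in>UNIV. h $ j * pd j \<phi> z)) (at z within UNIV)" for z
        using assms by (simp add: has_derivative_pd smooth_fun_differentiable test_fun_smooth)
      show "onorm (\<lambda>h. \<Sum>j\<in>UNIV. h $ j * pd j \<phi> z) \<le> (\<Sum>j\<in>UNIV. M j)" for z
      proof (rule onorm_le)
        fix h :: "real^'n"
        have "norm (\<Sum>j\<in>UNIV. h $ j * pd j \<phi> z) \<le> (\<Sum>j\<in>UNIV. M j * norm h)"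
        proof (intro sum_norm_le)
          fix j
          have "\<bar>pd j \<phi> z\<bar> * \<bar>h $ j\<bar> \<le> M j * norm h"
            using M[where j=j and x=z] component_le_norm_cart[of h j]
            by (intro mult_mono) (auto intro: order_trans[OF abs_ge_zero])
          then show "norm (h $ j * pd j \<phi> z) \<le> M j * norm h" by (simp add: abs_mult mult.commute)
        qed
        then show "norm (\<Sum>j\<in>UNIV. h $ j * pd j \<phi> z) \<le> (\<Sum>j\<in>UNIV. M j) * norm h"
          by (simp add: sum_distrib_right)
      qed
    qed auto
    then show "\<bar>\<phi> x - \<phi> y\<bar> \<le> (\<Sum>j\<in>UNIV. M j) * norm (x - y)" by simp
  qed
qed

text \<open>The mean value inequality is applied to \<open>\<phi>\<close> minus its linear part at
  x, whose derivative is O(|h|) on the segment because the partial derivatives are Lipschitz. A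
  constant independent of x is what differentiation under the integral requires.\<close>

lemma test_fun_taylor:
  fixes \<phi> :: "real^'n::finite \<Rightarrow> real"
  assumes "test_fun \<Omega> \<phi>"
  obtains C where "C \<ge> 0"
    "\<And>x h. \<bar>\<phi> (x + h) - \<phi> x - (\<Sum>j\<in>UNIV. h $ j * pd j \<phi> x)\<bar> \<le> C * (norm h)\<^sup>2"
proof -
  have "\<exists>L. L \<ge> 0 \<and> (\<forall>x y. \<bar>pd j \<phi> x - pd j \<phi> y\<bar> \<le> L * norm (x - y))" for j
    using test_fun_lipschitz[OF test_fun_pd[OF assms]] by metis
  then obtain L where L: "\<And>j. L j \<ge> 0" "\<And>j x y. \<bar>pd j \<phi> x - pd j \<phi> y\<bar> \<le> L j * norm (x - y)" by metis
  show thesis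
  proof (rule that[of "\<Sum>j\<in>UNIV. L j"])
    show "0 \<le> (\<Sum>j\<in>UNIV. L j)" using L by (intro sum_nonneg) auto
    fix x h :: "real^'n"
    define \<psi> where "\<psi> z = \<phi> z - (\<Sum>j\<in>UNIV. z $ j * pd j \<phi> x)" for z
    have "norm (\<psi> (x + h) - \<psi> x) \<le> ((\<Sum>j\<in>UNIV. L j) * norm h) * norm (x + h - x)"
    proof (rule differentiable_bound[of "closed_segment x (x + h)"])
      fix z assume z: "z \<in> closed_segment x (x + h)"
      have "(\<phi> has_derivative (\<lambda>k. \<Sum>j\<in>UNIV. k $ j * pd j \<phi> z)) (at z within closed_segment x (x + h))"
        by (rule has_derivative_at_withinI)
          (use assms in \<open>simp add: has_derivative_pd smooth_fun_differentiable test_fun_smooth\<close>)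
      moreover have "((\<lambda>z. \<Sum>j\<in>UNIV. z $ j * pd j \<phi> x) has_derivative (\<lambda>k. \<Sum>j\<in>UNIV. k $ j * pd j \<phi> x)) (at z within closed_segment x (x + h))"
        by (intro bounded_linear_imp_has_derivative bounded_linear_sum bounded_linear_mult_const bounded_linear_vec_nth)
      ultimately show "(\<psi> has_derivative (\<lambda>k. (\<Sum>j\<in>UNIV. k $ j * pd j \<phi> z) - (\<Sum>j\<in>UNIV. k $ j * pd j \<phi> x))) (at z within closed_segment x (x + h))"
        unfolding \<psi>_def[abs_def] by (rule has_derivative_diff)
      have zx: "norm (z - x) \<le> norm h"
        using z segment_bound(1)[of z x "x + h"] by simp
      show "onorm (\<lambda>k. (\<Sum>j\<in>UNIV. k $ j * pd j \<phi> z) - (\<Sum>j\<in>UNIV. k $ j * pd j \<phi> x)) \<le> (\<Sum>j\<in>UNIV. L j) * norm h"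
      proof (rule onorm_le)
        fix k :: "real^'n"
        have "norm (\<Sum>j\<in>UNIV. k $ j * (pd j \<phi> z - pd j \<phi> x)) \<le> (\<Sum>j\<in>UNIV. L j * norm h * norm k)"
        proof (intro sum_norm_le)
          fix j
          have "\<bar>pd j \<phi> z - pd j \<phi> x\<bar> \<le> L j * norm h"
            using L(2)[of j z x] L(1)[of j] zx by (meson mult_left_mono order_trans)
          then have "\<bar>pd j \<phi> z - pd j \<phi> x\<bar> * \<bar>k $ j\<bar> \<le> L j * norm h * norm k"
            using component_le_norm_cart[of k j] L(1)[of j] by (intro mult_mono) auto
          then show "norm (k $ j * (pd j \<phi> z - pd j \<phi> x)) \<le> L j * norm h * norm k" by (simp add: abs_mult mult.commute)
        qed
        then show "norm ((\<Sum>j\<in>UNIV. k $ j * pd j \<phi> z) - (\<Sum>j\<in>UNIV. k $ j * pd j \<phi> x)) \<le> (\<Sum>j\<in>UNIV. L j) * norm h * norm k"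
          by (simp add: sum_distrib_right sum_subtractf right_diff_distrib)
      qed
    qed auto
    then show "\<bar>\<phi> (x + h) - \<phi> x - (\<Sum>j\<in>UNIV. h $ j * pd j \<phi> x)\<bar> \<le> (\<Sum>j\<in>UNIV. L j) * (norm h)\<^sup>2"
      by (simp add: \<psi>_def algebra_simps sum.distrib power2_eq_square)
  qed
qed

lemma mollify_integrand_integrable:
  fixes u \<eta> :: "real^'n::finite \<Rightarrow> real"
  assumes "integrable lborel u" "test_fun \<Omega> \<eta>"
  shows "integrable lborel (\<lambda>y. u y * \<eta> (x - y))"
proof -
  obtain B where "\<And>x. \<bar>\<eta> x\<bar> \<le> B" using test_fun_bounded[OF assms(2)] by metis
  moreover have [measurable]: "\<eta> \<in> borel_measurable borel" using assms by (auto intro: smooth_fun_borel test_fun_smooth)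
  ultimately show ?thesis by (intro integrable_mult_bounded assms) auto
qed

text \<open>The quadratic Taylor remainder of the kernel is uniform, so integrating it against |u|
  leaves C |h|^2 times the L^1 norm of \<open>u\<close>, which is o(|h|).\<close>

lemma mollify_has_derivative:
  fixes u \<eta> :: "real^'n::finite \<Rightarrow> real"
  assumes u: "integrable lborel u" and \<eta>: "test_fun \<Omega> \<eta>"
  shows "(mollify u \<eta> has_derivative (\<lambda>h. \<Sum>j\<in>UNIV. h $ j * mollify u (pd j \<eta>) x)) (at x)"
proof -
  obtain C where C: "C \<ge> 0"
    "\<And>x h. \<bar>\<eta> (x + h) - \<eta> x - (\<Sum>j\<in>UNIV. h $ j * pd j \<eta> x)\<bar> \<le> C * (norm h)\<^sup>2"
    using test_fun_taylor[OF \<eta>] by blast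
  note i = mollify_integrand_integrable[OF u \<eta>] mollify_integrand_integrable[OF u test_fun_pd[OF \<eta>]]
  let ?I = "LINT z|lborel. \<bar>u z\<bar>"
  show ?thesis
  proof (rule has_derivativeI_sandwich[where e=1 and H="\<lambda>y. C * norm (y - x) * ?I"])
    show "bounded_linear (\<lambda>h. \<Sum>j\<in>UNIV. h $ j * mollify u (pd j \<eta>) x)"
      by (intro bounded_linear_sum bounded_linear_mult_const bounded_linear_vec_nth)
    show "((\<lambda>y. C * norm (y - x) * ?I) \<longlongrightarrow> 0) (at x)"
      by (auto intro!: tendsto_eq_intros)
    fix y assume "y \<noteq> x"
    define h where "h = y - x"
    have "mollify u \<eta> y - mollify u \<eta> x - (\<Sum>j\<in>UNIV. h $ j * mollify u (pd j \<eta>) x)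
      = (LINT z|lborel. u z * \<eta> (y - z) - u z * \<eta> (x - z) - (\<Sum>j\<in>UNIV. h $ j * (u z * pd j \<eta> (x - z))))"
      using i by (simp add: mollify_def)
    also have "\<bar>\<dots>\<bar> \<le> (LINT z|lborel. C * (norm h)\<^sup>2 * \<bar>u z\<bar>)"
    proof (rule order_trans[OF integral_abs_bound], rule integral_mono)
      show "integrable lborel (\<lambda>z. C * (norm h)\<^sup>2 * \<bar>u z\<bar>)" using u by simp
      show "integrable lborel (\<lambda>z. \<bar>u z * \<eta> (y - z) - u z * \<eta> (x - z) - (\<Sum>j\<in>UNIV. h $ j * (u z * pd j \<eta> (x - z)))\<bar>)"
        using i by auto
      fix z
      have "\<bar>\<eta> (y - z) - \<eta> (x - z) - (\<Sum>j\<in>UNIV. h $ j * pd j \<eta> (x - z))\<bar> \<le> C * (norm h)\<^sup>2"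
        using C(2)[of "x - z" h] by (simp add: h_def)
      then have "\<bar>u z\<bar> * \<bar>\<eta> (y - z) - \<eta> (x - z) - (\<Sum>j\<in>UNIV. h $ j * pd j \<eta> (x - z))\<bar> \<le> \<bar>u z\<bar> * (C * (norm h)\<^sup>2)"
        by (intro mult_left_mono) auto
      then show "\<bar>u z * \<eta> (y - z) - u z * \<eta> (x - z) - (\<Sum>j\<in>UNIV. h $ j * (u z * pd j \<eta> (x - z)))\<bar> \<le> C * (norm h)\<^sup>2 * \<bar>u z\<bar>"
        by (simp add: abs_mult[symmetric] right_diff_distrib sum_distrib_left mult_ac)
    qed
    finally show "norm (mollify u \<eta> y - mollify u \<eta> x - (\<Sum>j\<in>UNIV. (y - x) $ j * mollify u (pd j \<eta>) x)) / norm (y - x)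
       \<le> C * norm (y - x) * ?I"
      using \<open>y \<noteq> x\<close> unfolding h_def[symmetric]
      by (simp add: h_def field_simps power2_eq_square)
  qed auto
qed

lemma pd_mollify:
  fixes u \<eta> :: "real^'n::finite \<Rightarrow> real"
  assumes "integrable lborel u" "test_fun \<Omega> \<eta>"
  shows "pd j (mollify u \<eta>) = mollify u (pd j \<eta>)"
proof
  fix x
  have "(\<Sum>i\<in>UNIV. (axis j 1::real^'n) $ i * mollify u (pd i \<eta>) x) = (\<Sum>i\<in>UNIV. if i = j then mollify u (pd i \<eta>) x else 0)"
    by (intro sum.cong) (auto simp: axis_def)
  then show "pd j (mollify u \<eta>) x = mollify u (pd j \<eta>) x"
    using pd_eq_derivative[OF mollify_has_derivative[OF assms, of x], of j] by simp
qed

text \<open>Coinduction over all mollifications of \<open>u\<close> by test functions: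
  differentiating one yields another, with \<open>pd j \<eta>\<close> as its kernel.\<close>

lemma smooth_fun_mollify:
  fixes u \<eta> :: "real^'n::finite \<Rightarrow> real"
  assumes u: "integrable lborel u" and \<eta>: "test_fun \<Omega> \<eta>"
  shows "smooth_fun (mollify u \<eta>)"
proof (rule smooth_fun_coinduct[where K="{mollify u \<eta> |\<eta>. test_fun \<Omega> \<eta>}"])
  show "mollify u \<eta> \<in> {mollify u \<eta> |\<eta>. test_fun \<Omega> \<eta>}" using \<eta> by blast
  show "f differentiable (at x)" if "f \<in> {mollify u \<eta> |\<eta>. test_fun \<Omega> \<eta>}" for f x
    using that mollify_has_derivative[OF u] unfolding differentiable_def by blast
  show "pd j f \<in> {mollify u \<eta> |\<eta>. test_fun \<Omega> \<eta>}" if "f \<in> {mollify u \<eta> |\<eta>. test_fun \<Omega> \<eta>}" for f j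
    using that pd_mollify[OF u] test_fun_pd by blast
qed

lemma ex_smooth_kernel:
  assumes "r > 0" shows "\<exists>\<eta>. smooth_kernel a r \<eta>"
proof -
  obtain \<eta> where "test_fun UNIV \<eta>" "\<And>x. \<eta> x \<ge> 0" "(LINT x|lborel. \<eta> x) = 1" "\<And>x. \<eta> x \<noteq> 0 \<Longrightarrow> x \<in> ball a r"
    by (rule smooth_kernel_exists[OF assms, of a]) (rule that)
  then have "smooth_kernel a r \<eta>" unfolding smooth_kernel_def by blast
  then show ?thesis by blast
qed

lemma mollify_support:
  assumes "mollify u \<eta> x \<noteq> 0" obtains y z where "u y \<noteq> 0" "\<eta> z \<noteq> 0" "x = y + z"
proof -
  have "\<exists>y. u y * \<eta> (x - y) \<noteq> 0"
  proof (rule ccontr)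
    assume "\<nexists>y. u y * \<eta> (x - y) \<noteq> 0"
    then have "(\<lambda>y. u y * \<eta> (x - y)) = (\<lambda>y. 0)" by auto
    then have "mollify u \<eta> x = 0" unfolding mollify_def by simp
    with assms show False by simp
  qed
  then obtain y where "u y * \<eta> (x - y) \<noteq> 0" by blast
  then show thesis using that[of y "x - y"] by auto
qed

lemma test_fun_reflect:
  fixes \<eta> :: "real^'n::finite \<Rightarrow> real"
  assumes "test_fun UNIV \<eta>"
  shows "test_fun UNIV (\<lambda>y. \<eta> (x - y))" and "pd j (\<lambda>y. \<eta> (x - y)) y = - pd j \<eta> (x - y)"
proof -
  have s: "smooth_fun \<eta>" using assms by (rule test_fun_smooth)
  have "smooth_fun (\<lambda>y. \<eta> (x - y))" using smooth_fun_affine[OF s, of x "-1"] by simp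
  moreover have "bounded {y. \<eta> (x - y) \<noteq> 0}"
  proof -
    obtain R where R: "\<And>z. \<eta> z \<noteq> 0 \<Longrightarrow> norm z \<le> R" using test_fun_support_ball[OF assms] by metis
    have "norm y \<le> norm x + R" if "\<eta> (x - y) \<noteq> 0" for y
      using R[OF that] norm_triangle_ineq4[of x "x - y"] by simp
    then show ?thesis by (auto simp: bounded_iff)
  qed
  ultimately show "test_fun UNIV (\<lambda>y. \<eta> (x - y))" by (simp add: test_fun_UNIV)
  show "pd j (\<lambda>y. \<eta> (x - y)) y = - pd j \<eta> (x - y)" using pd_affine(2)[OF s, of j x "-1" y] by simp
qed

text \<open>The test functions live on the whole space. For a function vanishing outside \<Omega>
  this asks more than a weak derivative in \<Omega>: it also records zero boundary values.\<close>

definition weak_pd :: "'n::finite \<Rightarrow> (real^'n \<Rightarrow> real) \<Rightarrow> (real^'n \<Rightarrow> real) \<Rightarrow> bool" where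
  "weak_pd j u g \<longleftrightarrow> integrable lborel u \<and> integrable lborel g \<and>
    (\<forall>\<phi>. test_fun UNIV \<phi> \<longrightarrow> (LINT x|lborel. u x * pd j \<phi> x) = - (LINT x|lborel. g x * \<phi> x))"

text \<open>For fixed x the reflected kernel y -> \<eta>(x - y) is a test function. Its derivative
  in y carries a minus sign, which cancels the one of integration by parts.\<close>

lemma pd_mollify_weak_pd:
  assumes w: "weak_pd j u g" and \<eta>: "test_fun UNIV \<eta>"
  shows "pd j (mollify u \<eta>) = mollify g \<eta>"
proof
  fix x
  have "pd j (mollify u \<eta>) x = (LINT y|lborel. u y * pd j \<eta> (x - y))"
    using w \<eta> by (simp add: pd_mollify weak_pd_def mollify_def)
  also have "\<dots> = - (LINT y|lborel. u y * pd j (\<lambda>y. \<eta> (x - y)) y)"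
    by (simp add: test_fun_reflect(2)[OF \<eta>])
  also have "\<dots> = (LINT y|lborel. g y * \<eta> (x - y))"
    using w test_fun_reflect(1)[OF \<eta>] by (simp add: weak_pd_def)
  finally show "pd j (mollify u \<eta>) x = mollify g \<eta> x" by (simp add: mollify_def)
qed

lemma test_fun_mult_integrable:
  fixes u \<phi> :: "real^'n::finite \<Rightarrow> real"
  assumes "integrable lborel u" "test_fun \<Omega> \<phi>"
  shows "integrable lborel (\<lambda>x. u x * \<phi> x)"
proof -
  obtain B where "\<And>x. \<bar>\<phi> x\<bar> \<le> B" using test_fun_bounded[OF assms(2)] by metis
  then show ?thesis using assms
    by (intro integrable_mult_bounded) (auto intro: smooth_fun_borel test_fun_smooth)
qed

text \<open>The product of \<open>\<psi>\<close> with a test function is again one; inserting it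
  into the definition and expanding its derivative gives the product rule.\<close>

lemma weak_pd_mult:
  fixes u g \<psi> :: "real^'n::finite \<Rightarrow> real"
  assumes w: "weak_pd j u g" and \<psi>: "test_fun UNIV \<psi>"
  shows "weak_pd j (\<lambda>x. u x * \<psi> x) (\<lambda>x. g x * \<psi> x + u x * pd j \<psi> x)"
proof -
  have u: "integrable lborel u" and g: "integrable lborel g" using w by (auto simp: weak_pd_def)
  have sm: "smooth_fun \<psi>" by (rule test_fun_smooth[OF \<psi>])
  show ?thesis unfolding weak_pd_def
  proof (intro conjI allI impI)
    show "integrable lborel (\<lambda>x. u x * \<psi> x)" by (rule test_fun_mult_integrable[OF u \<psi>])
    show "integrable lborel (\<lambda>x. g x * \<psi> x + u x * pd j \<psi> x)"
      by (intro Bochner_Integration.integrable_add test_fun_mult_integrable[OF g \<psi>] test_fun_mult_integrable[OF u test_fun_pd[OF \<psi>]])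
    fix \<phi> :: "real^'n \<Rightarrow> real" assume \<phi>: "test_fun UNIV \<phi>"
    have t: "test_fun UNIV (\<lambda>x. \<psi> x * \<phi> x)" "test_fun UNIV (\<lambda>x. pd j \<psi> x * \<phi> x)"
      by (rule test_fun_mult_smooth[OF \<phi>], auto intro: sm smooth_fun_pd)+
    have pdm: "pd j (\<lambda>x. \<psi> x * \<phi> x) x = \<psi> x * pd j \<phi> x + pd j \<psi> x * \<phi> x" for x
      using \<phi> sm by (intro pd_mult) (auto intro: smooth_fun_differentiable test_fun_smooth)
    have "(LINT x|lborel. u x * \<psi> x * pd j \<phi> x) = (LINT x|lborel. u x * pd j (\<lambda>x. \<psi> x * \<phi> x) x - u x * (pd j \<psi> x * \<phi> x))"
      by (simp only: pdm) (simp add: algebra_simps)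
    also have "\<dots> = (LINT x|lborel. u x * pd j (\<lambda>x. \<psi> x * \<phi> x) x) - (LINT x|lborel. u x * (pd j \<psi> x * \<phi> x))"
      using test_fun_mult_integrable[OF u test_fun_pd[OF t(1)]] test_fun_mult_integrable[OF u t(2)]
      by (rule Bochner_Integration.integral_diff)
    also have "(LINT x|lborel. u x * pd j (\<lambda>x. \<psi> x * \<phi> x) x) = - (LINT x|lborel. g x * (\<psi> x * \<phi> x))"
      using w t(1) by (simp add: weak_pd_def)
    also have "- (LINT x|lborel. g x * (\<psi> x * \<phi> x)) - (LINT x|lborel. u x * (pd j \<psi> x * \<phi> x))
       = - (LINT x|lborel. g x * (\<psi> x * \<phi> x) + u x * (pd j \<psi> x * \<phi> x))"
      using test_fun_mult_integrable[OF g t(1)] test_fun_mult_integrable[OF u t(2)] by simp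
    finally show "(LINT x|lborel. u x * \<psi> x * pd j \<phi> x) = - (LINT x|lborel. (g x * \<psi> x + u x * pd j \<psi> x) * \<phi> x)"
      by (simp add: algebra_simps)
  qed
qed

text \<open>The definitions integrate against completed Lebesgue measure on a set, while
  translations and Fubini are used for \<open>lborel\<close>. Borel functions vanishing outside
  \<open>S\<close> can be moved between the two.\<close>

lemma lebesgue_on_eq_lborel:
  fixes w :: "'a::euclidean_space \<Rightarrow> real"
  assumes S[measurable]: "S \<in> sets borel" and w[measurable]: "w \<in> borel_measurable borel" and w0: "\<And>x. x \<notin> S \<Longrightarrow> w x = 0"
  shows "integrable (lebesgue_on S) w \<longleftrightarrow> integrable lborel w"
    and "(LINT x|lebesgue_on S. w x) = (LINT x|lborel. w x)"
proof -
  have S': "S \<inter> space lebesgue \<in> sets lebesgue" by simp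
  have *: "(\<lambda>x. indicator S x *\<^sub>R w x) = w" using w0 by (auto simp: indicator_def fun_eq_iff)
  show "integrable (lebesgue_on S) w \<longleftrightarrow> integrable lborel w"
    unfolding integrable_restrict_space[OF S'] * by (rule integrable_completion) simp
  show "(LINT x|lebesgue_on S. w x) = (LINT x|lborel. w x)"
    unfolding integral_restrict_space[OF S'] * by (rule integral_completion) simp
qed

text \<open>A Lebesgue measurable function agrees a.e. with a Borel one. Extension by zero then
  brings functions on \<Omega> within reach of \<open>lborel\<close>.\<close>

lemma borel_extension:
  fixes u :: "'a::euclidean_space \<Rightarrow> real"
  assumes S[measurable]: "S \<in> sets borel" and u: "u \<in> borel_measurable (lebesgue_on S)"
  obtains u' where "u' \<in> borel_measurable borel" "AE x in lebesgue_on S. u' x = u x" "\<And>x. x \<notin> S \<Longrightarrow> u' x = 0"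
proof -
  have S': "S \<inter> space lebesgue \<in> sets lebesgue" by simp
  have "(\<lambda>x. indicator S x *\<^sub>R u x) \<in> borel_measurable lebesgue"
    using u unfolding borel_measurable_restrict_space_iff[OF S'] .
  then obtain v where v[measurable]: "v \<in> borel_measurable lborel" "AE x in lborel. indicator S x *\<^sub>R u x = v x"
    using completion_ex_borel_measurable_real by blast
  show thesis
  proof (rule that[of "\<lambda>x. indicator S x * v x"])
    have "AE x in lebesgue. indicator S x *\<^sub>R u x = v x" using v(2) by (rule AE_completion)
    then show "AE x in lebesgue_on S. indicator S x * v x = u x"
      unfolding AE_restrict_space_iff[OF S'] by eventually_elim auto
  qed (use v in auto)
qed

lemma locint_mult_test_fun:
  assumes u: "locint \<Omega> u" and \<phi>: "test_fun \<Omega> \<phi>" and "open \<Omega>"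
  shows "integrable (lebesgue_on \<Omega>) (\<lambda>x. u x * \<phi> x)"
proof -
  let ?K = "closure {x. \<phi> x \<noteq> 0}"
  have K: "compact ?K" "?K \<subseteq> \<Omega>" using \<phi> by (auto simp: test_fun_def)
  have [measurable]: "\<phi> \<in> borel_measurable borel" using \<phi> by (auto intro: smooth_fun_borel test_fun_smooth)
  obtain B where B: "\<And>x. \<bar>\<phi> x\<bar> \<le> B" using test_fun_bounded[OF \<phi>] by metis
  have "integrable (lebesgue_on ?K) (\<lambda>x. u x * \<phi> x)"
    using u K B by (intro integrable_mult_bounded[where B=B])
      (auto simp: locint_def intro!: measurable_restrict_space1 measurable_completion)
  moreover have "?K \<inter> space lebesgue \<in> sets lebesgue" "\<Omega> \<inter> space lebesgue \<in> sets lebesgue"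
    using \<open>open \<Omega>\<close> by auto
  moreover have "(\<lambda>x. indicator ?K x *\<^sub>R (u x * \<phi> x)) = (\<lambda>x. indicator \<Omega> x *\<^sub>R (u x * \<phi> x))"
    using K closure_subset[of "{x. \<phi> x \<noteq> 0}"] by (auto simp: indicator_def fun_eq_iff)
  ultimately show ?thesis by (simp add: integrable_restrict_space)
qed

lemma AE_lebesgue_on_subset:
  assumes "AE x in lebesgue_on S. P x" "T \<subseteq> S" "S \<in> sets lebesgue" "T \<in> sets lebesgue"
  shows "AE x in lebesgue_on T. P x"
  using assms by (auto simp: AE_restrict_space_iff elim!: eventually_mono)

text \<open>Mollifications near a point of \<open>\<Omega>\<close> are integrals against test functions, hence vanish.\<close>

lemma locint_zero_AE:
  fixes h :: "real^'n::finite \<Rightarrow> real"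
  assumes "open \<Omega>" and h: "locint \<Omega> h"
    and z: "\<And>\<phi>. test_fun \<Omega> \<phi> \<Longrightarrow> (LINT x|lebesgue_on \<Omega>. h x * \<phi> x) = 0"
  shows "AE x in lebesgue_on \<Omega>. h x = 0"
proof -
  have O[measurable]: "\<Omega> \<in> sets borel" using \<open>open \<Omega>\<close> by simp
  obtain v where v[measurable]: "v \<in> borel_measurable borel" and vh: "AE x in lebesgue_on \<Omega>. v x = h x"
    and v0: "\<And>x. x \<notin> \<Omega> \<Longrightarrow> v x = 0"
    using borel_extension[OF O, of h] h unfolding locint_def by metis
  \<comment> \<open>Negligibility is a local property, so a neighbourhood of each point suffices; on
    a closed ball inside \<Omega> the locally integrable \<open>h\<close> is integrable.\<close>
  have loc: "\<exists>r>0. negligible ({x\<in>\<Omega>. v x \<noteq> 0} \<inter> ball a r)" if a: "a \<in> \<Omega>" for a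
  proof -
    obtain s where s: "s > 0" "cball a s \<subseteq> \<Omega>" using \<open>open \<Omega>\<close> a by (metis open_contains_cball)
    define K where "K = cball a s"
    define w where "w x = indicator K x * v x" for x
    have [measurable]: "K \<in> sets borel" by (simp add: K_def)
    have wm[measurable]: "w \<in> borel_measurable borel" unfolding w_def[abs_def] by measurable
    have K: "K \<subseteq> \<Omega>" "compact K" using s by (auto simp: K_def)
    have vhK: "AE x in lebesgue_on K. v x = h x" by (rule AE_lebesgue_on_subset[OF vh K(1)]) auto
    have "integrable (lebesgue_on K) h" using h K by (simp add: locint_def)
    then have "integrable (lebesgue_on K) w"
    proof (rule integrable_cong_AE_imp)
      show "w \<in> borel_measurable (lebesgue_on K)"
        by (intro measurable_restrict_space1 measurable_completion) simp
      have "AE x in lebesgue_on K. x \<in> K" by (rule AE_I2) (simp add: space_restrict_space)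
      with vhK show "AE x in lebesgue_on K. h x = w x" by eventually_elim (simp add: w_def)
    qed
    then have wi: "integrable lborel w"
      by (subst (asm) lebesgue_on_eq_lborel) (auto simp: w_def)
    \<comment> \<open>For x in the half ball and a kernel of radius at most s/2, the shifted kernel
      is supported in \<open>K\<close>, hence is a test function of \<Omega>.\<close>
    have mz: "mollify w \<eta> x = 0" if x: "x \<in> ball a (s/2)" and k: "smooth_kernel 0 d \<eta>" and d: "d \<le> s/2" for x d \<eta>
    proof -
      have \<eta>: "test_fun UNIV \<eta>" using k by (simp add: smooth_kernel_def)
      have sup: "y \<in> cball x (s/2)" if "\<eta> (x - y) \<noteq> 0" for y
      proof -
        have "x - y \<in> ball 0 d" using that k by (simp add: smooth_kernel_def)
        then show ?thesis using d by (simp add: dist_norm norm_minus_commute[of y x])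
      qed
      have "cball x (s/2) \<subseteq> K" using x unfolding K_def by (intro cball_subset_cball_iff[THEN iffD2]) (auto simp: dist_commute)
      with sup have supK: "y \<in> K" if "\<eta> (x - y) \<noteq> 0" for y using that by blast
      have cl: "closure {y. \<eta> (x - y) \<noteq> 0} \<subseteq> K" using supK K by (intro closure_minimal) (auto intro: compact_imp_closed)
      have t: "test_fun \<Omega> (\<lambda>y. \<eta> (x - y))"
        using test_fun_reflect(1)[OF \<eta>, of x] cl K unfolding test_fun_def by auto
      have [measurable]: "\<eta> \<in> borel_measurable borel" using \<eta> by (auto intro: smooth_fun_borel test_fun_smooth)
      have "mollify w \<eta> x = (LINT y|lborel. v y * \<eta> (x - y))"
        unfolding mollify_def using supK by (intro Bochner_Integration.integral_cong) (auto simp: w_def indicator_def)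
      also have "\<dots> = (LINT y|lebesgue_on \<Omega>. v y * \<eta> (x - y))"
        using v0 by (intro lebesgue_on_eq_lborel(2)[symmetric]) auto
      also have "\<dots> = (LINT y|lebesgue_on \<Omega>. h y * \<eta> (x - y))"
      proof (rule integral_cong_AE)
        show "(\<lambda>y. v y * \<eta> (x - y)) \<in> borel_measurable (lebesgue_on \<Omega>)"
          by (intro measurable_restrict_space1 measurable_completion) simp
        show "(\<lambda>y. h y * \<eta> (x - y)) \<in> borel_measurable (lebesgue_on \<Omega>)"
          using locint_mult_test_fun[OF h t \<open>open \<Omega>\<close>] by auto
        show "AE y in lebesgue_on \<Omega>. v y * \<eta> (x - y) = h y * \<eta> (x - y)" using vh by eventually_elim simp
      qed
      also have "\<dots> = 0" by (rule z[OF t])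
      finally show ?thesis .
    qed
    \<comment> \<open>On the half ball the mollification is 0, so |w| there is the mollification
      error, whose integral is as small as desired.\<close>
    have small: "(\<integral>\<^sup>+x. ennreal \<bar>w x\<bar> * indicator (ball a (s/2)) x \<partial>lborel) \<le> ennreal e" if e: "e > 0" for e
    proof -
      obtain d where d: "d > 0" "\<And>\<eta>. smooth_kernel 0 d \<eta> \<Longrightarrow>
        (\<integral>\<^sup>+x. ennreal (\<bar>mollify w \<eta> x - w x\<bar> powr 1) \<partial>lborel) \<le> ennreal e"
        using mollify_tendsto_Lp[OF wi, of 1 e] wi e by auto
      obtain \<eta> where "smooth_kernel (0::real^'n) (min d (s/2)) \<eta>"
        using ex_smooth_kernel[of "min d (s/2)" 0] d s by auto
      then have k: "smooth_kernel 0 d \<eta>" "smooth_kernel 0 (s/2) \<eta>" by (auto simp: smooth_kernel_def)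
      have "(\<integral>\<^sup>+x. ennreal \<bar>w x\<bar> * indicator (ball a (s/2)) x \<partial>lborel)
        \<le> (\<integral>\<^sup>+x. ennreal (\<bar>mollify w \<eta> x - w x\<bar> powr 1) \<partial>lborel)"
        using mz[OF _ k(2)] by (intro nn_integral_mono) (auto simp: indicator_def)
      also have "\<dots> \<le> ennreal e" using d(2)[OF k(1)] .
      finally show ?thesis .
    qed
    have "(\<integral>\<^sup>+x. ennreal \<bar>w x\<bar> * indicator (ball a (s/2)) x \<partial>lborel) \<le> 0"
      by (rule ennreal_le_epsilon) (use small in auto)
    then have "AE x in lborel. ennreal \<bar>w x\<bar> * indicator (ball a (s/2)) x = 0"
      by (subst (asm) le_zero_eq, subst (asm) nn_integral_0_iff_AE) (measurable, simp)
    then have "AE x in lebesgue. ennreal \<bar>w x\<bar> * indicator (ball a (s/2)) x = 0" by (rule AE_completion)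
    then have "AE x in lebesgue. x \<notin> {x\<in>\<Omega>. v x \<noteq> 0} \<inter> ball a (s/2)"
    proof eventually_elim
      case (elim x)
      then show ?case using s by (auto simp: w_def K_def indicator_def split: if_splits)
    qed
    moreover have "{x\<in>\<Omega>. v x \<noteq> 0} \<inter> ball a (s/2) \<in> sets lebesgue" by (intro sets_completionI_sets) simp
    ultimately have "negligible ({x\<in>\<Omega>. v x \<noteq> 0} \<inter> ball a (s/2))"
      by (simp add: negligible_iff_null_sets AE_iff_null_sets)
    then show ?thesis using s by (intro exI[of _ "s/2"]) auto
  qed
  have "negligible {x\<in>\<Omega>. v x \<noteq> 0}"
    unfolding locally_negligible_alt[of "{x\<in>\<Omega>. v x \<noteq> 0}"]
  proof
    fix a assume a: "a \<in> {x\<in>\<Omega>. v x \<noteq> 0}"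
    then obtain r where r: "r > 0" "negligible ({x\<in>\<Omega>. v x \<noteq> 0} \<inter> ball a r)" using loc by blast
    then show "\<exists>U. openin (top_of_set {x\<in>\<Omega>. v x \<noteq> 0}) U \<and> a \<in> U \<and> negligible U"
      using a by (intro exI[of _ "{x\<in>\<Omega>. v x \<noteq> 0} \<inter> ball a r"]) (auto intro: openin_open_Int)
  qed
  then have "AE x in lebesgue. x \<notin> {x\<in>\<Omega>. v x \<noteq> 0}"
    unfolding negligible_iff_null_sets by (rule AE_not_in)
  then have "AE x in lebesgue_on \<Omega>. v x = 0"
    by (subst AE_restrict_space_iff) (auto elim!: eventually_mono)
  with vh show ?thesis by eventually_elim simp
qed

text \<open>\<open>wgrad\<close> is an arbitrary choice among weak gradients; this transfers
  properties from any other weak gradient to it. Each component of the difference integrates to 0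
  against every test function.\<close>

lemma weak_grad_unique:
  fixes u :: "real^'n::finite \<Rightarrow> real"
  assumes "open \<Omega>" and g: "weak_grad \<Omega> u g" and g': "weak_grad \<Omega> u g'"
  shows "AE x in lebesgue_on \<Omega>. g x = g' x"
proof -
  have "AE x in lebesgue_on \<Omega>. g x $ j - g' x $ j = 0" for j
  proof (rule locint_zero_AE[OF \<open>open \<Omega>\<close>])
    have l: "locint \<Omega> (\<lambda>x. g x $ j)" "locint \<Omega> (\<lambda>x. g' x $ j)" using g g' by (auto simp: weak_grad_def)
    then show "locint \<Omega> (\<lambda>x. g x $ j - g' x $ j)" by (auto simp: locint_def)
    fix \<phi> assume \<phi>: "test_fun \<Omega> \<phi>"
    have "(LINT x|lebesgue_on \<Omega>. (g x $ j - g' x $ j) * \<phi> x)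
      = (LINT x|lebesgue_on \<Omega>. g x $ j * \<phi> x) - (LINT x|lebesgue_on \<Omega>. g' x $ j * \<phi> x)"
      using l[THEN locint_mult_test_fun[OF _ \<phi> \<open>open \<Omega>\<close>]] by (simp add: left_diff_distrib)
    also have "\<dots> = 0" using g g' \<phi> by (simp add: weak_grad_def)
    finally show "(LINT x|lebesgue_on \<Omega>. (g x $ j - g' x $ j) * \<phi> x) = 0" .
  qed
  then have "AE x in lebesgue_on \<Omega>. \<forall>j\<in>UNIV. g x $ j - g' x $ j = 0"
    by (intro AE_finite_allI) auto
  then show ?thesis by eventually_elim (simp add: vec_eq_iff)
qed

section \<open>Averages of weakly convergent sequences\<close>

text \<open>Discrete Jensen inequality: sum the tangent inequalities at the norm \<open>m\<close> of
  the average. Their linear parts have a nonnegative sum by the triangle inequality.\<close>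

lemma powr_norm_average_le:
  fixes g :: "nat \<Rightarrow> 'e::real_normed_vector"
  assumes p: "1 \<le> p"
  shows "norm ((1 / real (Suc n)) *\<^sub>R (\<Sum>k<Suc n. g k)) powr p \<le> (1 / real (Suc n)) * (\<Sum>k<Suc n. norm (g k) powr p)"
proof -
  define N where "N = real (Suc n)"
  define m where "m = norm ((1 / N) *\<^sub>R (\<Sum>k<Suc n. g k))"
  have N: "N > 0" by (simp add: N_def)
  have "m \<le> (\<Sum>k<Suc n. norm (g k)) / N"
    using N norm_sum[of g "{..<Suc n}"] by (simp add: m_def divide_right_mono del: sum.lessThan_Suc)
  then have m: "m * N \<le> (\<Sum>k<Suc n. norm (g k))" using N by (simp add: field_simps del: sum.lessThan_Suc)
  have "m powr p \<le> (1 / N) * (\<Sum>k<Suc n. norm (g k) powr p)"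
  proof (cases "m = 0")
    case True
    then show ?thesis using N by (simp add: sum_nonneg del: sum.lessThan_Suc)
  next
    case False
    then have m0: "m > 0" by (simp add: m_def)
    have "N * m powr p \<le> N * m powr p + p * m powr (p - 1) * ((\<Sum>k<Suc n. norm (g k)) - m * N)"
      using m p by simp
    also have "\<dots> = (\<Sum>k<Suc n. m powr p + p * m powr (p - 1) * (norm (g k) - m))"
      by (simp only: sum.distrib sum_distrib_left[symmetric] sum_subtractf sum_constant card_lessThan N_def mult.commute[of m])
    also have "\<dots> \<le> (\<Sum>k<Suc n. norm (g k) powr p)"
      using m0 p by (intro sum_mono powr_tangent) auto
    finally show ?thesis using N by (simp add: field_simps del: sum.lessThan_Suc)
  qed
  then show ?thesis unfolding m_def N_def .
qed

text \<open>In place of Cauchy-Schwarz, the elementary bound |f| <= e + |f|^2 / e is integrated over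
  a space of finite measure, with e chosen first.\<close>

lemma tendsto_L1_of_L2:
  fixes f :: "nat \<Rightarrow> 'a \<Rightarrow> 'e::{banach, second_countable_topology}"
  assumes fin: "finite_measure M" and f[measurable]: "\<And>n. f n \<in> borel_measurable M"
    and int: "\<And>n. integrable M (\<lambda>x. (norm (f n x))\<^sup>2)" and lim: "(\<lambda>n. LINT x|M. (norm (f n x))\<^sup>2) \<longlonglongrightarrow> 0"
  shows "\<And>n. integrable M (f n)" "(\<lambda>n. LINT x|M. norm (f n x)) \<longlonglongrightarrow> 0"
proof -
  interpret finite_measure M by fact
  have le: "norm (f n x) \<le> e + (norm (f n x))\<^sup>2 / e" if "e > 0" for e n x
  proof (cases "norm (f n x) \<le> e")
    case False
    then have "e * norm (f n x) \<le> norm (f n x) * norm (f n x)" by (intro mult_right_mono) auto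
    then have "norm (f n x) \<le> (norm (f n x))\<^sup>2 / e"
      using that by (simp add: pos_le_divide_eq power2_eq_square mult.commute)
    then show ?thesis using that by linarith
  qed (use that in \<open>simp add: add_increasing2\<close>)
  show intf: "integrable M (f n)" for n
  proof (rule Bochner_Integration.integrable_bound)
    show "integrable M (\<lambda>x. 1 + (norm (f n x))\<^sup>2)" using int by simp
    show "AE x in M. norm (f n x) \<le> norm (1 + (norm (f n x))\<^sup>2)" using le[of 1 n] by auto
  qed auto
  show "(\<lambda>n. LINT x|M. norm (f n x)) \<longlonglongrightarrow> 0"
  proof (rule LIMSEQ_I)
    fix r :: real assume r: "r > 0"
    define m where "m = measure M (space M)"
    \<comment> \<open>This makes e times the total mass at most r/2; the summand 1 covers a space of
      measure 0.\<close>
    define e where "e = r / (2 * (m + 1))"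
    have m: "m \<ge> 0" by (simp add: m_def)
    have e: "e > 0" using r m by (simp add: e_def)
    have em: "e * m \<le> r / 2" using r m by (simp add: e_def field_simps)
    have "\<forall>\<^sub>F n in sequentially. (LINT x|M. (norm (f n x))\<^sup>2) < e * (r / 2)"
      using lim e r by (intro order_tendstoD) auto
    then obtain N where N: "\<And>n. n \<ge> N \<Longrightarrow> (LINT x|M. (norm (f n x))\<^sup>2) < e * (r / 2)"
      by (auto simp: eventually_sequentially)
    have "norm ((LINT x|M. norm (f n x)) - 0) < r" if "n \<ge> N" for n
    proof -
      have "(LINT x|M. norm (f n x)) \<le> (LINT x|M. e + (norm (f n x))\<^sup>2 / e)"
        using intf int by (intro integral_mono le e) auto
      also have "\<dots> = e * m + (LINT x|M. (norm (f n x))\<^sup>2) / e" using int by (simp add: m_def)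
      also have "\<dots> < r / 2 + r / 2"
        using em N[OF that] e by (intro add_le_less_mono) (auto simp: field_simps)
      finally show ?thesis by simp
    qed
    then show "\<exists>N. \<forall>n\<ge>N. norm ((LINT x|M. norm (f n x)) - 0) < r" by blast
  qed
qed

text \<open>The selection step of the Banach--Saks theorem, in terms of the Gram matrix \<open>a\<close>.\<close>

lemma gram_subsequence:
  fixes a :: "nat \<Rightarrow> nat \<Rightarrow> real" and b :: "nat \<Rightarrow> real"
  assumes lim: "\<And>j. (\<lambda>i. a i j) \<longlonglongrightarrow> 0" and sym: "\<And>i j. a i j = a j i"
    and b: "b \<longlonglongrightarrow> 0" and Q: "eventually Q sequentially" and C: "\<And>i. Q i \<Longrightarrow> a i i \<le> C"
  obtains s where "\<And>k. Q (s k)" "\<And>n. (\<Sum>k<n. \<Sum>l<n. a (s k) (s l)) \<le> (C + 2) * real n"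
    "\<And>n. (\<Sum>k<n. b (s k)) \<le> 2"
proof -
  \<comment> \<open>The n-th index is chosen so that its inner products with all earlier choices sum
    to at most 1 and \<open>b\<close> is at most 2^-n. All large indices qualify, because only
    finitely many columns of \<open>a\<close> are involved.\<close>
  define P where "P s n r \<longleftrightarrow> Q r \<and> (\<Sum>j<n. a r (s j)) \<le> 1 \<and> b r \<le> (1/2)^n" for s :: "nat \<Rightarrow> nat" and n r
  have "\<exists>s. \<forall>n. P s n (s n)"
  proof (rule dependent_wellorder_choice)
    show "P f x r = P g x r" if "\<And>y. y < x \<Longrightarrow> f y = g y" for r f g and x :: nat
      using that by (simp add: P_def)
    fix n :: nat and s :: "nat \<Rightarrow> nat"
    have "(\<lambda>i. \<Sum>j<n. a i (s j)) \<longlonglongrightarrow> (\<Sum>j<n. 0)" by (intro tendsto_sum lim)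
    then have "\<forall>\<^sub>F i in sequentially. (\<Sum>j<n. a i (s j)) < 1" by (intro order_tendstoD) auto
    moreover have "\<forall>\<^sub>F i in sequentially. b i < (1/2)^n" using b by (intro order_tendstoD) auto
    ultimately have "\<forall>\<^sub>F i in sequentially. P s n i"
      using Q by eventually_elim (simp add: P_def)
    then show "\<exists>r. P s n r" by (auto simp: eventually_sequentially)
  qed
  then obtain s where s: "\<And>n. P s n (s n)" by blast
  show thesis
  proof (rule that[of s])
    show "Q (s k)" for k using s[of k] by (simp add: P_def)
    show "(\<Sum>k<n. \<Sum>l<n. a (s k) (s l)) \<le> (C + 2) * real n" for n
    proof (induction n)
      case (Suc n)
      \<comment> \<open>A new index adds one row and one column, each with sum at most 1, and a
        diagonal entry at most \<open>C\<close>: linear growth at rate C + 2.\<close>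
      have "(\<Sum>k<Suc n. \<Sum>l<Suc n. a (s k) (s l))
         = (\<Sum>k<n. \<Sum>l<n. a (s k) (s l)) + (\<Sum>k<n. a (s k) (s n)) + (\<Sum>l<n. a (s n) (s l)) + a (s n) (s n)"
        by (simp add: sum.distrib)
      also have "(\<Sum>k<n. a (s k) (s n)) = (\<Sum>l<n. a (s n) (s l))" by (intro sum.cong refl sym)
      also have "(\<Sum>k<n. \<Sum>l<n. a (s k) (s l)) + (\<Sum>l<n. a (s n) (s l)) + (\<Sum>l<n. a (s n) (s l)) + a (s n) (s n)
          \<le> (C + 2) * real n + 1 + 1 + C"
        using Suc s[of n] C by (intro add_mono) (auto simp: P_def)
      also have "\<dots> = (C + 2) * real (Suc n)" by (simp add: algebra_simps)
      finally show ?case .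
    qed simp
    show "(\<Sum>k<n. b (s k)) \<le> 2" for n
    proof -
      have "(\<Sum>k<n. b (s k)) \<le> (\<Sum>k<n. (1/2)^k)" using s by (intro sum_mono) (simp add: P_def)
      also have "\<dots> \<le> 2" by (simp add: sum_gp_strict)
      finally show ?thesis .
    qed
  qed
qed

lemma integrable_mult_of_squares:
  fixes u v :: "'a \<Rightarrow> real"
  assumes "integrable M (\<lambda>x. (u x)\<^sup>2)" "integrable M (\<lambda>x. (v x)\<^sup>2)"
      "u \<in> borel_measurable M" "v \<in> borel_measurable M"
  shows "integrable M (\<lambda>x. u x * v x)"
proof (rule Bochner_Integration.integrable_bound)
  show "integrable M (\<lambda>x. (u x)\<^sup>2 + (v x)\<^sup>2)" using assms by simp
  show "AE x in M. norm (u x * v x) \<le> norm ((u x)\<^sup>2 + (v x)\<^sup>2)"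
  proof (rule AE_I2)
    fix x
    have "2 * (\<bar>u x\<bar> * \<bar>v x\<bar>) \<le> (u x)\<^sup>2 + (v x)\<^sup>2" using sum_squares_bound[of "\<bar>u x\<bar>" "\<bar>v x\<bar>"] by simp
    moreover have "0 \<le> \<bar>u x\<bar> * \<bar>v x\<bar>" by simp
    ultimately have "\<bar>u x\<bar> * \<bar>v x\<bar> \<le> (u x)\<^sup>2 + (v x)\<^sup>2" by linarith
    then show "norm (u x * v x) \<le> norm ((u x)\<^sup>2 + (v x)\<^sup>2)" by (simp add: abs_mult)
  qed
qed (use assms in measurable)

text \<open>The Banach--Saks averages of \<open>w i\<close> converge strongly to \<open>w0\<close>; those of \<open>g i\<close> have the same
  limit in \<open>L\<^sup>1\<close> and stay bounded in \<open>L\<^sup>p\<close>, so Fatou's lemma applies.\<close>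

lemma weak_limit_Lp:
  fixes y :: "nat \<Rightarrow> 'a \<Rightarrow> real" and w g :: "nat \<Rightarrow> 'a \<Rightarrow> 'e::euclidean_space" and y0 w0
  assumes fin: "finite_measure M" and p: "1 \<le> p"
    and ym[measurable]: "\<And>i. y i \<in> borel_measurable M" "y0 \<in> borel_measurable M"
    and wm[measurable]: "\<And>i. w i \<in> borel_measurable M" "w0 \<in> borel_measurable M" "\<And>i. g i \<in> borel_measurable M"
    and y2: "\<And>i. integrable M (\<lambda>x. (y i x)\<^sup>2)" "integrable M (\<lambda>x. (y0 x)\<^sup>2)"
    and w2: "\<And>i. integrable M (\<lambda>x. (norm (w i x))\<^sup>2)" "integrable M (\<lambda>x. (norm (w0 x))\<^sup>2)"
    and lim: "\<And>j. (\<lambda>i. LINT x|M. y i x * y j x + w i x \<bullet> w j x) \<longlonglongrightarrow> (LINT x|M. y0 x * y j x + w0 x \<bullet> w j x)"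
    and lim0: "(\<lambda>i. LINT x|M. y i x * y0 x + w i x \<bullet> w0 x) \<longlonglongrightarrow> (LINT x|M. y0 x * y0 x + w0 x \<bullet> w0 x)"
    and Q: "eventually Q sequentially"
    and C: "\<And>i. Q i \<Longrightarrow> (LINT x|M. (y i x)\<^sup>2) \<le> C" "\<And>i. Q i \<Longrightarrow> (LINT x|M. (norm (w i x))\<^sup>2) \<le> C"
    and gp: "\<And>i. Q i \<Longrightarrow> integrable M (\<lambda>x. norm (g i x) powr p)" "\<And>i. Q i \<Longrightarrow> (LINT x|M. norm (g i x) powr p) \<le> C"
    and gw: "\<And>i. Q i \<Longrightarrow> integrable M (\<lambda>x. w i x - g i x)"
    and b: "b \<longlonglongrightarrow> 0" "\<And>i. Q i \<Longrightarrow> (LINT x|M. norm (w i x - g i x)) \<le> b i"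
  shows "integrable M (\<lambda>x. norm (w0 x) powr p)"
proof -
  interpret finite_measure M by fact
  note prod = integrable_mult_of_squares
  have iprod: "integrable M (\<lambda>x. u x \<bullet> v x)" if "integrable M (\<lambda>x. (norm (u x))\<^sup>2)" "integrable M (\<lambda>x. (norm (v x))\<^sup>2)"
      "u \<in> borel_measurable M" "v \<in> borel_measurable M" for u v :: "'a \<Rightarrow> 'e"
  proof (rule Bochner_Integration.integrable_bound[OF prod[of M "\<lambda>x. norm (u x)" "\<lambda>x. norm (v x)"]])
    show "AE x in M. norm (u x \<bullet> v x) \<le> norm (norm (u x) * norm (v x))"
      using Cauchy_Schwarz_ineq2 by auto
  qed (use that in measurable)
  define V where "V i j = (LINT x|M. y i x * y j x + w i x \<bullet> w j x)" for i j
  define V0 where "V0 j = (LINT x|M. y0 x * y j x + w0 x \<bullet> w j x)" for j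
  define V00 where "V00 = (LINT x|M. y0 x * y0 x + w0 x \<bullet> w0 x)"
  note int = prod[OF y2(1) y2(1) ym(1) ym(1)] prod[OF y2(2) y2(1) ym(2) ym(1)] prod[OF y2(2) y2(2) ym(2) ym(2)]
    iprod[OF w2(1) w2(1) wm(1) wm(1)] iprod[OF w2(2) w2(1) wm(2) wm(1)] iprod[OF w2(2) w2(2) wm(2) wm(2)]
  \<comment> \<open>Gram matrix of the differences from the limit in the H^1 inner product.
    Expanding it leaves only inner products whose limits are given.\<close>
  define a where "a i j = (LINT x|M. (y i x - y0 x) * (y j x - y0 x) + (w i x - w0 x) \<bullet> (w j x - w0 x))" for i j
  have V_int: "integrable M (\<lambda>x. y i x * y j x + w i x \<bullet> w j x)" "integrable M (\<lambda>x. y0 x * y j x + w0 x \<bullet> w j x)"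
    "integrable M (\<lambda>x. y0 x * y0 x + w0 x \<bullet> w0 x)" for i j
    using int by auto
  have a_eq: "a i j = V i j - V0 i - V0 j + V00" for i j
  proof -
    have "a i j = (LINT x|M. (y i x * y j x + w i x \<bullet> w j x) - (y0 x * y i x + w0 x \<bullet> w i x)
         - (y0 x * y j x + w0 x \<bullet> w j x) + (y0 x * y0 x + w0 x \<bullet> w0 x))"
      unfolding a_def by (intro Bochner_Integration.integral_cong) (auto simp: algebra_simps inner_diff_left inner_diff_right inner_commute)
    then show ?thesis using V_int by (simp add: V_def V0_def V00_def)
  qed
  have alim: "(\<lambda>i. a i j) \<longlonglongrightarrow> 0" for j
  proof -
    have "(\<lambda>i. V0 i) \<longlonglongrightarrow> V00" using lim0 by (simp add: V0_def V00_def mult.commute inner_commute)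
    moreover have "(\<lambda>i. V i j) \<longlonglongrightarrow> V0 j" using lim by (simp add: V_def V0_def)
    ultimately have "(\<lambda>i. a i j) \<longlonglongrightarrow> V0 j - V00 - V0 j + V00" unfolding a_eq by (intro tendsto_intros)
    then show ?thesis by simp
  qed
  have asym: "a i j = a j i" for i j by (simp add: a_def mult.commute inner_commute)
  \<comment> \<open>From |u - v|^2 <= 2|u|^2 + 2|v|^2; function and gradient contribute 2C
    each.\<close>
  have abd: "a i i \<le> 4 * C + 2 * V00" if "Q i" for i
  proof -
    have "a i i \<le> (LINT x|M. 2 * (y i x)\<^sup>2 + 2 * (norm (w i x))\<^sup>2 + 2 * (y0 x * y0 x + w0 x \<bullet> w0 x))"
      unfolding a_def
    proof (intro integral_mono)
      show "integrable M (\<lambda>x. (y i x - y0 x) * (y i x - y0 x) + (w i x - w0 x) \<bullet> (w i x - w0 x))"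
      proof -
        have "integrable M (\<lambda>x. (y i x * y i x + w i x \<bullet> w i x) - 2 * (y0 x * y i x + w0 x \<bullet> w i x)
           + (y0 x * y0 x + w0 x \<bullet> w0 x))"
          by (intro Bochner_Integration.integrable_add Bochner_Integration.integrable_diff integrable_mult_right V_int)
        then show ?thesis by (rule back_subst[of "integrable M"]) (auto simp: algebra_simps inner_diff_left inner_diff_right inner_commute)
      qed
      show "integrable M (\<lambda>x. 2 * (y i x)\<^sup>2 + 2 * (norm (w i x))\<^sup>2 + 2 * (y0 x * y0 x + w0 x \<bullet> w0 x))"
        by (intro Bochner_Integration.integrable_add integrable_mult_right y2 w2 V_int)
      fix x
      have "0 \<le> (y i x + y0 x)\<^sup>2 + (w i x + w0 x) \<bullet> (w i x + w0 x)" by simp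
      then show "(y i x - y0 x) * (y i x - y0 x) + (w i x - w0 x) \<bullet> (w i x - w0 x)
        \<le> 2 * (y i x)\<^sup>2 + 2 * (norm (w i x))\<^sup>2 + 2 * (y0 x * y0 x + w0 x \<bullet> w0 x)"
        unfolding power2_norm_eq_inner
        by (simp add: algebra_simps inner_diff_left inner_diff_right inner_add_left inner_add_right inner_commute power2_eq_square)
    qed
    also have "\<dots> = 2 * (LINT x|M. (y i x)\<^sup>2) + 2 * (LINT x|M. (norm (w i x))\<^sup>2) + 2 * V00"
      using y2(1)[of i] w2(1)[of i] V_int(3) by (simp add: V00_def del: distrib_left_numeral)
    also have "\<dots> \<le> 4 * C + 2 * V00" using C[OF that] by simp
    finally show ?thesis .
  qed
  obtain s where s: "\<And>k. Q (s k)" and sa: "\<And>n. (\<Sum>k<n. \<Sum>l<n. a (s k) (s l)) \<le> (4 * C + 2 * V00 + 2) * real n"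
    and sb: "\<And>n. (\<Sum>k<n. b (s k)) \<le> 2"
    by (rule gram_subsequence[OF alim asym b(1) Q abd]) (assumption, rule that)
  define N where "N n = real (Suc n)" for n
  have N: "N n > 0" for n by (simp add: N_def)
  \<comment> \<open>The error of the averaged truncations is \<open>z - q\<close>: \<open>z\<close>
    averages the gradient errors \<open>w - w0\<close>, \<open>q\<close> the truncation errors
    \<open>w - g\<close>. The first tends to 0 by the Gram bound, the second because the selected
    values of \<open>b\<close> have partial sums at most 2.\<close>
  define z where "z n x = (1 / N n) *\<^sub>R (\<Sum>k<Suc n. w (s k) x - w0 x)" for n x
  define q where "q n x = (1 / N n) *\<^sub>R (\<Sum>k<Suc n. w (s k) x - g (s k) x)" for n x
  define G where "G n x = (1 / N n) *\<^sub>R (\<Sum>k<Suc n. g (s k) x)" for n x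
  have [measurable]: "z n \<in> borel_measurable M" "q n \<in> borel_measurable M" "G n \<in> borel_measurable M" for n
    unfolding z_def[abs_def] q_def[abs_def] G_def[abs_def] by measurable
  have d2: "integrable M (\<lambda>x. (w (s k) x - w0 x) \<bullet> (w (s l) x - w0 x))" for k l
  proof -
    have "integrable M (\<lambda>x. w (s k) x \<bullet> w (s l) x - w0 x \<bullet> w (s k) x - w0 x \<bullet> w (s l) x + w0 x \<bullet> w0 x)"
      using int by auto
    then show ?thesis by (rule back_subst[of "integrable M"]) (auto simp: algebra_simps inner_diff_left inner_diff_right inner_commute)
  qed
  have e2: "integrable M (\<lambda>x. (y (s k) x - y0 x) * (y (s l) x - y0 x))" for k l
  proof -
    have "integrable M (\<lambda>x. y (s k) x * y (s l) x - y0 x * y (s k) x - y0 x * y (s l) x + y0 x * y0 x)"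
      using int by auto
    then show ?thesis by (rule back_subst[of "integrable M"]) (auto simp: algebra_simps)
  qed
  have zz: "(norm (z n x))\<^sup>2 = (1 / (N n)\<^sup>2) * (\<Sum>k<Suc n. \<Sum>l<Suc n. (w (s k) x - w0 x) \<bullet> (w (s l) x - w0 x))" for n x

  proof -
    have "(\<Sum>k<Suc n. w (s k) x - w0 x) \<bullet> (\<Sum>l<Suc n. w (s l) x - w0 x)
       = (\<Sum>k<Suc n. \<Sum>l<Suc n. (w (s k) x - w0 x) \<bullet> (w (s l) x - w0 x))"
      by (subst inner_sum_left, intro sum.cong refl, subst inner_sum_right, rule refl)
    then show ?thesis
      unfolding power2_norm_eq_inner z_def inner_scaleR_left inner_scaleR_right
      by (simp add: power2_eq_square del: sum.lessThan_Suc)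
  qed
  have z2: "integrable M (\<lambda>x. (norm (z n x))\<^sup>2)" for n
    unfolding zz using d2 by (intro integrable_mult_right Bochner_Integration.integrable_sum) auto
  \<comment> \<open>The Gram sum over N indices is O(N) and is divided by N^2. It also contains the
    square integral of the summed function errors, a nonnegative term that is dropped.\<close>
  have zle: "(LINT x|M. (norm (z n x))\<^sup>2) \<le> (4 * C + 2 * V00 + 2) * (1 / N n)" for n
  proof -
    have yy: "(\<Sum>k<Suc n. y (s k) x - y0 x)\<^sup>2 = (\<Sum>k<Suc n. \<Sum>l<Suc n. (y (s k) x - y0 x) * (y (s l) x - y0 x))" for x
      by (simp add: power2_eq_square sum_product del: sum.lessThan_Suc)
    have "(LINT x|M. (norm (z n x))\<^sup>2) = (1 / (N n)\<^sup>2) * (\<Sum>k<Suc n. \<Sum>l<Suc n. LINT x|M. (w (s k) x - w0 x) \<bullet> (w (s l) x - w0 x))"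
      unfolding zz using d2 by (simp add: Bochner_Integration.integral_sum del: sum.lessThan_Suc)
    also have "\<dots> \<le> (1 / (N n)\<^sup>2) * (\<Sum>k<Suc n. \<Sum>l<Suc n. a (s k) (s l))"
    proof (intro mult_left_mono)
      have "0 \<le> (LINT x|M. (\<Sum>k<Suc n. y (s k) x - y0 x)\<^sup>2)" by simp
      also have "\<dots> = (\<Sum>k<Suc n. \<Sum>l<Suc n. LINT x|M. (y (s k) x - y0 x) * (y (s l) x - y0 x))"
        unfolding yy using e2 by (simp add: Bochner_Integration.integral_sum del: sum.lessThan_Suc)
      finally have nn: "0 \<le> (\<Sum>k<Suc n. \<Sum>l<Suc n. LINT x|M. (y (s k) x - y0 x) * (y (s l) x - y0 x))" .
      have "(\<Sum>k<Suc n. \<Sum>l<Suc n. a (s k) (s l)) = (\<Sum>k<Suc n. \<Sum>l<Suc n. LINT x|M. (y (s k) x - y0 x) * (y (s l) x - y0 x))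
         + (\<Sum>k<Suc n. \<Sum>l<Suc n. LINT x|M. (w (s k) x - w0 x) \<bullet> (w (s l) x - w0 x))"
        unfolding a_def using d2 e2 by (simp add: sum.distrib del: sum.lessThan_Suc)
      with nn show "(\<Sum>k<Suc n. \<Sum>l<Suc n. LINT x|M. (w (s k) x - w0 x) \<bullet> (w (s l) x - w0 x)) \<le> (\<Sum>k<Suc n. \<Sum>l<Suc n. a (s k) (s l))"
        by linarith
    qed simp
    also have "\<dots> \<le> (1 / (N n)\<^sup>2) * ((4 * C + 2 * V00 + 2) * N n)"
      using sa[of "Suc n"] by (intro mult_left_mono) (auto simp: N_def)
    also have "\<dots> = (4 * C + 2 * V00 + 2) * (1 / N n)" using N[of n] by (simp add: power2_eq_square)
    finally show ?thesis .
  qed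
  have Nlim: "(\<lambda>n. 1 / N n) \<longlonglongrightarrow> 0"
    using LIMSEQ_inverse_real_of_nat by (simp add: N_def inverse_eq_divide)
  have "(\<lambda>n. LINT x|M. (norm (z n x))\<^sup>2) \<longlonglongrightarrow> 0"
  proof (rule tendsto_sandwich[OF _ _ tendsto_const])
    show "\<forall>\<^sub>F n in sequentially. 0 \<le> (LINT x|M. (norm (z n x))\<^sup>2)" by simp
    show "\<forall>\<^sub>F n in sequentially. (LINT x|M. (norm (z n x))\<^sup>2) \<le> (4 * C + 2 * V00 + 2) * (1 / N n)" using zle by simp
    show "(\<lambda>n. (4 * C + 2 * V00 + 2) * (1 / N n)) \<longlonglongrightarrow> 0" using tendsto_mult_right_zero[OF Nlim] by blast
  qed
  note z1 = tendsto_L1_of_L2[of M z, OF fin _ z2 this, simplified]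
  have q1: "integrable M (q n)" for n
    unfolding q_def[abs_def] using gw s by (intro integrable_scaleR_right Bochner_Integration.integrable_sum) auto
  have qle: "(LINT x|M. norm (q n x)) \<le> 2 * (1 / N n)" for n
  proof -
    have "(LINT x|M. norm (q n x)) \<le> (LINT x|M. (1 / N n) * (\<Sum>k<Suc n. norm (w (s k) x - g (s k) x)))"
    proof (intro integral_mono)
      show "integrable M (\<lambda>x. norm (q n x))" using q1 by simp
      show "integrable M (\<lambda>x. (1 / N n) * (\<Sum>k<Suc n. norm (w (s k) x - g (s k) x)))"
        using gw s by (intro integrable_mult_right Bochner_Integration.integrable_sum integrable_norm) auto
      show "norm (q n x) \<le> (1 / N n) * (\<Sum>k<Suc n. norm (w (s k) x - g (s k) x))" for x
        using N[of n] norm_sum[of "\<lambda>k. w (s k) x - g (s k) x" "{..<Suc n}"]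
        by (simp add: q_def divide_right_mono del: sum.lessThan_Suc)
    qed
    also have "\<dots> = (1 / N n) * (\<Sum>k<Suc n. LINT x|M. norm (w (s k) x - g (s k) x))"
      using gw s by (simp add: Bochner_Integration.integral_sum del: sum.lessThan_Suc)
    also have "\<dots> \<le> (1 / N n) * (\<Sum>k<Suc n. b (s k))"
      using N[of n] b(2) s by (intro mult_left_mono sum_mono) auto
    also have "\<dots> \<le> (1 / N n) * 2" using N[of n] sb by (intro mult_left_mono) (auto simp del: sum.lessThan_Suc)
    finally show ?thesis by simp
  qed
  have qlim: "(\<lambda>n. LINT x|M. norm (q n x)) \<longlonglongrightarrow> 0"
  proof (rule tendsto_sandwich[OF _ _ tendsto_const])
    show "\<forall>\<^sub>F n in sequentially. 0 \<le> (LINT x|M. norm (q n x))" by simp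
    show "\<forall>\<^sub>F n in sequentially. (LINT x|M. norm (q n x)) \<le> 2 * (1 / N n)" using qle by simp
    show "(\<lambda>n. 2 * (1 / N n)) \<longlonglongrightarrow> 0" using tendsto_mult_right_zero[OF Nlim] by blast
  qed
  have Gw: "G n x - w0 x = z n x - q n x" for n x
    using N[of n] by (simp add: G_def z_def q_def sum_subtractf scaleR_diff_right N_def sum_constant_scaleR del: sum.lessThan_Suc)
  have Gint: "integrable M (\<lambda>x. G n x - w0 x)" for n unfolding Gw using z1(1) q1 by auto
  have "(\<lambda>n. LINT x|M. norm (G n x - w0 x)) \<longlonglongrightarrow> 0"
  proof (rule tendsto_sandwich[OF _ _ tendsto_const])
    show "\<forall>\<^sub>F n in sequentially. 0 \<le> (LINT x|M. norm (G n x - w0 x))" by simp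
    show "\<forall>\<^sub>F n in sequentially. (LINT x|M. norm (G n x - w0 x)) \<le> (LINT x|M. norm (z n x)) + (LINT x|M. norm (q n x))"
    proof (rule always_eventually, rule allI)
      fix n
      have "(LINT x|M. norm (G n x - w0 x)) \<le> (LINT x|M. norm (z n x) + norm (q n x))"
        unfolding Gw using z1(1) q1 by (intro integral_mono norm_triangle_ineq4) auto
      then show "(LINT x|M. norm (G n x - w0 x)) \<le> (LINT x|M. norm (z n x)) + (LINT x|M. norm (q n x))"
        using z1(1) q1 by simp
    qed
    show "(\<lambda>n. (LINT x|M. norm (z n x)) + (LINT x|M. norm (q n x))) \<longlonglongrightarrow> 0"
      using tendsto_add[OF z1(2) qlim] by simp
  qed
  from tendsto_L1_AE_subseq[OF Gint this]
  obtain r where r: "strict_mono r" "AE x in M. (\<lambda>n. G (r n) x - w0 x) \<longlonglongrightarrow> 0" by blast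
  \<comment> \<open>By convexity of the p-th power, averaging does not increase the common L^p
    bound.\<close>
  have Gp: "(\<integral>\<^sup>+x. ennreal (norm (G n x) powr p) \<partial>M) \<le> ennreal C" for n
  proof -
    have "(\<integral>\<^sup>+x. ennreal (norm (G n x) powr p) \<partial>M)
      \<le> (\<integral>\<^sup>+x. ennreal ((1 / N n) * (\<Sum>k<Suc n. norm (g (s k) x) powr p)) \<partial>M)"
      unfolding G_def N_def by (intro nn_integral_mono ennreal_leI powr_norm_average_le p)
    also have "\<dots> = ennreal (LINT x|M. (1 / N n) * (\<Sum>k<Suc n. norm (g (s k) x) powr p))"
    proof (rule nn_integral_eq_integral)
      show "integrable M (\<lambda>x. (1 / N n) * (\<Sum>k<Suc n. norm (g (s k) x) powr p))"
        using gp s by (intro integrable_mult_right Bochner_Integration.integrable_sum) auto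
      show "AE x in M. 0 \<le> (1 / N n) * (\<Sum>k<Suc n. norm (g (s k) x) powr p)"
        using less_imp_le[OF N[of n]] by (intro AE_I2 mult_nonneg_nonneg sum_nonneg) auto
    qed
    also have "(LINT x|M. (1 / N n) * (\<Sum>k<Suc n. norm (g (s k) x) powr p)) = (1 / N n) * (\<Sum>k<Suc n. LINT x|M. norm (g (s k) x) powr p)"
      using gp s by (simp add: Bochner_Integration.integral_sum del: sum.lessThan_Suc)
    also have "ennreal \<dots> \<le> ennreal ((1 / N n) * (\<Sum>k<Suc n. C))"
      using N[of n] gp s by (intro ennreal_leI mult_left_mono sum_mono) auto
    also have "(1 / N n) * (\<Sum>k<Suc n. C) = C" using N[of n] by (simp add: N_def)
    finally show ?thesis .
  qed
  have "(\<integral>\<^sup>+x. ennreal (norm (w0 x) powr p) \<partial>M) \<le> (\<integral>\<^sup>+x. liminf (\<lambda>n. ennreal (norm (G (r n) x) powr p)) \<partial>M)"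
  proof (rule nn_integral_mono_AE)
    show "AE x in M. ennreal (norm (w0 x) powr p) \<le> liminf (\<lambda>n. ennreal (norm (G (r n) x) powr p))"
      using r(2)
    proof eventually_elim
      case (elim x)
      then have "(\<lambda>n. G (r n) x) \<longlonglongrightarrow> w0 x" by (rule LIM_zero_cancel)
      then have "(\<lambda>n. norm (G (r n) x) powr p) \<longlonglongrightarrow> norm (w0 x) powr p"
        using p by (intro tendsto_powr' tendsto_norm tendsto_const) auto
      then have "(\<lambda>n. ennreal (norm (G (r n) x) powr p)) \<longlonglongrightarrow> ennreal (norm (w0 x) powr p)"
        by (intro tendsto_ennrealI)
      then have "liminf (\<lambda>n. ennreal (norm (G (r n) x) powr p)) = ennreal (norm (w0 x) powr p)"
        by (rule lim_imp_Liminf[rotated]) simp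
      then show ?case by simp
    qed
  qed
  also have "\<dots> \<le> liminf (\<lambda>n. \<integral>\<^sup>+x. ennreal (norm (G (r n) x) powr p) \<partial>M)"
    by (rule nn_integral_liminf) measurable
  also have "\<dots> \<le> liminf (\<lambda>n::nat. ennreal C)" by (intro Liminf_mono) (simp add: Gp)
  also have "\<dots> = ennreal C" by (rule Liminf_const) simp
  finally show ?thesis by (intro integrableI_bounded) (auto intro: le_less_trans)
qed

section \<open>Square roots of positive definite matrices\<close>

lemma inner_symmetric_matrix:
  fixes X :: "real^'n::finite^'n"
  assumes "transpose X = X" shows "u \<bullet> (X *v v) = (X *v u) \<bullet> v"
  by (metis assms dot_lmul_matrix transpose_matrix_vector)

text \<open>Polarisation with \<open>u\<close> the vector of length |v| in the direction of X v: the
  parallelogram law bounds the inner product of u and X v by q |v|^2, and that product equals |v| |X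
  v|.\<close>

lemma symmetric_form_norm_le:
  fixes X :: "real^'n::finite^'n"
  assumes X: "transpose X = X" and q: "\<And>v. \<bar>v \<bullet> (X *v v)\<bar> \<le> q * (norm v)\<^sup>2"
  shows "norm (X *v v) \<le> q * norm v"
proof (cases "v = 0 \<or> X *v v = 0")
  case True
  have "0 \<le> q * (norm v)\<^sup>2" using q[of v] by simp
  then have "v = 0 \<or> q \<ge> 0" by (auto simp: zero_le_mult_iff)
  with True show ?thesis by (auto simp: matrix_vector_mult_0_right)
next
  case False
  define w where "w = X *v v"
  define u where "u = (norm v / norm w) *\<^sub>R w"
  have nu: "norm u = norm v" using False by (simp add: u_def w_def)
  have "4 * (u \<bullet> (X *v v)) = (u + v) \<bullet> (X *v (u + v)) - (u - v) \<bullet> (X *v (u - v))"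
    using inner_symmetric_matrix[OF X, of v u]
    by (simp add: matrix_vector_right_distrib matrix_vector_mult_diff_distrib inner_add_left inner_add_right inner_diff_left inner_diff_right inner_commute)
  also have "\<dots> \<le> q * (norm (u + v))\<^sup>2 + q * (norm (u - v))\<^sup>2"
    using q[of "u + v"] q[of "u - v"] by linarith
  also have "\<dots> = q * (2 * (norm u)\<^sup>2 + 2 * (norm v)\<^sup>2)"
    by (simp add: power2_norm_eq_inner inner_add_left inner_add_right inner_diff_left inner_diff_right algebra_simps inner_commute)
  also have "\<dots> = 4 * (q * (norm v)\<^sup>2)" by (simp add: nu)
  finally have "u \<bullet> w \<le> q * (norm v)\<^sup>2" by (simp add: w_def)
  moreover have "u \<bullet> w = norm v * norm w"
    using False by (simp add: u_def w_def dot_square_norm power2_eq_square)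
  ultimately have "norm v * norm w \<le> norm v * (q * norm v)" by (simp add: power2_eq_square mult_ac)
  then show ?thesis using False by (simp add: w_def)
qed

text \<open>The norm of a matrix here is the Euclidean norm of its entries. For symmetric
  \<open>Z\<close> the rows of \<open>D ** Z\<close> are \<open>Z\<close> applied to the rows of
  \<open>D\<close>, so an operator bound on \<open>Z\<close> acts row by row.\<close>

lemma norm_matrix_mult_right_le:
  fixes D Z :: "real^'n::finite^'n"
  assumes Z: "transpose Z = Z" and r: "\<And>v. norm (Z *v v) \<le> r * norm v" "0 \<le> r"
  shows "norm (D ** Z) \<le> r * norm D"
proof -
  have "(D ** Z) $ i = Z *v (D $ i)" for i
  proof -
    have "(D ** Z) $ i = transpose Z *v (D $ i)"
      by (simp add: vec_eq_iff matrix_matrix_mult_def matrix_vector_mult_def transpose_def mult.commute)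
    then show ?thesis by (simp add: Z)
  qed
  then have "norm (D ** Z) \<le> L2_set (\<lambda>i. r * norm (D $ i)) UNIV"
    unfolding norm_vec_def[of "D ** Z"] using r by (intro L2_set_mono) auto
  also have "\<dots> = r * norm D" using r by (simp add: norm_vec_def L2_set_right_distrib)
  finally show ?thesis .
qed

lemma norm_transpose:
  fixes M :: "real^'n::finite^'n" shows "norm (transpose M) = norm M"
proof -
  have "transpose M \<bullet> transpose M = M \<bullet> M"
    unfolding inner_vec_def transpose_def by simp (rule sum.swap)
  then show ?thesis by (simp add: norm_eq_sqrt_inner)
qed

lemma norm_matrix_mult_left_le:
  fixes D Z :: "real^'n::finite^'n"
  assumes "transpose Z = Z" "transpose D = D" "\<And>v. norm (Z *v v) \<le> r * norm v" "0 \<le> r"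
  shows "norm (Z ** D) \<le> r * norm D"
proof -
  have "norm (Z ** D) = norm (D ** Z)"
    using norm_transpose[of "Z ** D"] assms by (simp add: matrix_transpose_mul)
  then show ?thesis using norm_matrix_mult_right_le[OF assms(1,3,4)] by simp
qed

lemma transpose_add: "transpose (A + B) = transpose A + transpose (B::real^'n::finite^'n)"
  by (simp add: vec_eq_iff transpose_def)

lemma transpose_diff: "transpose (A - B) = transpose A - transpose (B::real^'n::finite^'n)"
  by (simp add: vec_eq_iff transpose_def)

lemma transpose_scaleR: "transpose (c *\<^sub>R A) = c *\<^sub>R transpose (A::real^'n::finite^'n)"
  by (simp add: vec_eq_iff transpose_def)

lemma matrix_scaleR_mult: "(c *\<^sub>R A) ** B = c *\<^sub>R (A ** B)" "A ** (c *\<^sub>R B) = c *\<^sub>R (A ** B)"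
  for A B :: "real^'n::finite^'n"
  by (simp_all add: vec_eq_iff matrix_matrix_mult_def sum_distrib_left mult_ac)

lemma matrix_diff_mult: "(A - B) ** C = A ** C - B ** C" "C ** (A - B) = C ** A - C ** B"
  for A B C :: "real^'n::finite^'n"
  by (simp_all add: vec_eq_iff matrix_matrix_mult_def sum_subtractf algebra_simps)

lemma matrix_add_mult: "(A + B) ** C = A ** C + B ** C" "C ** (A + B) = C ** A + C ** B"
  for A B C :: "real^'n::finite^'n"
  by (simp_all add: vec_eq_iff matrix_matrix_mult_def sum.distrib algebra_simps)

text \<open>A fixed point \<open>Y\<close> gives \<open>(mat 1 - Y)\<^sup>2 = mat 1 - X\<close>.\<close>

lemma matrix_quadratic_fixpoint:
  fixes X :: "real^'n::finite^'n"
  assumes X: "transpose X = X" "\<And>v. norm (X *v v) \<le> q * norm v" and q: "0 \<le> q" "q < 1"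
  obtains Y where "transpose Y = Y" "\<And>v. norm (Y *v v) \<le> norm v" "2 *\<^sub>R Y = X + Y ** Y"
proof -
  \<comment> \<open>The smaller root of 2 r = q + r^2. It is both the operator bound preserved by
    the iteration and its contraction constant.\<close>
  define r where "r = 1 - sqrt (1 - q)"
  have r: "0 \<le> r" "r < 1" using q by (auto simp: r_def)
  have rq: "(q + r * r) / 2 = r" 
  proof -
    have "sqrt (1 - q) * sqrt (1 - q) = 1 - q" using q by simp
    then show ?thesis unfolding r_def by (simp only: left_diff_distrib right_diff_distrib) (simp add: field_simps)
  qed
  define S where "S = {Y::real^'n^'n. (\<forall>i j. Y $ j $ i = Y $ i $ j) \<and> (\<forall>v. norm (Y *v v) \<le> r * norm v)}"
  have S_iff: "Y \<in> S \<longleftrightarrow> transpose Y = Y \<and> (\<forall>v. norm (Y *v v) \<le> r * norm v)" for Y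
    by (auto simp: S_def transpose_def vec_eq_iff)
  define T where "T Y = (1/2) *\<^sub>R (X + Y ** Y)" for Y
  have "closed S" unfolding S_def matrix_vector_mult_def
    by (intro closed_Collect_conj closed_Collect_all closed_Collect_le closed_Collect_eq continuous_intros continuous_on_vec_lambda)
  then have "complete S" by (simp add: complete_eq_closed)
  moreover have "S \<noteq> {}" using r S_iff[of 0] by (auto simp: transpose_def vec_eq_iff)
  moreover have "T ` S \<subseteq> S"
  proof safe
    fix Y assume Y: "Y \<in> S"
    have "transpose (T Y) = T Y"
      using Y X by (simp add: S_iff T_def transpose_scaleR transpose_add matrix_transpose_mul)
    moreover have "norm (T Y *v v) \<le> r * norm v" for v
    proof -
      have "norm (Y *v (Y *v v)) \<le> r * norm (Y *v v)" using Y by (simp add: S_iff)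
      also have "\<dots> \<le> r * (r * norm v)" using Y r by (intro mult_left_mono) (auto simp: S_iff)
      finally have *: "norm (Y *v (Y *v v)) \<le> r * (r * norm v)" .
      have "T Y *v v = (1/2) *\<^sub>R (X *v v + Y *v (Y *v v))"
        by (simp add: T_def scaleR_matrix_vector_assoc[symmetric] matrix_vector_mult_add_rdistrib matrix_vector_mul_assoc)
      then have "norm (T Y *v v) \<le> (q * norm v + r * (r * norm v)) / 2"
        using norm_triangle_le[OF add_mono[OF X(2) *], of v] by simp
      also have "\<dots> = ((q + r * r) / 2) * norm v" by (simp add: algebra_simps)
      finally show ?thesis by (simp add: rq)
    qed
    ultimately show "T Y \<in> S" by (simp add: S_iff)
  qed
  moreover have "dist (T Y) (T Z) \<le> r * dist Y Z" if "Y \<in> S" "Z \<in> S" for Y Z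
  proof -
    have sym: "transpose Y = Y" "transpose Z = Z" "transpose (Y - Z) = Y - Z"
      using that by (auto simp: S_iff transpose_diff)
    \<comment> \<open>Factorisation of Y Y - Z Z without commutativity; in each summand the factor
      beside Y - Z has operator norm at most \<open>r\<close>.\<close>
    have "T Y - T Z = (1/2) *\<^sub>R (Y ** (Y - Z) + (Y - Z) ** Z)"
      by (simp add: T_def matrix_diff_mult algebra_simps)
    then have "norm (T Y - T Z) \<le> (norm (Y ** (Y - Z)) + norm ((Y - Z) ** Z)) / 2"
      using norm_triangle_ineq[of "Y ** (Y - Z)" "(Y - Z) ** Z"] by simp
    also have "\<dots> \<le> (r * norm (Y - Z) + r * norm (Y - Z)) / 2"
      using that sym r by (intro divide_right_mono add_mono norm_matrix_mult_left_le norm_matrix_mult_right_le) (auto simp: S_iff)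
    finally show ?thesis by (simp add: dist_norm)
  qed
  ultimately obtain Y where Y: "Y \<in> S" "T Y = Y"
    using Banach_fix[of S r T] r by metis
  show thesis
  proof (rule that[of Y])
    show "transpose Y = Y" using Y by (simp add: S_iff)
    show "norm (Y *v v) \<le> norm v" for v
      using Y(1) r mult_right_mono[of r 1 "norm v"] by (auto simp: S_iff intro: order_trans)
    have "2 *\<^sub>R T Y = X + Y ** Y" by (simp add: T_def)
    then show "2 *\<^sub>R Y = X + Y ** Y" by (simp add: Y(2))
  qed
qed

text \<open>The form of X = 1 - A/c is bounded by q = 1 - a/c < 1, so the fixed point
  \<open>Y\<close> exists, and sqrt c (1 - Y) is the root. It is positive semidefinite because
  \<open>Y\<close> does not increase norms.\<close>

lemma psd_sqrt_exists:
  fixes A :: "real^'n::finite^'n"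
  assumes A: "transpose A = A" and a: "0 < a" "\<And>v. a * (norm v)\<^sup>2 \<le> v \<bullet> (A *v v)"
    and c: "\<And>v. v \<bullet> (A *v v) \<le> c * (norm v)\<^sup>2" "a \<le> c"
  obtains B where "transpose B = B" "psd B" "B ** B = A"
proof -
  define X where "X = mat 1 - (1/c) *\<^sub>R A"
  have c0: "c > 0" using a c by simp
  have Xs: "transpose X = X" by (simp add: X_def transpose_diff transpose_scaleR A transpose_mat)
  have Xf: "v \<bullet> (X *v v) = (norm v)\<^sup>2 - (v \<bullet> (A *v v)) / c" for v
    by (simp add: X_def matrix_vector_mult_diff_rdistrib scaleR_matrix_vector_assoc[symmetric] inner_diff_right power2_norm_eq_inner)
  have "\<bar>v \<bullet> (X *v v)\<bar> \<le> (1 - a/c) * (norm v)\<^sup>2" for v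
  proof -
    have "a * (norm v)\<^sup>2 / c \<le> v \<bullet> (A *v v) / c" "v \<bullet> (A *v v) / c \<le> c * (norm v)\<^sup>2 / c"
      using divide_right_mono[OF a(2), of c v] divide_right_mono[OF c(1), of c v] c0 by auto
    then show ?thesis unfolding Xf using c0 by (simp add: left_diff_distrib)
  qed
  note Xn = symmetric_form_norm_le[OF Xs this]
  obtain Y where Y: "transpose Y = Y" "\<And>v. norm (Y *v v) \<le> norm v" "2 *\<^sub>R Y = X + Y ** Y"
    using matrix_quadratic_fixpoint[OF Xs Xn] a c c0 by auto
  show thesis
  proof (rule that[of "sqrt c *\<^sub>R (mat 1 - Y)"])
    show "transpose (sqrt c *\<^sub>R (mat 1 - Y)) = sqrt c *\<^sub>R (mat 1 - Y)"
      by (simp add: transpose_scaleR transpose_diff Y transpose_mat)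
    show "psd (sqrt c *\<^sub>R (mat 1 - Y))"
    proof (unfold psd_def, rule allI)
      fix v :: "real^'n"
      have "v \<bullet> (Y *v v) \<le> norm v * norm (Y *v v)" by (rule norm_cauchy_schwarz)
      also have "\<dots> \<le> norm v * norm v" by (intro mult_left_mono Y) auto
      finally have "v \<bullet> (Y *v v) \<le> v \<bullet> v" by (simp add: power2_norm_eq_inner[symmetric] power2_eq_square)
      then show "0 \<le> v \<bullet> (sqrt c *\<^sub>R (mat 1 - Y) *v v)"
        using c0 by (simp add: scaleR_matrix_vector_assoc[symmetric] matrix_vector_mult_diff_rdistrib inner_diff_right)
    qed
    have "(mat 1 - Y) ** (mat 1 - Y) = mat 1 - 2 *\<^sub>R Y + Y ** Y"
      by (simp add: matrix_diff_mult scaleR_2)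
    also have "\<dots> = mat 1 - X" by (simp add: Y(3))
    also have "\<dots> = (1/c) *\<^sub>R A" by (simp add: X_def)
    finally show "sqrt c *\<^sub>R (mat 1 - Y) ** sqrt c *\<^sub>R (mat 1 - Y) = A"
      using c0 by (simp add: matrix_scaleR_mult)
  qed
qed

text \<open>If w = B v were nonzero, the form at v + t w would have the linear term 2 t |w|^2 and
  become negative for small negative t.\<close>

lemma psd_form_zero:
  fixes B :: "real^'n::finite^'n"
  assumes B: "transpose B = B" "psd B" and v: "v \<bullet> (B *v v) = 0"
  shows "B *v v = 0"
proof (rule ccontr)
  define w where "w = B *v v"
  assume "B *v v \<noteq> 0"
  then have b: "0 < w \<bullet> w" by (simp add: w_def)
  define K where "K = w \<bullet> (B *v w)"
  have K: "0 \<le> K" using B by (simp add: K_def psd_def)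
  \<comment> \<open>At this t the value 2 t |w|^2 + t^2 K is negative; the summand 1 keeps the
    denominator positive when K = 0.\<close>
  define t where "t = - (w \<bullet> w) / (K + 1)"
  have "v \<bullet> (B *v w) = w \<bullet> w" using inner_symmetric_matrix[OF B(1), of v w] by (simp add: w_def)
  then have "(v + t *\<^sub>R w) \<bullet> (B *v (v + t *\<^sub>R w)) = 2 * t * (w \<bullet> w) + t\<^sup>2 * K"
    using v by (simp add: w_def[symmetric] K_def matrix_vector_right_distrib matrix_vector_mult_scaleR
        inner_add_left inner_add_right algebra_simps power2_eq_square)
  moreover have "\<dots> = ((w \<bullet> w) / (K + 1))\<^sup>2 * (K - 2 * (K + 1))"

  proof -
    define m where "m = K + 1"
    have "m \<noteq> 0" "K = m - 1" using K by (auto simp: m_def)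
    then show ?thesis by (simp add: t_def power2_eq_square field_simps)
  qed
  moreover have "\<dots> < 0" using K b by (intro mult_pos_neg) auto
  moreover have "0 \<le> (v + t *\<^sub>R w) \<bullet> (B *v (v + t *\<^sub>R w))" using B by (simp add: psd_def)
  ultimately show False by linarith
qed

text \<open>For D = B - C one has D B + C D = B B - C C = 0. Multiplying by D and taking the trace,
  the forms of B + C at the rows of D add up to 0. All are nonnegative, so B annihilates each row,
  and so does A = B B, which is injective.\<close>

lemma psd_sqrt_unique:
  fixes A B C :: "real^'n::finite^'n"
  assumes B: "transpose B = B" "psd B" "B ** B = A" and C: "transpose C = C" "psd C" "C ** C = A"
    and A: "\<And>v. v \<noteq> 0 \<Longrightarrow> A *v v \<noteq> 0"
  shows "B = C"
proof -
  define D where "D = B - C"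
  have Ds: "transpose D = D" by (simp add: D_def transpose_diff B C)
  have "D ** B + C ** D = 0" by (simp add: D_def matrix_diff_mult B C)
  then have "0 = trace ((D ** B + C ** D) ** D)" by (simp add: trace_def)
  also have "\<dots> = trace (D ** B ** D) + trace ((C ** D) ** D)"
    by (simp add: matrix_add_mult trace_add)
  also have "trace ((C ** D) ** D) = trace (D ** C ** D)"
    by (metis matrix_mul_assoc trace_mul_sym)
  also have "trace (D ** B ** D) + trace (D ** C ** D) = trace (D ** (B + C) ** D)"
    by (simp add: trace_add[symmetric] matrix_add_mult)
  also have "\<dots> = (\<Sum>i\<in>UNIV. (D $ i) \<bullet> ((B + C) *v (D $ i)))"
  proof -
    have "(D ** M ** D) $ i $ i = (D $ i) \<bullet> (M *v (D $ i))" for M i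
    proof -
      have sy: "D $ j $ i = D $ i $ j" for j using Ds by (metis transpose_def vec_lambda_beta)
      have "(M ** D) $ k $ i = (M *v (D $ i)) $ k" for k
        unfolding matrix_matrix_mult_def matrix_vector_mult_def vec_lambda_beta
        by (intro sum.cong refl) (subst sy, rule refl)
      moreover have "(D ** (M ** D)) $ i $ i = (\<Sum>k\<in>UNIV. D $ i $ k * (M ** D) $ k $ i)"
        by (simp add: matrix_matrix_mult_def)
      ultimately show ?thesis
        by (simp add: matrix_mul_assoc[symmetric] inner_vec_def)
    qed
    then show ?thesis by (simp add: trace_def)
  qed
  finally have s0: "(\<Sum>i\<in>UNIV. (D $ i) \<bullet> ((B + C) *v (D $ i))) = 0" by simp
  have nn: "0 \<le> (D $ i) \<bullet> (B *v (D $ i))" "0 \<le> (D $ i) \<bullet> (C *v (D $ i))" for i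
    using B C by (auto simp: psd_def)
  have "D $ i = 0" for i
  proof (rule ccontr)
    assume "D $ i \<noteq> 0"
    have "(D $ i) \<bullet> ((B + C) *v (D $ i)) = 0"
      using s0 nn by (subst (asm) sum_nonneg_eq_0_iff) (auto simp: matrix_vector_mult_add_rdistrib inner_add_right)
    then have "(D $ i) \<bullet> (B *v (D $ i)) = 0"
      using nn[of i] by (simp add: matrix_vector_mult_add_rdistrib inner_add_right)
    then have "B *v (D $ i) = 0" by (rule psd_form_zero[OF B(1,2)])
    then have "A *v (D $ i) = 0" by (simp add: B(3)[symmetric] matrix_vector_mul_assoc[symmetric])
    with A \<open>D $ i \<noteq> 0\<close> show False by blast
  qed
  then show ?thesis by (simp add: D_def vec_eq_iff)
qed

text \<open>Existence and uniqueness identify the definite description \<open>msqrt A\<close> with a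
  symmetric root B; then |B v|^2 is the inner product of v with B (B v).\<close>

lemma norm_msqrt_mult:
  fixes A :: "real^'n::finite^'n"
  assumes A: "transpose A = A" and a: "0 < a" "\<And>v. a * (norm v)\<^sup>2 \<le> v \<bullet> (A *v v)"
    and c: "\<And>v. v \<bullet> (A *v v) \<le> c * (norm v)\<^sup>2" "a \<le> c"
  shows "(norm (msqrt A *v v))\<^sup>2 = v \<bullet> (A *v v)"
proof -
  have inj: "A *v v \<noteq> 0" if "v \<noteq> 0" for v
  proof
    assume "A *v v = 0"
    then have "a * (norm v)\<^sup>2 \<le> 0" using a(2)[of v] by simp
    then show False using that a(1) by (simp add: mult_le_0_iff)
  qed
  obtain B where B: "transpose B = B" "psd B" "B ** B = A"
    using psd_sqrt_exists[OF A a c] by blast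
  have "msqrt A = B" unfolding msqrt_def

  proof (rule the_equality)
    show "transpose B = B \<and> psd B \<and> B ** B = A" using B by simp
    fix C assume "transpose C = C \<and> psd C \<and> C ** C = A"
    then show "C = B" using psd_sqrt_unique[of C A B] B inj by blast
  qed
  then show ?thesis
    using inner_symmetric_matrix[OF B(1), of v "B *v v"]
    by (simp add: power2_norm_eq_inner matrix_vector_mul_assoc B(3))
qed

section \<open>Functions in \<open>H\<^sup>1\<^sub>0\<close>\<close>

lemma abs_powr_2: "\<bar>t\<bar> powr 2 = (t::real)\<^sup>2"
  by (cases "t = 0") auto

lemma norm_powr_2: "norm v powr 2 = (norm v)\<^sup>2"
  using abs_powr_2[of "norm v"] by simp

lemma norm_diff_sq_le: "(norm (a - b))\<^sup>2 \<le> 2 * (norm a)\<^sup>2 + 2 * (norm b)\<^sup>2"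
  for a b :: "'e::real_normed_vector"
proof -
  have "(norm (a - b))\<^sup>2 \<le> (norm a + norm b)\<^sup>2" by (intro power_mono norm_triangle_ineq4) auto
  also have "\<dots> \<le> 2 * (norm a)\<^sup>2 + 2 * (norm b)\<^sup>2"
    using sum_squares_bound[of "norm a" "norm b"] by (simp add: power2_sum)
  finally show ?thesis .
qed

lemma integrable_norm_diff_sq:
  fixes u v :: "'a \<Rightarrow> 'e::{banach, second_countable_topology}"
  assumes [measurable]: "u \<in> borel_measurable M" "v \<in> borel_measurable M"
    and "integrable M (\<lambda>x. (norm (u x))\<^sup>2)" "integrable M (\<lambda>x. (norm (v x))\<^sup>2)"
  shows "integrable M (\<lambda>x. (norm (u x - v x))\<^sup>2)"
proof (rule Bochner_Integration.integrable_bound)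
  show "integrable M (\<lambda>x. 2 * (norm (u x))\<^sup>2 + 2 * (norm (v x))\<^sup>2)" using assms by simp
  show "AE x in M. norm ((norm (u x - v x))\<^sup>2) \<le> norm (2 * (norm (u x))\<^sup>2 + 2 * (norm (v x))\<^sup>2)"
    using norm_diff_sq_le by (intro AE_I2) auto
qed measurable

lemma integrable_of_square:
  fixes u :: "'a \<Rightarrow> 'e::{banach, second_countable_topology}"
  assumes "finite_measure M" "u \<in> borel_measurable M" "integrable M (\<lambda>x. (norm (u x))\<^sup>2)"
  shows "integrable M u"
proof (rule Bochner_Integration.integrable_bound)
  interpret finite_measure M by fact
  show "integrable M (\<lambda>x. 1 + (norm (u x))\<^sup>2)" using assms by simp
  show "AE x in M. norm (u x) \<le> norm (1 + (norm (u x))\<^sup>2)"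
  proof (rule AE_I2)
    fix x
    have "0 \<le> (norm (u x) - 1)\<^sup>2" by simp
    then have "2 * norm (u x) \<le> 1 + (norm (u x))\<^sup>2" by (simp add: power2_diff)
    then have "norm (u x) \<le> 1 + (norm (u x))\<^sup>2" using norm_ge_zero[of "u x"] by linarith
    then show "norm (u x) \<le> norm (1 + (norm (u x))\<^sup>2)" by simp
  qed
qed (use assms in auto)

lemma borel_measurable_vec_components:
  fixes g :: "'a \<Rightarrow> real^'n::finite"
  assumes "\<And>j. (\<lambda>x. g x $ j) \<in> borel_measurable M" shows "g \<in> borel_measurable M"
  using assms by (subst borel_measurable_euclidean_space) (auto simp: Basis_vec_def inner_axis)

lemma vec_component_measurable[measurable]: "(\<lambda>x::real^'n::finite. x $ j) \<in> borel_measurable borel"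
  by (intro borel_measurable_continuous_onI continuous_intros)

lemma grad_nth: "grad f x $ j = pd j f x"
  by (simp add: grad_def)

lemma borel_lebesgue_on: "f \<in> borel_measurable borel \<Longrightarrow> f \<in> borel_measurable (lebesgue_on S)"
  by (intro measurable_restrict_space1 measurable_completion) simp

lemma smooth_fun_grad_borel: "smooth_fun \<phi> \<Longrightarrow> grad \<phi> \<in> borel_measurable borel"
  by (rule borel_measurable_vec_components) (simp add: grad_nth smooth_fun_borel smooth_fun_pd)

lemma finite_measure_lebesgue_on:
  fixes \<Omega> :: "'a::euclidean_space set"
  assumes "open \<Omega>" "bounded \<Omega>" shows "finite_measure (lebesgue_on \<Omega>)"
proof (rule finite_measureI)
  have "emeasure (lebesgue_on \<Omega>) \<Omega> = emeasure lborel \<Omega>"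
    using assms by (subst emeasure_restrict_space) auto
  moreover have "emeasure lborel \<Omega> < \<infinity>" by (rule emeasure_bounded_finite[OF assms(2)])
  ultimately show "emeasure (lebesgue_on \<Omega>) (space (lebesgue_on \<Omega>)) \<noteq> \<infinity>"
    by (simp add: space_restrict_space)
qed

lemma sob0_weak_grad: "sob0 \<Omega> p y \<Longrightarrow> weak_grad \<Omega> y (wgrad \<Omega> y)"
  unfolding sob0_def sob_def wgrad_def by (metis someI_ex)

lemma weak_grad_measurable: "weak_grad \<Omega> u g \<Longrightarrow> g \<in> borel_measurable (lebesgue_on \<Omega>)"
  by (rule borel_measurable_vec_components) (simp add: weak_grad_def locint_def)

text \<open>\<open>sob\<close> grants square integrability to some weak gradient; a.e. uniqueness
  passes it on to the chosen one.\<close>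

lemma sob0_2_square_integrable:
  fixes y :: "real^'n::finite \<Rightarrow> real"
  assumes "open \<Omega>" and y: "sob0 \<Omega> 2 y"
  shows "y \<in> borel_measurable (lebesgue_on \<Omega>)" "integrable (lebesgue_on \<Omega>) (\<lambda>x. (y x)\<^sup>2)"
    "wgrad \<Omega> y \<in> borel_measurable (lebesgue_on \<Omega>)" "integrable (lebesgue_on \<Omega>) (\<lambda>x. (norm (wgrad \<Omega> y x))\<^sup>2)"
proof -
  show "y \<in> borel_measurable (lebesgue_on \<Omega>)" "integrable (lebesgue_on \<Omega>) (\<lambda>x. (y x)\<^sup>2)"
    using y by (auto simp: sob0_def sob_def Lp_def abs_powr_2)
  show m[measurable]: "wgrad \<Omega> y \<in> borel_measurable (lebesgue_on \<Omega>)"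
    by (rule weak_grad_measurable[OF sob0_weak_grad[OF y]])
  obtain g where g: "weak_grad \<Omega> y g" "integrable (lebesgue_on \<Omega>) (\<lambda>x. (norm (g x))\<^sup>2)"
    using y by (auto simp: sob0_def sob_def Lp_def norm_powr_2)
  have ae: "AE x in lebesgue_on \<Omega>. g x = wgrad \<Omega> y x"
    by (rule weak_grad_unique[OF \<open>open \<Omega>\<close> g(1) sob0_weak_grad[OF y]])
  show "integrable (lebesgue_on \<Omega>) (\<lambda>x. (norm (wgrad \<Omega> y x))\<^sup>2)"
    using g(2) by (rule integrable_cong_AE_imp) (use ae in \<open>auto elim!: eventually_mono\<close>)
qed

lemma test_fun_square_integrable:
  fixes \<phi> :: "real^'n::finite \<Rightarrow> real"
  assumes "open \<Omega>" and \<phi>: "test_fun \<Omega> \<phi>"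
  shows "integrable (lebesgue_on \<Omega>) (\<lambda>x. (\<phi> x)\<^sup>2)" "(LINT x|lebesgue_on \<Omega>. (\<phi> x)\<^sup>2) = (LINT x|lborel. (\<phi> x)\<^sup>2)"
proof -
  have [measurable]: "\<phi> \<in> borel_measurable borel" using \<phi> by (auto intro: smooth_fun_borel test_fun_smooth)
  have "test_fun \<Omega> (\<lambda>x. \<phi> x * \<phi> x)" by (rule test_fun_mult_smooth[OF \<phi> test_fun_smooth[OF \<phi>]])
  then have "integrable lborel (\<lambda>x. (\<phi> x)\<^sup>2)" by (simp add: test_fun_integrable power2_eq_square)
  moreover have "(\<phi> x)\<^sup>2 = 0" if "x \<notin> \<Omega>" for x using test_fun_zero_outside[OF \<phi> that] by simp
  ultimately show "integrable (lebesgue_on \<Omega>) (\<lambda>x. (\<phi> x)\<^sup>2)" "(LINT x|lebesgue_on \<Omega>. (\<phi> x)\<^sup>2) = (LINT x|lborel. (\<phi> x)\<^sup>2)"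
    using \<open>open \<Omega>\<close> by (simp_all add: lebesgue_on_eq_lborel)
qed

lemma test_fun_grad_square_integrable:
  fixes \<phi> :: "real^'n::finite \<Rightarrow> real"
  assumes "open \<Omega>" and \<phi>: "test_fun \<Omega> \<phi>"
  shows "integrable (lebesgue_on \<Omega>) (\<lambda>x. (norm (grad \<phi> x))\<^sup>2)"
proof -
  have "(norm (grad \<phi> x))\<^sup>2 = (\<Sum>j\<in>UNIV. (pd j \<phi> x)\<^sup>2)" for x
    unfolding power2_norm_eq_inner inner_vec_def by (simp add: grad_nth power2_eq_square)
  then show ?thesis
    using test_fun_square_integrable(1)[OF \<open>open \<Omega>\<close> test_fun_pd[OF \<phi>]] by (simp add: Bochner_Integration.integrable_sum)
qed

text \<open>The integral of a non-integrable function is 0 by convention, so the limits in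
  \<open>sob0\<close> are informative only together with the integrability recorded here.\<close>

lemma sob0_2_approx:
  fixes y :: "real^'n::finite \<Rightarrow> real"
  assumes "open \<Omega>" and y: "sob0 \<Omega> 2 y"
  obtains \<phi> where "\<And>n. test_fun \<Omega> (\<phi> n)"
    "\<And>n. integrable (lebesgue_on \<Omega>) (\<lambda>x. (norm (\<phi> n x - y x))\<^sup>2)"
    "\<And>n. integrable (lebesgue_on \<Omega>) (\<lambda>x. (norm (grad (\<phi> n) x - wgrad \<Omega> y x))\<^sup>2)"
    "(\<lambda>n. LINT x|lebesgue_on \<Omega>. (norm (\<phi> n x - y x))\<^sup>2) \<longlonglongrightarrow> 0"
    "(\<lambda>n. LINT x|lebesgue_on \<Omega>. (norm (grad (\<phi> n) x - wgrad \<Omega> y x))\<^sup>2) \<longlonglongrightarrow> 0"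
proof -
  note sq = sob0_2_square_integrable[OF assms]
  obtain \<phi> where \<phi>: "\<forall>n. test_fun \<Omega> (\<phi> n)"
    "(\<lambda>n. LINT x|lebesgue_on \<Omega>. \<bar>\<phi> n x - y x\<bar> powr 2) \<longlonglongrightarrow> 0"
    "(\<lambda>n. LINT x|lebesgue_on \<Omega>. norm (grad (\<phi> n) x - wgrad \<Omega> y x) powr 2) \<longlonglongrightarrow> 0"
    using y unfolding sob0_def by blast
  show thesis
  proof (rule that[of \<phi>])
    show t: "test_fun \<Omega> (\<phi> n)" for n using \<phi> by blast
    have sm: "smooth_fun (\<phi> n)" for n by (rule test_fun_smooth[OF t])
    show "integrable (lebesgue_on \<Omega>) (\<lambda>x. (norm (\<phi> n x - y x))\<^sup>2)" for n
      by (rule integrable_norm_diff_sq[OF borel_lebesgue_on[OF smooth_fun_borel[OF sm]] sq(1)])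
        (use sq test_fun_square_integrable(1)[OF \<open>open \<Omega>\<close> t] in auto)
    show "integrable (lebesgue_on \<Omega>) (\<lambda>x. (norm (grad (\<phi> n) x - wgrad \<Omega> y x))\<^sup>2)" for n
      by (rule integrable_norm_diff_sq[OF borel_lebesgue_on[OF smooth_fun_grad_borel[OF sm]] sq(3)])
        (use sq test_fun_grad_square_integrable[OF \<open>open \<Omega>\<close> t] in auto)
  qed (use \<phi> in \<open>simp_all add: abs_powr_2 norm_powr_2\<close>)
qed

text \<open>Passage to the limit from test functions. At exponent 2 their constant is (4 R)^2, and
  two uses of |a - b|^2 <= 2|a|^2 + 2|b|^2 cost the factor 4.\<close>

lemma sob0_2_poincare:
  fixes y :: "real^'n::finite \<Rightarrow> real"
  assumes "open \<Omega>" and y: "sob0 \<Omega> 2 y" and R: "\<Omega> \<subseteq> cball 0 R" "R > 0"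
  shows "(LINT x|lebesgue_on \<Omega>. (y x)\<^sup>2) \<le> 4 * (4 * R)\<^sup>2 * (LINT x|lebesgue_on \<Omega>. (norm (wgrad \<Omega> y x))\<^sup>2)"
proof -
  let ?M = "lebesgue_on \<Omega>" and ?w = "wgrad \<Omega> y"
  note sq = sob0_2_square_integrable[OF assms(1,2)]
  obtain \<phi> where t: "\<And>n. test_fun \<Omega> (\<phi> n)"
    and i: "\<And>n. integrable ?M (\<lambda>x. (norm (\<phi> n x - y x))\<^sup>2)" "\<And>n. integrable ?M (\<lambda>x. (norm (grad (\<phi> n) x - ?w x))\<^sup>2)"
    and l: "(\<lambda>n. LINT x|?M. (norm (\<phi> n x - y x))\<^sup>2) \<longlonglongrightarrow> 0" "(\<lambda>n. LINT x|?M. (norm (grad (\<phi> n) x - ?w x))\<^sup>2) \<longlonglongrightarrow> 0"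
    by (rule sob0_2_approx[OF assms(1,2)]) (rule that)
  \<comment> \<open>Any fixed direction will do, since each partial derivative is dominated by the
    gradient.\<close>
  let ?j = "undefined :: 'n"
  define K where "K = (4 * R)\<^sup>2"
  have K: "K \<ge> 0" by (simp add: K_def)
  have "(LINT x|?M. (y x)\<^sup>2) \<le> 2 * (LINT x|?M. (norm (\<phi> n x - y x))\<^sup>2)
     + 4 * K * (LINT x|?M. (norm (grad (\<phi> n) x - ?w x))\<^sup>2) + 4 * K * (LINT x|?M. (norm (?w x))\<^sup>2)" for n
  proof -
    note i1 = test_fun_square_integrable[OF \<open>open \<Omega>\<close> t]
    note i2 = test_fun_square_integrable[OF \<open>open \<Omega>\<close> test_fun_pd[OF t]]
    have "(LINT x|?M. (y x)\<^sup>2) \<le> (LINT x|?M. 2 * (norm (\<phi> n x - y x))\<^sup>2 + 2 * (\<phi> n x)\<^sup>2)"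
    proof (intro integral_mono)
      fix x show "(y x)\<^sup>2 \<le> 2 * (norm (\<phi> n x - y x))\<^sup>2 + 2 * (\<phi> n x)\<^sup>2"
        using norm_diff_sq_le[of "\<phi> n x" "\<phi> n x - y x"] by simp
    qed (use sq i i1 in auto)
    also have "\<dots> = 2 * (LINT x|?M. (norm (\<phi> n x - y x))\<^sup>2) + 2 * (LINT x|?M. (\<phi> n x)\<^sup>2)"
      using i(1)[of n] i1(1)[of n] by simp
    also have "(LINT x|?M. (\<phi> n x)\<^sup>2) \<le> K * (LINT x|?M. (pd ?j (\<phi> n) x)\<^sup>2)"
    proof -
      have "norm x \<le> R" if "\<phi> n x \<noteq> 0" for x
        using test_fun_zero_outside[OF t] that R by fastforce
      from poincare_test_fun[OF t this R(2), where p=2 and j="?j"] show ?thesis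
        using R(2) by (simp add: i1 i2 abs_powr_2 K_def)
    qed
    also have "(LINT x|?M. (pd ?j (\<phi> n) x)\<^sup>2) \<le> (LINT x|?M. 2 * (norm (grad (\<phi> n) x - ?w x))\<^sup>2 + 2 * (norm (?w x))\<^sup>2)"
    proof (intro integral_mono)
      fix x
      have "(pd ?j (\<phi> n) x)\<^sup>2 \<le> (norm (grad (\<phi> n) x))\<^sup>2"
        using power_mono[OF component_le_norm_cart[of "grad (\<phi> n) x" ?j], of 2] by (simp add: grad_nth)
      also have "\<dots> \<le> 2 * (norm (grad (\<phi> n) x - ?w x))\<^sup>2 + 2 * (norm (?w x))\<^sup>2"
        using norm_diff_sq_le[of "grad (\<phi> n) x - ?w x" "- ?w x"] by simp
      finally show "(pd ?j (\<phi> n) x)\<^sup>2 \<le> 2 * (norm (grad (\<phi> n) x - ?w x))\<^sup>2 + 2 * (norm (?w x))\<^sup>2" .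
    qed (use sq i i2 in auto)
    also have "\<dots> = 2 * (LINT x|?M. (norm (grad (\<phi> n) x - ?w x))\<^sup>2) + 2 * (LINT x|?M. (norm (?w x))\<^sup>2)"
      using i(2)[of n] sq by simp
    finally show ?thesis using K by (simp add: algebra_simps mult_right_mono)
  qed
  moreover have "(\<lambda>n. 2 * (LINT x|?M. (norm (\<phi> n x - y x))\<^sup>2)
     + 4 * K * (LINT x|?M. (norm (grad (\<phi> n) x - ?w x))\<^sup>2) + 4 * K * (LINT x|?M. (norm (?w x))\<^sup>2))
     \<longlonglongrightarrow> 2 * 0 + 4 * K * 0 + 4 * K * (LINT x|?M. (norm (?w x))\<^sup>2)"
    by (intro tendsto_intros l)
  ultimately show ?thesis unfolding K_def[symmetric]
    by (intro tendsto_lowerbound[of _ _ sequentially]) auto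
qed

lemma integral_mult_bounded_tendsto:
  fixes f :: "nat \<Rightarrow> 'a \<Rightarrow> real"
  assumes "\<And>n. integrable M (f n)" "integrable M g" "(\<lambda>n. LINT x|M. \<bar>f n x - g x\<bar>) \<longlonglongrightarrow> 0"
    and h: "h \<in> borel_measurable M" "\<And>x. \<bar>h x\<bar> \<le> B"
  shows "(\<lambda>n. LINT x|M. f n x * h x) \<longlonglongrightarrow> (LINT x|M. g x * h x)"
proof (rule LIM_zero_cancel, rule Lim_null_comparison)
  note i = integrable_mult_bounded[OF assms(1) h] integrable_mult_bounded[OF assms(2) h]
  show "\<forall>\<^sub>F n in sequentially. norm ((LINT x|M. f n x * h x) - (LINT x|M. g x * h x)) \<le> B * (LINT x|M. \<bar>f n x - g x\<bar>)"
  proof (rule always_eventually, rule allI)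
    fix n
    have "(LINT x|M. f n x * h x) - (LINT x|M. g x * h x) = (LINT x|M. (f n x - g x) * h x)"
      using i by (simp add: left_diff_distrib)
    also have "\<bar>\<dots>\<bar> \<le> (LINT x|M. \<bar>(f n x - g x) * h x\<bar>)" by (rule integral_abs_bound)
    also have "\<dots> \<le> (LINT x|M. B * \<bar>f n x - g x\<bar>)"
    proof (intro integral_mono)
      show "integrable M (\<lambda>x. \<bar>(f n x - g x) * h x\<bar>)"
        using i by (simp add: left_diff_distrib)
      show "\<bar>(f n x - g x) * h x\<bar> \<le> B * \<bar>f n x - g x\<bar>" for x
        using mult_right_mono[OF h(2)[of x], of "\<bar>f n x - g x\<bar>"] by (simp add: abs_mult mult.commute)
    qed (use assms in auto)
    finally show "norm ((LINT x|M. f n x * h x) - (LINT x|M. g x * h x)) \<le> B * (LINT x|M. \<bar>f n x - g x\<bar>)" by simp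
  qed
  show "(\<lambda>n. B * (LINT x|M. \<bar>f n x - g x\<bar>)) \<longlonglongrightarrow> 0" using tendsto_mult_right_zero[OF assms(3)] .
qed

text \<open>Here zero boundary values enter: an approximant supported in \<Omega> can be integrated
  by parts against any test function of the whole space without boundary terms, and both sides pass
  to the limit by L^1 convergence.\<close>

lemma sob0_2_weak_pd:
  fixes y :: "real^'n::finite \<Rightarrow> real"
  assumes "open \<Omega>" "bounded \<Omega>" and y: "sob0 \<Omega> 2 y"
    and u: "u \<in> borel_measurable borel" "AE x in lebesgue_on \<Omega>. u x = y x" "\<And>x. x \<notin> \<Omega> \<Longrightarrow> u x = 0"
    and G: "G \<in> borel_measurable borel" "AE x in lebesgue_on \<Omega>. G x = wgrad \<Omega> y x $ j" "\<And>x. x \<notin> \<Omega> \<Longrightarrow> G x = 0"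
  shows "weak_pd j u G"
proof -
  let ?M = "lebesgue_on \<Omega>" and ?w = "wgrad \<Omega> y"
  have fin: "finite_measure ?M" by (rule finite_measure_lebesgue_on[OF assms(1,2)])
  note sq = sob0_2_square_integrable[OF assms(1) y]
  have O[measurable]: "\<Omega> \<in> sets borel" using \<open>open \<Omega>\<close> by simp
  note um[measurable] = u(1) and Gm[measurable] = G(1)
  have yi: "integrable ?M y" using integrable_of_square[OF fin sq(1)] sq(2) by simp
  have wi: "integrable ?M ?w" by (rule integrable_of_square[OF fin sq(3,4)])
  have wji: "integrable ?M (\<lambda>x. ?w x $ j)"
    using integrable_bounded_linear[OF bounded_linear_vec_nth wi] .
  have uiM: "integrable ?M u"
    using yi by (rule integrable_cong_AE_imp) (use u(2) in \<open>auto intro!: borel_lebesgue_on elim!: eventually_mono\<close>)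
  have GiM: "integrable ?M G"
    using wji by (rule integrable_cong_AE_imp) (use G(2) in \<open>auto intro!: borel_lebesgue_on elim!: eventually_mono\<close>)
  have ui: "integrable lborel u" using uiM u(3) by (subst (asm) lebesgue_on_eq_lborel) auto
  have Gi: "integrable lborel G" using GiM G(3) by (subst (asm) lebesgue_on_eq_lborel) auto
  obtain \<phi> where t: "\<And>n. test_fun \<Omega> (\<phi> n)"
    and i: "\<And>n. integrable ?M (\<lambda>x. (norm (\<phi> n x - y x))\<^sup>2)" "\<And>n. integrable ?M (\<lambda>x. (norm (grad (\<phi> n) x - ?w x))\<^sup>2)"
    and l: "(\<lambda>n. LINT x|?M. (norm (\<phi> n x - y x))\<^sup>2) \<longlonglongrightarrow> 0" "(\<lambda>n. LINT x|?M. (norm (grad (\<phi> n) x - ?w x))\<^sup>2) \<longlonglongrightarrow> 0"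
    by (rule sob0_2_approx[OF assms(1) y]) (rule that)
  have m: "(\<lambda>x. \<phi> n x - y x) \<in> borel_measurable ?M" "(\<lambda>x. grad (\<phi> n) x - ?w x) \<in> borel_measurable ?M" for n
    using sq borel_lebesgue_on[OF smooth_fun_borel[OF test_fun_smooth[OF t]]]
      borel_lebesgue_on[OF smooth_fun_grad_borel[OF test_fun_smooth[OF t]]] by auto
  note l1 = tendsto_L1_of_L2[OF fin m(1) i(1) l(1)] and l2 = tendsto_L1_of_L2[OF fin m(2) i(2) l(2)]
  have \<phi>i: "integrable ?M (\<phi> n)" "integrable ?M (pd j (\<phi> n))" for n
    using test_fun_zero_outside[OF t] test_fun_zero_outside[OF test_fun_pd[OF t]]
      test_fun_integrable[OF t] test_fun_integrable[OF test_fun_pd[OF t]]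
      smooth_fun_borel[OF test_fun_smooth[OF t]] smooth_fun_borel[OF test_fun_smooth[OF test_fun_pd[OF t]]]
    by (simp_all add: lebesgue_on_eq_lborel)
  have l2': "(\<lambda>n. LINT x|?M. \<bar>pd j (\<phi> n) x - ?w x $ j\<bar>) \<longlonglongrightarrow> 0"
  proof (rule tendsto_sandwich[OF _ _ tendsto_const l2(2)])
    show "\<forall>\<^sub>F n in sequentially. 0 \<le> (LINT x|?M. \<bar>pd j (\<phi> n) x - ?w x $ j\<bar>)" by simp
    show "\<forall>\<^sub>F n in sequentially. (LINT x|?M. \<bar>pd j (\<phi> n) x - ?w x $ j\<bar>) \<le> (LINT x|?M. norm (grad (\<phi> n) x - ?w x))"
    proof (rule always_eventually, rule allI, intro integral_mono)
      fix n x
      show "\<bar>pd j (\<phi> n) x - ?w x $ j\<bar> \<le> norm (grad (\<phi> n) x - ?w x)"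
        using component_le_norm_cart[of "grad (\<phi> n) x - ?w x" j] by (simp add: grad_nth)
    qed (use l2(1) \<phi>i wji in auto)
  qed
  show ?thesis unfolding weak_pd_def
  proof (intro conjI ui Gi allI impI)
    fix \<psi> :: "real^'n \<Rightarrow> real" assume \<psi>: "test_fun UNIV \<psi>"
    have [measurable]: "\<psi> \<in> borel_measurable borel" "pd j \<psi> \<in> borel_measurable borel"
      using \<psi> by (auto intro: smooth_fun_borel test_fun_smooth test_fun_pd)
    have Mm: "\<psi> \<in> borel_measurable ?M" "pd j \<psi> \<in> borel_measurable ?M" "u \<in> borel_measurable ?M" "G \<in> borel_measurable ?M"
      by (auto intro: borel_lebesgue_on)
    obtain B where B: "\<And>x. \<bar>\<psi> x\<bar> \<le> B" using test_fun_bounded[OF \<psi>] by metis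
    obtain B' where B': "\<And>x. \<bar>pd j \<psi> x\<bar> \<le> B'" using test_fun_bounded[OF test_fun_pd[OF \<psi>]] by metis
    have "(\<lambda>n. LINT x|?M. \<phi> n x * pd j \<psi> x) \<longlonglongrightarrow> (LINT x|?M. y x * pd j \<psi> x)"
      using l1(2) by (intro integral_mult_bounded_tendsto[OF \<phi>i(1) yi _ _ B'] borel_lebesgue_on) auto
    moreover have "(\<lambda>n. LINT x|?M. pd j (\<phi> n) x * \<psi> x) \<longlonglongrightarrow> (LINT x|?M. ?w x $ j * \<psi> x)"
      by (intro integral_mult_bounded_tendsto[OF \<phi>i(2) wji l2' _ B] borel_lebesgue_on) auto
    moreover have "(LINT x|?M. \<phi> n x * pd j \<psi> x) = - (LINT x|?M. pd j (\<phi> n) x * \<psi> x)" for n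
    proof -
      have bm[measurable]: "\<phi> n \<in> borel_measurable borel" "pd j (\<phi> n) \<in> borel_measurable borel"
        using t by (auto intro: smooth_fun_borel test_fun_smooth test_fun_pd)
      have "0 = (LINT x|lborel. pd j (\<lambda>x. \<psi> x * \<phi> n x) x)"
        by (rule integral_pd_test_fun[symmetric, OF test_fun_mult_smooth[OF t test_fun_smooth[OF \<psi>]]])
      also have "\<dots> = (LINT x|lborel. pd j (\<phi> n) x * \<psi> x + \<phi> n x * pd j \<psi> x)"
        using pd_mult[OF smooth_fun_differentiable[OF test_fun_smooth[OF \<psi>]] smooth_fun_differentiable[OF test_fun_smooth[OF t]]]
        by (simp add: mult.commute)
      also have "\<dots> = (LINT x|lborel. pd j (\<phi> n) x * \<psi> x) + (LINT x|lborel. \<phi> n x * pd j \<psi> x)"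
        using test_fun_mult_integrable[OF test_fun_integrable[OF test_fun_pd[OF t]] \<psi>]
          test_fun_mult_integrable[OF test_fun_integrable[OF t] test_fun_pd[OF \<psi>]]
        by (rule Bochner_Integration.integral_add)
      also have "(LINT x|lborel. pd j (\<phi> n) x * \<psi> x) = (LINT x|?M. pd j (\<phi> n) x * \<psi> x)"
        using test_fun_zero_outside[OF test_fun_pd[OF t]] by (intro lebesgue_on_eq_lborel(2)[symmetric]) auto
      also have "(LINT x|lborel. \<phi> n x * pd j \<psi> x) = (LINT x|?M. \<phi> n x * pd j \<psi> x)"
        using test_fun_zero_outside[OF t] by (intro lebesgue_on_eq_lborel(2)[symmetric]) auto
      finally show ?thesis by simp
    qed
    ultimately have "(\<lambda>n. - (LINT x|?M. pd j (\<phi> n) x * \<psi> x)) \<longlonglongrightarrow> (LINT x|?M. y x * pd j \<psi> x)"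
      and "(\<lambda>n. - (LINT x|?M. pd j (\<phi> n) x * \<psi> x)) \<longlonglongrightarrow> - (LINT x|?M. ?w x $ j * \<psi> x)"
      by (auto intro: tendsto_minus)
    then have "(LINT x|?M. y x * pd j \<psi> x) = - (LINT x|?M. ?w x $ j * \<psi> x)" by (rule LIMSEQ_unique)
    moreover have "(LINT x|lborel. u x * pd j \<psi> x) = (LINT x|?M. u x * pd j \<psi> x)"
      using u(3) by (intro lebesgue_on_eq_lborel(2)[symmetric]) auto
    moreover have "(LINT x|?M. u x * pd j \<psi> x) = (LINT x|?M. y x * pd j \<psi> x)"
      using u(2) sq(1) Mm by (intro integral_cong_AE) (auto intro: borel_measurable_times elim!: eventually_mono)
    moreover have "(LINT x|lborel. G x * \<psi> x) = (LINT x|?M. G x * \<psi> x)"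
      using G(3) by (intro lebesgue_on_eq_lborel(2)[symmetric]) auto
    moreover have "(LINT x|?M. G x * \<psi> x) = (LINT x|?M. ?w x $ j * \<psi> x)"
      using G(2) wji Mm by (intro integral_cong_AE) (auto intro: borel_measurable_times elim!: eventually_mono)
    ultimately show "(LINT x|lborel. u x * pd j \<psi> x) = - (LINT x|lborel. G x * \<psi> x)" by simp
  qed
qed

section \<open>Density of test functions on Lipschitz domains\<close>

text \<open>In the interior a small ball of directions around 0 works. At the boundary, \<Omega> is
  locally the region below a Lipschitz graph in rotated coordinates: moving down, even with a small
  tilt, descends faster than the graph can fall.\<close>

lemma lipschitz_boundary_cone:
  fixes \<Omega> :: "(real^'n::finite) set"
  assumes "open \<Omega>" and L: "lipschitz_boundary \<Omega>" and x: "x \<in> closure \<Omega>"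
  shows "\<exists>r>0. \<exists>d. \<exists>c>0. \<exists>e>0. \<forall>z\<in>closure \<Omega> \<inter> ball x r. \<forall>w\<in>cball d c. \<forall>t. 0 < t \<and> t < e \<longrightarrow> z + t *\<^sub>R w \<in> \<Omega>"
proof (cases "x \<in> \<Omega>")
  case True
  then obtain s where s: "s > 0" "ball x s \<subseteq> \<Omega>" using \<open>open \<Omega>\<close> by (metis open_contains_ball)
  have "z + t *\<^sub>R w \<in> \<Omega>" if z: "z \<in> ball x (s/2)" and w: "w \<in> cball 0 (s/2)" and t: "0 < t" "t < 1" for z w t
  proof -
    have "norm (t *\<^sub>R w) \<le> 1 * norm w" using t by (simp add: mult_left_le_one_le)
    then have "norm (t *\<^sub>R w) \<le> s/2" using w by simp
    moreover have "norm (z - x) < s/2" using z by (simp add: dist_norm norm_minus_commute)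
    ultimately have "norm ((z - x) + t *\<^sub>R w) < s" using norm_triangle_ineq[of "z - x" "t *\<^sub>R w"] by linarith
    then have "z + t *\<^sub>R w \<in> ball x s" by (simp add: dist_norm norm_minus_commute algebra_simps)
    with s show ?thesis by blast
  qed
  then show ?thesis using s
    by (intro exI[of _ "s/2"] exI[of _ 0] exI[of _ 1] conjI) (auto simp del: mem_cball mem_ball)
next
  case False
  then have "x \<in> frontier \<Omega>" using x \<open>open \<Omega>\<close> by (simp add: frontier_def interior_open)
  then have "\<exists>r>0. \<exists>(R::real^'n\<Rightarrow>real^'n) (j::'n) (g::real^'n\<Rightarrow>real) L.
     orthogonal_transformation R \<and> L-lipschitz_on UNIV g \<and>
     (\<forall>y. g y = g (\<chi> i. if i = j then 0 else y $ i)) \<and>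
     \<Omega> \<inter> ball x r = {y \<in> ball x r. (R y) $ j < g (R y)}"
    using L[unfolded lipschitz_boundary_def] by (rule bspec[rotated])
  then obtain r and R :: "real^'n \<Rightarrow> real^'n" and j :: 'n and g :: "real^'n \<Rightarrow> real" and L where
    r: "r > 0" and all: "orthogonal_transformation R \<and> L-lipschitz_on UNIV g \<and>
     (\<forall>y. g y = g (\<chi> i. if i = j then 0 else y $ i)) \<and>
     \<Omega> \<inter> ball x r = {y \<in> ball x r. (R y) $ j < g (R y)}"
    by (elim exE conjE) (rule that, assumption, intro conjI; assumption)
  have R: "orthogonal_transformation R" and g: "L-lipschitz_on UNIV g"
    and gj: "\<And>y. g y = g (\<chi> i. if i = j then 0 else y $ i)"
    and eq: "\<Omega> \<inter> ball x r = {y \<in> ball x r. (R y) $ j < g (R y)}"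
    using all by blast+
  have L0: "L \<ge> 0" using g by (rule lipschitz_on_nonneg)
  have lin: "linear R" using R by (rule orthogonal_transformation_linear)
  obtain d where d: "R d = - axis j 1" using orthogonal_transformation_surj[OF R] by (metis surjD)
  have nd: "norm d = 1" using orthogonal_transformation_norm[OF R, of d] by (simp add: d)
  \<comment> \<open>A tilt of size c costs at most t c in height and L t c in the graph; c (1 + L) =
    1/2 keeps the total below the descent t.\<close>
  define c where "c = 1 / (2 * (1 + L))"
  have c: "c > 0" "c * (1 + L) < 1" "c \<le> 1" using L0 by (auto simp: c_def field_simps)
  have contR: "continuous_on UNIV R" using lin by (simp add: linear_continuous_on linear_conv_bounded_linear)
  have contg: "continuous_on UNIV g" using g by (rule lipschitz_on_continuous_on)
  \<comment> \<open>Points of the closure may lie on the graph itself, so only the weak inequality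
    is available for z; strictness comes from the descent.\<close>
  have below: "(R z) $ j \<le> g (R z)" if "z \<in> closure \<Omega> \<inter> ball x r" for z
  proof -
    have "closed {y. (R y) $ j \<le> g (R y)}"
      by (intro closed_Collect_le continuous_intros contR continuous_on_compose2[OF contg contR]) auto
    moreover have "\<Omega> \<inter> ball x r \<subseteq> {y. (R y) $ j \<le> g (R y)}" unfolding eq by auto
    ultimately have "closure (\<Omega> \<inter> ball x r) \<subseteq> {y. (R y) $ j \<le> g (R y)}" by (rule closure_minimal[rotated])
    moreover have "z \<in> closure (\<Omega> \<inter> ball x r)"
      using that open_Int_closure_subset[of "ball x r" \<Omega>] by (auto simp: Int_commute)
    ultimately show ?thesis by auto
  qed
  have "z + t *\<^sub>R w \<in> \<Omega>" if z: "z \<in> closure \<Omega>" "z \<in> ball x (r/2)" and w: "w \<in> cball d c" and t: "0 < t" "t < r/4" for z w t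
  proof -
    define v where "v = w - d"
    have v: "norm v \<le> c" using w by (simp add: v_def dist_norm norm_minus_commute)
    have wv: "w = d + v" by (simp add: v_def)
    have "norm w \<le> 2" using norm_triangle_ineq[of d v] v c nd by (simp add: wv)
    then have "norm (t *\<^sub>R w) \<le> t * 2" using t by (simp add: mult_left_mono)
    then have "norm (t *\<^sub>R w) < r/2" using t by linarith
    moreover have "norm (z - x) < r/2" using z by (simp add: dist_norm norm_minus_commute)
    ultimately have "norm ((z - x) + t *\<^sub>R w) < r" using norm_triangle_ineq[of "z - x" "t *\<^sub>R w"] by linarith
    then have inb: "z + t *\<^sub>R w \<in> ball x r" by (simp add: dist_norm norm_minus_commute algebra_simps)
    have Rv: "norm (R v) \<le> c" using v orthogonal_transformation_norm[OF R, of v] by simp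
    have RR: "R (z + t *\<^sub>R w) = R z - t *\<^sub>R axis j 1 + t *\<^sub>R R v"
      by (simp add: wv linear_add[OF lin] linear_scale[OF lin] d algebra_simps)
    \<comment> \<open>\<open>g\<close> ignores coordinate \<open>j\<close>, so the vertical part of
      the displacement drops out.\<close>
    have "g (R (z + t *\<^sub>R w)) = g (R z + t *\<^sub>R R v)"
      by (subst (1 2) gj, rule arg_cong[where f=g]) (auto simp: vec_eq_iff RR axis_def)
    moreover have "\<bar>g (R z + t *\<^sub>R R v) - g (R z)\<bar> \<le> L * (t * c)"
    proof -
      have "dist (g (R z + t *\<^sub>R R v)) (g (R z)) \<le> L * dist (R z + t *\<^sub>R R v) (R z)"
        using g by (rule lipschitz_onD) auto
      also have "\<dots> = L * (t * norm (R v))" using t by (simp add: dist_norm)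
      also have "\<dots> \<le> L * (t * c)" using L0 t Rv by (intro mult_left_mono) auto
      finally show ?thesis by (simp add: dist_real_def)
    qed
    moreover have "(R (z + t *\<^sub>R w)) $ j \<le> (R z) $ j - t + t * c"
    proof -
      have "(R v) $ j \<le> c" using component_le_norm_cart[of "R v" j] Rv by linarith
      then have "t * (R v) $ j \<le> t * c" using t by (intro mult_left_mono) auto
      then show ?thesis by (simp add: RR axis_def)
    qed
    moreover have "(R z) $ j \<le> g (R z)" using z r by (intro below) auto
    moreover have "t * (c * (1 + L)) < t * 1" using t c by (intro mult_strict_left_mono) auto
    ultimately have "(R (z + t *\<^sub>R w)) $ j < g (R (z + t *\<^sub>R w))" by (simp add: algebra_simps)
    then have "z + t *\<^sub>R w \<in> \<Omega> \<inter> ball x r" unfolding eq using inb by simp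
    then show ?thesis by simp
  qed
  then show ?thesis using r c(1)
    by (intro exI[of _ "r/2"] exI[of _ d] exI[of _ c] exI[of _ "r/4"] conjI) (auto simp del: mem_cball mem_ball)
qed

lemma powr_sum_le:
  fixes a :: "nat \<Rightarrow> real"
  assumes p: "1 \<le> p" shows "\<bar>\<Sum>i<m. a i\<bar> powr p \<le> real m powr p * (\<Sum>i<m. \<bar>a i\<bar> powr p)"
proof (cases m)
  case (Suc n)
  let ?S = "\<Sum>i<Suc n. \<bar>a i\<bar> powr p"
  have "\<bar>\<Sum>i<Suc n. a i\<bar> = real (Suc n) * norm ((1 / real (Suc n)) *\<^sub>R (\<Sum>i<Suc n. a i))"
    by (simp add: abs_mult del: sum.lessThan_Suc)
  then have "\<bar>\<Sum>i<Suc n. a i\<bar> powr p = real (Suc n) powr p * norm ((1 / real (Suc n)) *\<^sub>R (\<Sum>i<Suc n. a i)) powr p"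
    by (simp only: powr_mult norm_ge_zero of_nat_0_le_iff)
  also have "\<dots> \<le> real (Suc n) powr p * ((1 / real (Suc n)) * ?S)"
    using powr_norm_average_le[OF p, of n a] by (intro mult_left_mono) auto
  also have "\<dots> \<le> real (Suc n) powr p * (1 * ?S)"
    by (intro mult_left_mono mult_right_mono sum_nonneg) auto
  finally show ?thesis by (simp add: Suc del: sum.lessThan_Suc)
qed simp

lemma indicator_integrable:
  "E \<in> sets borel \<Longrightarrow> bounded E \<Longrightarrow> integrable lborel (indicator E :: 'a::euclidean_space \<Rightarrow> real)"
  by (intro integrable_real_indicator emeasure_bounded_finite) simp_all

text \<open>Half balls covering \<open>K\<close> are made disjoint and their indicators mollified.
  The indicators sum to 1 on an open set \<open>W\<close> around \<open>K\<close>, so the mollified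
  ones sum to 1 wherever the kernel only sees \<open>W\<close>; no division by a sum is
  involved.\<close>

lemma smooth_partition_of_unity:
  fixes K :: "(real^'n::finite) set"
  assumes K: "compact K" and r: "\<And>x. x \<in> K \<Longrightarrow> r x > 0"
  obtains m :: nat and f \<psi> U where "\<And>i. i < m \<Longrightarrow> f i \<in> K" "\<And>i. i < m \<Longrightarrow> test_fun UNIV (\<psi> i)"
    "\<And>i x. i < m \<Longrightarrow> \<psi> i x \<noteq> 0 \<Longrightarrow> x \<in> cball (f i) (3/4 * r (f i))"
    "open U" "K \<subseteq> U" "\<And>x. x \<in> U \<Longrightarrow> (\<Sum>i<m. \<psi> i x) = 1"
proof -
  have "K \<subseteq> (\<Union>x\<in>K. ball x (r x / 2))" using r by (force simp: centre_in_ball)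
  then obtain F where F: "F \<subseteq> K" "finite F" "K \<subseteq> (\<Union>x\<in>F. ball x (r x / 2))"
    using compactE_image[OF K, of K "\<lambda>x. ball x (r x / 2)"] by (metis open_ball)
  obtain m :: nat and f where f: "F = f ` {i. i < m}" using finite_imp_nat_seg_image_inj_on[OF F(2)] by metis
  define A where "A i = (if i < m then ball (f i) (r (f i) / 2) else {})" for i
  define W where "W = (\<Union>i. A i)"
  have KW: "K \<subseteq> W" using F(3) by (auto simp: W_def A_def f) 
  have W: "open W" unfolding W_def A_def by (intro open_UN) auto
  obtain d0 where d0: "d0 > 0" "\<And>x y. x \<in> K \<Longrightarrow> y \<in> - W \<Longrightarrow> d0 \<le> dist x y"
    using separate_compact_closed[OF K, of "- W"] W KW by (metis Compl_disjoint closed_Compl disjoint_eq_subset_Compl double_complement)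
  \<comment> \<open>Radius r/2 plus at most r/4 from the kernel keeps supports in the ball of radius
    3r/4. The bound d0/2 ensures that the d-neighbourhood of \<open>K\<close>, enlarged once more by
    d, stays in \<open>W\<close>.\<close>
  define d where "d = Min (insert (d0 / 2) ((\<lambda>x. r x / 4) ` F))"
  have d: "d > 0" "d \<le> d0 / 2" "\<And>i. i < m \<Longrightarrow> d \<le> r (f i) / 4"

  proof -
    let ?D = "insert (d0 / 2) ((\<lambda>x. r x / 4) ` F)"
    have fin: "finite ?D" "?D \<noteq> {}" using F by auto
    have "\<forall>a\<in>?D. 0 < a" using d0 r F(1) by auto
    then show "d > 0" unfolding d_def by (rule Min_gr_iff[OF fin, THEN iffD2])
    show "d \<le> d0 / 2" unfolding d_def by (rule Min_le[OF fin(1)]) simp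
    show "d \<le> r (f i) / 4" if "i < m" for i
      unfolding d_def by (rule Min_le[OF fin(1)]) (use f that in auto)
  qed
  obtain \<eta> where \<eta>: "smooth_kernel (0::real^'n) d \<eta>" using ex_smooth_kernel[OF d(1)] by blast
  then have \<eta>t: "test_fun UNIV \<eta>" and \<eta>1: "(LINT x|lborel. \<eta> x) = 1" and \<eta>0: "\<And>x. \<eta> x \<noteq> 0 \<Longrightarrow> norm x < d"
    by (auto simp: smooth_kernel_def)
  have \<eta>m[measurable]: "\<eta> \<in> borel_measurable borel" by (rule smooth_fun_borel[OF test_fun_smooth[OF \<eta>t]])
  define E where "E = disjointed A"
  have EA: "E i \<subseteq> A i" for i unfolding E_def by (rule disjointed_subset)
  have Em[measurable]: "E i \<in> sets borel" for i unfolding E_def disjointed_def A_def by auto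
  have Eb: "bounded (E i)" for i
    using EA[of i] by (rule bounded_subset[rotated]) (simp add: A_def)
  have Ei: "integrable lborel (indicator (E i) :: real^'n \<Rightarrow> real)" for i
    by (rule indicator_integrable[OF Em Eb])
  define \<psi> where "\<psi> i = mollify (indicator (E i)) \<eta>" for i
  have sup: "x \<in> cball (f i) (3/4 * r (f i))" if i: "i < m" and x: "\<psi> i x \<noteq> 0" for i x
  proof -
    obtain y z where y: "indicator (E i) y \<noteq> (0::real)" and z: "\<eta> z \<noteq> 0" and xe: "x = y + z"
      using mollify_support[OF x[unfolded \<psi>_def]] by metis
    have "y \<in> ball (f i) (r (f i) / 2)" using y EA[of i] i by (auto simp: A_def indicator_def split: if_splits)
    then have "norm (f i - y) < r (f i) / 2" by (simp add: dist_norm)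
    moreover have "norm z < r (f i) / 4" using \<eta>0[OF z] d(3)[OF i] by simp
    ultimately have "norm ((f i - y) - z) \<le> 3/4 * r (f i)" using norm_triangle_ineq4[of "f i - y" z] by linarith
    then show ?thesis by (simp add: xe dist_norm algebra_simps)
  qed
  show thesis
  proof (rule that[of m f \<psi> "\<Union>x\<in>K. ball x d"])
    show "f i \<in> K" if "i < m" for i using that F f by auto
    show "test_fun UNIV (\<psi> i)" if "i < m" for i
    proof -
      have "{x. \<psi> i x \<noteq> 0} \<subseteq> cball (f i) (3/4 * r (f i))" using sup[OF that] by blast
      then have "bounded {x. \<psi> i x \<noteq> 0}" by (rule bounded_subset[OF bounded_cball])
      moreover have "smooth_fun (\<psi> i)" unfolding \<psi>_def by (rule smooth_fun_mollify[OF Ei \<eta>t])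
      ultimately show ?thesis by (simp add: test_fun_UNIV)
    qed
    show "x \<in> cball (f i) (3/4 * r (f i))" if "i < m" "\<psi> i x \<noteq> 0" for i x by (rule sup[OF that])
    show "open (\<Union>x\<in>K. ball x d)" by auto
    show "K \<subseteq> (\<Union>x\<in>K. ball x d)" using d(1) by (force simp: centre_in_ball)
    show "(\<Sum>i<m. \<psi> i x) = 1" if x: "x \<in> (\<Union>x\<in>K. ball x d)" for x
    proof -
      obtain k where k: "k \<in> K" "dist k x < d" using x by auto
      have inW: "y \<in> W" if "\<eta> (x - y) \<noteq> 0" for y
      proof (rule ccontr)
        assume "y \<notin> W"
        then have "d0 \<le> dist k y" using d0(2)[of k y] k by auto
        moreover have "dist x y < d" using \<eta>0[OF that] by (simp add: dist_norm)
        ultimately show False using k(2) d(2) dist_triangle[of k y x] by linarith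
      qed
      have sumE: "(\<Sum>i<m. indicator (E i) y) = (1::real)" if y: "y \<in> W" for y
      proof -
        have "y \<in> (\<Union>i. E i)" using y unfolding W_def E_def by (simp add: UN_disjointed_eq)
        then obtain i where i: "y \<in> E i" by blast
        have im: "i < m" using i EA[of i] by (auto simp: A_def split: if_splits)
        have "indicator (E l) y = (if l = i then 1 else 0 :: real)" for l
          using i disjoint_family_disjointed[of A] unfolding E_def disjoint_family_on_def by (auto simp: indicator_def)
        then show ?thesis using im by simp
      qed
      have "(\<Sum>i<m. \<psi> i x) = (LINT y|lborel. (\<Sum>i<m. indicator (E i) y * \<eta> (x - y)))"
        unfolding \<psi>_def mollify_def
        using mollify_integrand_integrable[OF Ei \<eta>t] by (intro Bochner_Integration.integral_sum[symmetric])
      also have "\<dots> = (LINT y|lborel. \<eta> (x - y))"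
      proof (intro Bochner_Integration.integral_cong refl)
        fix y
        show "(\<Sum>i<m. indicator (E i) y * \<eta> (x - y)) = \<eta> (x - y)"
          using sumE[OF inW, of y] by (cases "\<eta> (x - y) = 0") (auto simp: sum_distrib_right[symmetric])
      qed
      also have "\<dots> = 1" using integral_lborel_reflect[OF \<eta>m] \<eta>1 by simp
      finally show ?thesis .
    qed
  qed
qed

lemma test_fun_sum:
  assumes "finite I" "\<And>i. i \<in> I \<Longrightarrow> test_fun \<Omega> (\<phi> i)"
  shows "test_fun \<Omega> (\<lambda>x. \<Sum>i\<in>I. \<phi> i x)"
proof -
  let ?C = "\<Union>i\<in>I. closure {x. \<phi> i x \<noteq> 0}"
  have C: "compact ?C" "?C \<subseteq> \<Omega>" using assms by (auto simp: test_fun_def)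
  have "{x. (\<Sum>i\<in>I. \<phi> i x) \<noteq> 0} \<subseteq> ?C"
  proof
    fix x assume "x \<in> {x. (\<Sum>i\<in>I. \<phi> i x) \<noteq> 0}"
    then have "(\<Sum>i\<in>I. \<phi> i x) \<noteq> 0" by simp
    then obtain i where "i \<in> I" "\<phi> i x \<noteq> 0" by (rule sum.not_neutral_contains_not_neutral)
    then show "x \<in> ?C" using closure_subset[of "{x. \<phi> i x \<noteq> 0}"] by blast
  qed
  then have cl: "closure {x. (\<Sum>i\<in>I. \<phi> i x) \<noteq> 0} \<subseteq> ?C"
    using C by (intro closure_minimal) (auto intro: compact_imp_closed)
  then have "compact (closure {x. (\<Sum>i\<in>I. \<phi> i x) \<noteq> 0})"
    using C by (auto simp: compact_eq_bounded_closed intro: bounded_subset)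
  then show ?thesis
    using cl C assms smooth_fun_sum[of I \<phi>] by (auto simp: test_fun_def)
qed

lemma integrable_powr_add_bounded:
  fixes u v a b :: "'a \<Rightarrow> real"
  assumes [measurable]: "u \<in> borel_measurable M" "v \<in> borel_measurable M" "a \<in> borel_measurable M" "b \<in> borel_measurable M"
    and "integrable M (\<lambda>x. \<bar>u x\<bar> powr p)" "integrable M (\<lambda>x. \<bar>v x\<bar> powr p)"
    and a: "\<And>x. \<bar>a x\<bar> \<le> B" and b: "\<And>x. \<bar>b x\<bar> \<le> B" and p: "1 \<le> p"
  shows "integrable M (\<lambda>x. \<bar>u x * a x + v x * b x\<bar> powr p)"
proof (rule Bochner_Integration.integrable_bound)
  let ?f = "\<lambda>x. 2 powr p * (B powr p * \<bar>u x\<bar> powr p + B powr p * \<bar>v x\<bar> powr p)"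
  show "integrable M ?f" using assms by simp
  show "AE x in M. norm (\<bar>u x * a x + v x * b x\<bar> powr p) \<le> norm (?f x)"
  proof (rule AE_I2)
    fix x
    have *: "\<bar>s * c\<bar> powr p \<le> B powr p * \<bar>s\<bar> powr p" if "\<bar>c\<bar> \<le> B" for s c :: real
    proof -
      have "\<bar>s * c\<bar> powr p \<le> (B * \<bar>s\<bar>) powr p"
        using that p mult_right_mono[of "\<bar>c\<bar>" B "\<bar>s\<bar>"] by (intro powr_mono2) (auto simp: abs_mult mult.commute)
      then show ?thesis using that by (simp add: powr_mult)
    qed
    have "\<bar>u x * a x + v x * b x\<bar> powr p \<le> (\<bar>u x * a x\<bar> + \<bar>v x * b x\<bar>) powr p"
      using p by (intro powr_mono2 abs_triangle_ineq) auto
    also have "\<dots> \<le> 2 powr p * (\<bar>u x * a x\<bar> powr p + \<bar>v x * b x\<bar> powr p)"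
      using p by (intro powr_add_le) auto
    also have "\<dots> \<le> ?f x" by (intro mult_left_mono add_mono * a b) auto
    finally have le: "\<bar>u x * a x + v x * b x\<bar> powr p \<le> ?f x" .
    show "norm (\<bar>u x * a x + v x * b x\<bar> powr p) \<le> norm (?f x)"
      unfolding real_norm_def abs_of_nonneg[OF powr_ge_zero] by (rule order_trans[OF le abs_ge_self])
  qed
qed measurable

lemma smooth_kernel_mono: "smooth_kernel a r \<eta> \<Longrightarrow> ball a r \<subseteq> ball b s \<Longrightarrow> smooth_kernel b s \<eta>"
  unfolding smooth_kernel_def by blast

text \<open>Each localised piece is mollified with a kernel supported in the cone pointing into \<open>\<Omega>\<close>.\<close>

lemma test_fun_dense_Lp:
  fixes u :: "real^'n::finite \<Rightarrow> real" and G :: "'n \<Rightarrow> real^'n \<Rightarrow> real"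
  assumes "open \<Omega>" "bounded \<Omega>" "lipschitz_boundary \<Omega>" and p: "1 \<le> p"
    and w: "\<And>j. weak_pd j u (G j)" and u0: "\<And>x. x \<notin> \<Omega> \<Longrightarrow> u x = 0" and G0: "\<And>j x. x \<notin> \<Omega> \<Longrightarrow> G j x = 0"
    and up: "integrable lborel (\<lambda>x. \<bar>u x\<bar> powr p)" and Gp: "\<And>j. integrable lborel (\<lambda>x. \<bar>G j x\<bar> powr p)" and e: "e > 0"
  obtains \<phi> where "test_fun \<Omega> \<phi>" "(\<integral>\<^sup>+x. ennreal (\<bar>\<phi> x - u x\<bar> powr p) \<partial>lborel) \<le> ennreal e"
    "\<And>j. (\<integral>\<^sup>+x. ennreal (\<bar>pd j \<phi> x - G j x\<bar> powr p) \<partial>lborel) \<le> ennreal e"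
proof -
  have "integrable lborel u" "integrable lborel (G j)" for j using w unfolding weak_pd_def by auto
  then have um[measurable]: "u \<in> borel_measurable borel" and Gm[measurable]: "G j \<in> borel_measurable borel" for j
    by (auto dest!: borel_measurable_integrable)
  \<comment> \<open>The cone condition as a predicate, so that radius, axis, aperture and step bound
    can be selected as functions of the boundary or interior point.\<close>
  define good where "good x r d c e0 \<longleftrightarrow> r > 0 \<and> c > 0 \<and> e0 > 0 \<and> (\<forall>z\<in>closure \<Omega> \<inter> ball x r. \<forall>w\<in>cball d c. \<forall>t. 0 < t \<and> t < e0 \<longrightarrow> z + t *\<^sub>R w \<in> \<Omega>)"
    for x r d c e0
  have "\<forall>x\<in>closure \<Omega>. \<exists>r d c e0. good x r d c e0"

  proof
    fix x assume "x \<in> closure \<Omega>"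
    from lipschitz_boundary_cone[OF assms(1,3) this] show "\<exists>r d c e0. good x r d c e0"
      unfolding good_def by (elim exE conjE) (intro exI conjI; assumption)
  qed
  then obtain r d c e0 where cone: "\<And>x. x \<in> closure \<Omega> \<Longrightarrow> good x (r x) (d x) (c x) (e0 x)" by metis
  have cK: "compact (closure \<Omega>)" using \<open>bounded \<Omega>\<close> by (simp add: compact_closure)
  have rpos: "r x > 0" if "x \<in> closure \<Omega>" for x using cone[OF that] by (simp add: good_def)
  obtain m :: nat and f \<psi> U where f: "\<And>i. i < m \<Longrightarrow> f i \<in> closure \<Omega>" and \<psi>: "\<And>i. i < m \<Longrightarrow> test_fun UNIV (\<psi> i)"
    and \<psi>s: "\<And>i x. i < m \<Longrightarrow> \<psi> i x \<noteq> 0 \<Longrightarrow> x \<in> cball (f i) (3/4 * r (f i))"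
    and U: "open U" "closure \<Omega> \<subseteq> U" and one: "\<And>x. x \<in> U \<Longrightarrow> (\<Sum>i<m. \<psi> i x) = 1"
    by (rule smooth_partition_of_unity[of "closure \<Omega>" r, OF cK rpos]) (assumption, rule that)
  \<comment> \<open>Error allowed per piece: \<open>powr_sum_le\<close> multiplies the sum of the
    \<open>m\<close> errors by m^p. The summand 1 covers m = 0.\<close>
  define e' where "e' = e / (real m powr p * real m + 1)"
  have den: "real m powr p * real m + 1 > 0" by (simp add: add_nonneg_pos)
  have e': "e' > 0" using e den by (simp add: e'_def)
  have e'e: "real m powr p * (real m * e') \<le> e"
  proof -
    have "real m powr p * (real m * e') = e * (real m powr p * real m) / (real m powr p * real m + 1)" by (simp add: e'_def)
    also have "\<dots> \<le> e * 1" using e den by (simp add: pos_divide_le_eq mult_left_mono)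
    finally show ?thesis by simp
  qed
  define v where "v i x = u x * \<psi> i x" for i x
  define H where "H i j x = G j x * \<psi> i x + u x * pd j (\<psi> i) x" for i j x
  define close where "close i \<phi> \<longleftrightarrow> test_fun \<Omega> \<phi> \<and> (\<integral>\<^sup>+x. ennreal (\<bar>\<phi> x - v i x\<bar> powr p) \<partial>lborel) \<le> ennreal e' \<and>
      (\<forall>j. (\<integral>\<^sup>+x. ennreal (\<bar>pd j \<phi> x - H i j x\<bar> powr p) \<partial>lborel) \<le> ennreal e')" for i \<phi>
  have piece: "\<exists>\<phi>. close i \<phi>" if i: "i < m" for i
  proof -
    have wv: "weak_pd j (v i) (H i j)" for j
      using weak_pd_mult[OF w \<psi>[OF i]] unfolding v_def[abs_def] H_def[abs_def] .
    have vi: "integrable lborel (v i)" and Hi: "integrable lborel (H i j)" for j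
      using wv by (auto simp: weak_pd_def)
    have [measurable]: "\<psi> i \<in> borel_measurable borel" "pd j (\<psi> i) \<in> borel_measurable borel" for j
      using \<psi>[OF i] by (auto intro: smooth_fun_borel test_fun_smooth test_fun_pd)
    obtain B1 where B1: "\<And>x. \<bar>\<psi> i x\<bar> \<le> B1" using test_fun_bounded[OF \<psi>[OF i]] by metis
    have vp: "integrable lborel (\<lambda>x. \<bar>v i x\<bar> powr p)"
    proof -
      have "0 \<le> B1" using B1[of 0] by linarith
      then have "integrable lborel (\<lambda>x. \<bar>u x * \<psi> i x + u x * 0\<bar> powr p)"
        using up p B1 by (intro integrable_powr_add_bounded[where B=B1]) auto
      then show ?thesis by (simp add: v_def)
    qed
    have Hp: "integrable lborel (\<lambda>x. \<bar>H i j x\<bar> powr p)" for j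
    proof -
      obtain B2 where B2: "\<And>x. \<bar>pd j (\<psi> i) x\<bar> \<le> B2" using test_fun_bounded[OF test_fun_pd[OF \<psi>[OF i]]] by metis
      show ?thesis unfolding H_def using up Gp p B1 B2
        by (intro integrable_powr_add_bounded[where B="max B1 B2"]) (auto intro: max.coboundedI1 max.coboundedI2)
    qed
    obtain d1 where d1: "d1 > 0" "\<And>\<eta>. smooth_kernel 0 d1 \<eta> \<Longrightarrow>
        (\<integral>\<^sup>+x. ennreal (\<bar>mollify (v i) \<eta> x - v i x\<bar> powr p) \<partial>lborel) \<le> ennreal e'"
      using mollify_tendsto_Lp[OF vi vp p e'] by blast
    have "\<forall>j. \<exists>d>0. \<forall>\<eta>. smooth_kernel 0 d \<eta> \<longrightarrow>
        (\<integral>\<^sup>+x. ennreal (\<bar>mollify (H i j) \<eta> x - H i j x\<bar> powr p) \<partial>lborel) \<le> ennreal e'"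
      using mollify_tendsto_Lp[OF Hi Hp p e'] by blast
    then obtain d2 where d2: "\<And>j. d2 j > 0" "\<And>j \<eta>. smooth_kernel 0 (d2 j) \<eta> \<Longrightarrow>
        (\<integral>\<^sup>+x. ennreal (\<bar>mollify (H i j) \<eta> x - H i j x\<bar> powr p) \<partial>lborel) \<le> ennreal e'" by metis
    define dd where "dd = Min (insert d1 (range d2))"
    have dd: "dd > 0" "dd \<le> d1" "\<And>j. dd \<le> d2 j"
    proof -
      have fin: "finite (insert d1 (range d2))" "insert d1 (range d2) \<noteq> {}" by auto
      show "dd > 0" unfolding dd_def by (rule Min_gr_iff[OF fin, THEN iffD2]) (use d1 d2 in auto)
      show "dd \<le> d1" "dd \<le> d2 j" for j unfolding dd_def by (rule Min_le[OF fin(1)]; simp)+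
    qed
    define x where "x = f i"
    have xK: "x \<in> closure \<Omega>" using f[OF i] by (simp add: x_def)
    have cx: "r x > 0" "c x > 0" "e0 x > 0" "\<And>z w t. z \<in> closure \<Omega> \<Longrightarrow> z \<in> ball x (r x) \<Longrightarrow> w \<in> cball (d x) (c x) \<Longrightarrow> 0 < t \<Longrightarrow> t < e0 x \<Longrightarrow> z + t *\<^sub>R w \<in> \<Omega>"
      using cone[OF xK] unfolding good_def by blast+
    \<comment> \<open>Small enough for the cone condition, and such that the scaled ball of
      directions lies in the ball of radius \<open>dd\<close> around 0, where all the approximation
      bounds hold at once.\<close>
    define t where "t = min (e0 x / 2) (dd / (2 * (norm (d x) + c x)))"
    have nc: "norm (d x) + c x > 0" using cx(2) by (simp add: add_nonneg_pos)
    have t: "0 < t" "t < e0 x" using cx dd nc by (auto simp: t_def)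
    have tdd: "t * (norm (d x) + c x) < dd"
    proof -
      have "t * (norm (d x) + c x) \<le> (dd / (2 * (norm (d x) + c x))) * (norm (d x) + c x)"
        using nc by (intro mult_right_mono) (auto simp: t_def)
      also have "\<dots> = dd / 2" using nc by (simp del: distrib_left_numeral)
      finally show ?thesis using dd by simp
    qed
    have tc: "t * c x > 0" using t cx by simp
    obtain \<eta> where \<eta>: "smooth_kernel (t *\<^sub>R d x) (t * c x) \<eta>" using ex_smooth_kernel[OF tc] by blast
    then have \<eta>t: "test_fun UNIV \<eta>" and \<eta>s: "\<And>z. \<eta> z \<noteq> 0 \<Longrightarrow> z \<in> ball (t *\<^sub>R d x) (t * c x)" by (auto simp: smooth_kernel_def)
    have "ball (t *\<^sub>R d x) (t * c x) \<subseteq> ball 0 dd"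
    proof
      fix z assume "z \<in> ball (t *\<^sub>R d x) (t * c x)"
      then have "norm (z - t *\<^sub>R d x) < t * c x" by (simp add: dist_norm norm_minus_commute)
      then have "norm z < t * c x + t * norm (d x)"
        using norm_triangle_ineq[of "z - t *\<^sub>R d x" "t *\<^sub>R d x"] t by simp
      then show "z \<in> ball 0 dd" using tdd by (simp add: algebra_simps)
    qed
    then have k1: "smooth_kernel 0 d1 \<eta>" and k2: "smooth_kernel 0 (d2 j) \<eta>" for j
      using smooth_kernel_mono[OF \<eta>] dd by (meson order_trans subset_ball)+
    \<comment> \<open>A compact superset of the support of the mollified piece. The cone condition
      places it inside \<Omega>, although the piece itself may reach the boundary.\<close>
    define C where "C = {a + b |a b. a \<in> closure \<Omega> \<inter> cball x (3/4 * r x) \<and> b \<in> cball (t *\<^sub>R d x) (t * c x)}"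
    have "compact C" unfolding C_def by (rule compact_sums[OF compact_Int_closed[OF cK closed_cball] compact_cball])
    have "C \<subseteq> \<Omega>"
    proof
      fix q assume "q \<in> C"
      then obtain a b where q: "q = a + b" and a: "a \<in> closure \<Omega>" "a \<in> cball x (3/4 * r x)" and b: "b \<in> cball (t *\<^sub>R d x) (t * c x)"
        unfolding C_def by blast
      have "a \<in> ball x (r x)" using a cx(1) by simp
      moreover have "(1/t) *\<^sub>R b \<in> cball (d x) (c x)"
      proof -
        have "d x - (1/t) *\<^sub>R b = (1/t) *\<^sub>R (t *\<^sub>R d x - b)" using t by (simp add: algebra_simps)
        then have "norm (d x - (1/t) *\<^sub>R b) = norm (t *\<^sub>R d x - b) / t" using t by simp
        also have "\<dots> \<le> c x" using b t by (simp add: dist_norm field_simps)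
        finally show ?thesis by (simp add: dist_norm)
      qed
      ultimately have "a + t *\<^sub>R ((1/t) *\<^sub>R b) \<in> \<Omega>" using cx(4) a t by blast
      then show "q \<in> \<Omega>" using t by (simp add: q)
    qed
    have "{q. mollify (v i) \<eta> q \<noteq> 0} \<subseteq> C"
    proof
      fix q assume "q \<in> {q. mollify (v i) \<eta> q \<noteq> 0}"
      then have qn: "mollify (v i) \<eta> q \<noteq> 0" by simp
      obtain a b where ab: "v i a \<noteq> 0" "\<eta> b \<noteq> 0" "q = a + b" by (rule mollify_support[OF qn])
      then have "u a \<noteq> 0" "\<psi> i a \<noteq> 0" by (auto simp: v_def)
      then have "a \<in> closure \<Omega>" "a \<in> cball x (3/4 * r x)"
        using u0[of a] closure_subset[of \<Omega>] \<psi>s[OF i, of a] unfolding x_def by blast+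
      moreover have "b \<in> cball (t *\<^sub>R d x) (t * c x)" using \<eta>s[OF ab(2)] by simp
      ultimately show "q \<in> C" unfolding C_def using ab(3) by blast
    qed
    then have cl: "closure {q. mollify (v i) \<eta> q \<noteq> 0} \<subseteq> C" using \<open>compact C\<close> by (intro closure_minimal compact_imp_closed)
    then have "compact (closure {q. mollify (v i) \<eta> q \<noteq> 0})"
      using \<open>compact C\<close> by (meson bounded_subset closed_closure compact_eq_bounded_closed)
    then have "test_fun \<Omega> (mollify (v i) \<eta>)"
      unfolding test_fun_def using cl \<open>C \<subseteq> \<Omega>\<close> smooth_fun_mollify[OF vi \<eta>t] by blast
    then show ?thesis
      using d1(2)[OF k1] d2(2)[OF k2] pd_mollify_weak_pd[OF wv \<eta>t] unfolding close_def
      by (intro exI[of _ "mollify (v i) \<eta>"]) auto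
  qed
  define \<Phi> where "\<Phi> i = (SOME \<phi>. close i \<phi>)" for i
  have "close i (\<Phi> i)" if "i < m" for i unfolding \<Phi>_def by (rule someI_ex[OF piece[OF that]])
  then have \<Phi>: "\<And>i. i < m \<Longrightarrow> test_fun \<Omega> (\<Phi> i)"
    "\<And>i. i < m \<Longrightarrow> (\<integral>\<^sup>+x. ennreal (\<bar>\<Phi> i x - v i x\<bar> powr p) \<partial>lborel) \<le> ennreal e'"
    "\<And>i j. i < m \<Longrightarrow> (\<integral>\<^sup>+x. ennreal (\<bar>pd j (\<Phi> i) x - H i j x\<bar> powr p) \<partial>lborel) \<le> ennreal e'"
    unfolding close_def by simp_all
  have sumle: "(\<integral>\<^sup>+x. ennreal (\<bar>\<Sum>i<m. a i x\<bar> powr p) \<partial>lborel) \<le> ennreal e"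
    if a[measurable]: "\<And>i. i < m \<Longrightarrow> a i \<in> borel_measurable borel"
      and le: "\<And>i. i < m \<Longrightarrow> (\<integral>\<^sup>+x. ennreal (\<bar>a i x\<bar> powr p) \<partial>lborel) \<le> ennreal e'" for a :: "nat \<Rightarrow> real^'n \<Rightarrow> real"
  proof -
    have "(\<integral>\<^sup>+x. ennreal (\<bar>\<Sum>i<m. a i x\<bar> powr p) \<partial>lborel)
      \<le> (\<integral>\<^sup>+x. ennreal (real m powr p) * (\<Sum>i<m. ennreal (\<bar>a i x\<bar> powr p)) \<partial>lborel)"
      by (intro nn_integral_mono) (auto simp: ennreal_mult'[symmetric] sum_ennreal intro!: ennreal_leI powr_sum_le p)
    also have "\<dots> = ennreal (real m powr p) * (\<Sum>i<m. \<integral>\<^sup>+x. ennreal (\<bar>a i x\<bar> powr p) \<partial>lborel)"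

    proof -
      have am: "(\<lambda>x. ennreal (\<bar>a i x\<bar> powr p)) \<in> borel_measurable lborel" if "i \<in> {..<m}" for i
        using a[of i] that by simp
      have sm: "(\<lambda>x. \<Sum>i<m. ennreal (\<bar>a i x\<bar> powr p)) \<in> borel_measurable lborel"
        by (rule borel_measurable_sum) (rule am)
      show ?thesis by (subst nn_integral_cmult[OF sm], subst nn_integral_sum) (use am in auto)
    qed
    also have "\<dots> \<le> ennreal (real m powr p) * (\<Sum>i<m. ennreal e')"
      using le by (intro mult_left_mono sum_mono) auto
    also have "\<dots> = ennreal (real m powr p * (real m * e'))"
      using e' by (simp add: ennreal_mult' ennreal_of_nat_eq_real_of_nat)
    also have "\<dots> \<le> ennreal e" using e'e by (rule ennreal_leI)
    finally show ?thesis .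
  qed
  show thesis
  proof (rule that[of "\<lambda>x. \<Sum>i<m. \<Phi> i x"])
    have \<Phi>m: "\<Phi> i \<in> borel_measurable borel" "pd j (\<Phi> i) \<in> borel_measurable borel" if "i < m" for i j
      using \<Phi>(1)[OF that] by (auto intro: smooth_fun_borel test_fun_smooth test_fun_pd)
    have \<psi>m: "\<psi> i \<in> borel_measurable borel" "pd j (\<psi> i) \<in> borel_measurable borel" if "i < m" for i j
      using \<psi>[OF that] by (auto intro: smooth_fun_borel test_fun_smooth test_fun_pd)
    show "test_fun \<Omega> (\<lambda>x. \<Sum>i<m. \<Phi> i x)" by (rule test_fun_sum) (use \<Phi>(1) in auto)
    have ueq: "u x = (\<Sum>i<m. v i x)" for x
    proof (cases "x \<in> \<Omega>")
      case True
      then have "x \<in> U" using U closure_subset by blast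
      then show ?thesis using one by (simp add: v_def sum_distrib_left[symmetric])
    qed (simp add: u0 v_def)
    have Geq: "G j x = (\<Sum>i<m. H i j x)" for j x
    proof (cases "x \<in> \<Omega>")
      case True
      then have xU: "x \<in> U" using U closure_subset by blast
      \<comment> \<open>The partition sums to 1 on the open set \<open>U\<close>, so its derivatives
        cancel there; this removes the terms \<open>u x * pd j (\<psi> i) x\<close> from the sum of
        the pieces.\<close>
      have "((\<lambda>z. 1) has_derivative (\<lambda>h. 0)) (at x)" by simp
      then have "((\<lambda>z. \<Sum>i<m. \<psi> i z) has_derivative (\<lambda>h. 0)) (at x)"
        by (rule has_derivative_transform_within_open[OF _ U(1) xU]) (simp add: one)
      from pd_eq_derivative[OF this, of j] have "pd j (\<lambda>z. \<Sum>i<m. \<psi> i z) x = 0" .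
      moreover have "pd j (\<lambda>z. \<Sum>i<m. \<psi> i z) x = (\<Sum>i<m. pd j (\<psi> i) x)"
        using \<psi> by (intro pd_sum) (auto intro: smooth_fun_differentiable test_fun_smooth)
      ultimately show ?thesis
        using one[OF xU] by (simp add: H_def sum.distrib sum_distrib_left[symmetric])
    qed (simp add: u0 G0 H_def)
    show "(\<integral>\<^sup>+x. ennreal (\<bar>(\<Sum>i<m. \<Phi> i x) - u x\<bar> powr p) \<partial>lborel) \<le> ennreal e"
    proof -
      have "(\<integral>\<^sup>+x. ennreal (\<bar>\<Sum>i<m. \<Phi> i x - v i x\<bar> powr p) \<partial>lborel) \<le> ennreal e"
        using \<Phi>m \<psi>m um \<Phi>(2) unfolding v_def by (intro sumle borel_measurable_diff borel_measurable_times) auto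
      then show ?thesis by (simp add: ueq sum_subtractf)
    qed
    show "(\<integral>\<^sup>+x. ennreal (\<bar>pd j (\<lambda>x. \<Sum>i<m. \<Phi> i x) x - G j x\<bar> powr p) \<partial>lborel) \<le> ennreal e" for j
    proof -
      have "pd j (\<lambda>x. \<Sum>i<m. \<Phi> i x) x = (\<Sum>i<m. pd j (\<Phi> i) x)" for x
        using \<Phi>(1) by (intro pd_sum) (auto intro: smooth_fun_differentiable test_fun_smooth)
      moreover have "(\<integral>\<^sup>+x. ennreal (\<bar>\<Sum>i<m. pd j (\<Phi> i) x - H i j x\<bar> powr p) \<partial>lborel) \<le> ennreal e"
        using \<Phi>m \<psi>m um Gm \<Phi>(3) unfolding H_def by (intro sumle borel_measurable_diff borel_measurable_times borel_measurable_add) auto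
      ultimately show ?thesis by (simp add: Geq sum_subtractf)
    qed
  qed
qed

section \<open>The energy estimate and the limit\<close>

lemma integral_le_of_nn_integral:
  fixes f :: "'a \<Rightarrow> real"
  assumes "f \<in> borel_measurable M" "\<And>x. 0 \<le> f x" "(\<integral>\<^sup>+x. ennreal (f x) \<partial>M) \<le> ennreal e" "0 \<le> e"
  shows "integrable M f" "(LINT x|M. f x) \<le> e"
proof -
  have "(\<integral>\<^sup>+x. ennreal (f x) \<partial>M) < \<infinity>" using assms(3) by (simp add: le_less_trans)
  then show "integrable M f" using assms by (intro integrableI_nonneg) auto
  show "(LINT x|M. f x) \<le> e"
    using assms by (subst integral_eq_nn_integral) (auto intro!: enn2real_leI)
qed

text \<open>A priori \<open>u\<close> is only in L^1. Its mollifications are test functions, to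
  which the Poincare inequality applies with uniform bounds, and Fatou's lemma transfers the bound
  to \<open>u\<close>.\<close>

lemma weak_pd_Lp:
  fixes u G :: "real^'n::finite \<Rightarrow> real"
  assumes w: "weak_pd j u G" and R: "\<And>x. u x \<noteq> 0 \<Longrightarrow> norm x \<le> R" "R > 0"
    and Gp: "integrable lborel (\<lambda>x. \<bar>G x\<bar> powr p)" and p: "1 < p"
  shows "integrable lborel (\<lambda>x. \<bar>u x\<bar> powr p)"
proof -
  have ui: "integrable lborel u" and Gi: "integrable lborel G" using w by (auto simp: weak_pd_def)
  have um[measurable]: "u \<in> borel_measurable borel" and Gm[measurable]: "G \<in> borel_measurable borel"
    using ui Gi by (auto dest!: borel_measurable_integrable)
  have ui1: "integrable lborel (\<lambda>x. \<bar>u x\<bar> powr 1)" using ui by simp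
  have p1: "1 \<le> p" using p by simp
  define near where "near n \<eta> \<longleftrightarrow> smooth_kernel (0::real^'n) 1 \<eta> \<and>
      (\<integral>\<^sup>+x. ennreal (\<bar>mollify u \<eta> x - u x\<bar> powr 1) \<partial>lborel) \<le> ennreal (inverse (real (Suc n))) \<and>
      (\<integral>\<^sup>+x. ennreal (\<bar>mollify G \<eta> x - G x\<bar> powr p) \<partial>lborel) \<le> ennreal 1" for n \<eta>
  have ex: "\<exists>\<eta>. near n \<eta>" for n
  proof -
    obtain d1 where d1: "d1 > 0" "\<And>\<eta>. smooth_kernel 0 d1 \<eta> \<Longrightarrow>
        (\<integral>\<^sup>+x. ennreal (\<bar>mollify u \<eta> x - u x\<bar> powr 1) \<partial>lborel) \<le> ennreal (inverse (real (Suc n)))"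
      using mollify_tendsto_Lp[OF ui ui1, of "inverse (real (Suc n))"] by auto
    obtain d2 where d2: "d2 > 0" "\<And>\<eta>. smooth_kernel 0 d2 \<eta> \<Longrightarrow>
        (\<integral>\<^sup>+x. ennreal (\<bar>mollify G \<eta> x - G x\<bar> powr p) \<partial>lborel) \<le> ennreal 1"
      using mollify_tendsto_Lp[OF Gi Gp p1, of 1] by auto
    have "min (min d1 d2) 1 > 0" using d1 d2 by simp
    then obtain \<eta> where \<eta>: "smooth_kernel (0::real^'n) (min (min d1 d2) 1) \<eta>" using ex_smooth_kernel by blast
    have "smooth_kernel 0 d1 \<eta>" "smooth_kernel 0 d2 \<eta>" "smooth_kernel 0 1 \<eta>"
      by (rule smooth_kernel_mono[OF \<eta>], rule subset_ball, simp)+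
    then show ?thesis using d1(2) d2(2) unfolding near_def by blast
  qed
  define \<eta> where "\<eta> n = (SOME \<eta>. near n \<eta>)" for n
  have "near n (\<eta> n)" for n unfolding \<eta>_def by (rule someI_ex[OF ex])
  then have k: "\<And>n. smooth_kernel (0::real^'n) 1 (\<eta> n)"
    and ku: "\<And>n. (\<integral>\<^sup>+x. ennreal (\<bar>mollify u (\<eta> n) x - u x\<bar> powr 1) \<partial>lborel) \<le> ennreal (inverse (real (Suc n)))"
    and kG: "\<And>n. (\<integral>\<^sup>+x. ennreal (\<bar>mollify G (\<eta> n) x - G x\<bar> powr p) \<partial>lborel) \<le> ennreal 1"
    unfolding near_def by simp_all
  define \<phi> where "\<phi> n = mollify u (\<eta> n)" for n
  have \<eta>t: "test_fun UNIV (\<eta> n)" for n using k by (simp add: smooth_kernel_def)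
  have \<eta>m[measurable]: "\<eta> n \<in> borel_measurable borel" for n by (rule smooth_fun_borel[OF test_fun_smooth[OF \<eta>t]])
  have \<phi>R: "norm x \<le> R + 1" if nz: "\<phi> n x \<noteq> 0" for n x
  proof -
    obtain a b where ab: "u a \<noteq> 0" "\<eta> n b \<noteq> 0" "x = a + b"
      by (rule mollify_support[OF nz[unfolded \<phi>_def]])
    have "norm b < 1" using k[of n] ab(2) by (simp add: smooth_kernel_def)
    moreover have "norm a \<le> R" by (rule R(1)[OF ab(1)])
    ultimately show ?thesis using norm_triangle_ineq[of a b] unfolding ab(3) by linarith
  qed
  have \<phi>t: "test_fun UNIV (\<phi> n)" for n
  proof -
    have "bounded {x. \<phi> n x \<noteq> 0}" using \<phi>R by (auto simp: bounded_iff)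
    then show ?thesis unfolding \<phi>_def using smooth_fun_mollify[OF ui \<eta>t] by (simp add: test_fun_UNIV)
  qed
  have \<phi>m[measurable]: "\<phi> n \<in> borel_measurable borel" for n by (rule smooth_fun_borel[OF test_fun_smooth[OF \<phi>t]])
  have pdm: "pd j (\<phi> n) = mollify G (\<eta> n)" for n unfolding \<phi>_def by (rule pd_mollify_weak_pd[OF w \<eta>t])
  have Gmm[measurable]: "mollify G (\<eta> n) \<in> borel_measurable borel" for n by (rule mollify_measurable) auto
  \<comment> \<open>The derivatives of the mollifications are mollifications of \<open>G\<close>,
    whose error has p-th power integral at most 1; \<open>powr_add_le\<close> contributes the factor
    2^p.\<close>
  define I where "I = 2 powr p * (1 + (LINT x|lborel. \<bar>G x\<bar> powr p))"
  have I0: "0 \<le> I" by (simp add: I_def)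
  have pdle: "(\<integral>\<^sup>+x. ennreal (\<bar>pd j (\<phi> n) x\<bar> powr p) \<partial>lborel) \<le> ennreal I" for n
  proof -
    have "(\<integral>\<^sup>+x. ennreal (\<bar>pd j (\<phi> n) x\<bar> powr p) \<partial>lborel)
      \<le> (\<integral>\<^sup>+x. ennreal (2 powr p) * (ennreal (\<bar>mollify G (\<eta> n) x - G x\<bar> powr p) + ennreal (\<bar>G x\<bar> powr p)) \<partial>lborel)"
    proof (intro nn_integral_mono)
      fix x
      have "\<bar>mollify G (\<eta> n) x\<bar> powr p \<le> (\<bar>mollify G (\<eta> n) x - G x\<bar> + \<bar>G x\<bar>) powr p"
        using p by (intro powr_mono2) auto
      also have "\<dots> \<le> 2 powr p * (\<bar>mollify G (\<eta> n) x - G x\<bar> powr p + \<bar>G x\<bar> powr p)"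
        using p by (intro powr_add_le) auto
      finally show "ennreal (\<bar>pd j (\<phi> n) x\<bar> powr p)
        \<le> ennreal (2 powr p) * (ennreal (\<bar>mollify G (\<eta> n) x - G x\<bar> powr p) + ennreal (\<bar>G x\<bar> powr p))"
        unfolding pdm by (simp add: ennreal_plus[symmetric] ennreal_mult'[symmetric] ennreal_leI del: ennreal_plus)
    qed
    also have "\<dots> = ennreal (2 powr p) * ((\<integral>\<^sup>+x. ennreal (\<bar>mollify G (\<eta> n) x - G x\<bar> powr p) \<partial>lborel) + (\<integral>\<^sup>+x. ennreal (\<bar>G x\<bar> powr p) \<partial>lborel))"
      by (simp add: nn_integral_cmult nn_integral_add)
    also have "\<dots> \<le> ennreal (2 powr p) * (ennreal 1 + ennreal (LINT x|lborel. \<bar>G x\<bar> powr p))"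
      using kG[of n] Gp by (intro mult_left_mono add_mono) (auto simp: nn_integral_eq_integral)
    also have "\<dots> = ennreal I"
      unfolding I_def by (subst ennreal_plus[symmetric]) (auto simp: ennreal_mult'[symmetric] simp del: ennreal_1 ennreal_plus)
    finally show ?thesis .
  qed
  \<comment> \<open>Kernels of radius 1 enlarge the support radius to R + 1.\<close>
  define C where "C = (2 * p * (R + 1)) powr p * I"
  have \<phi>le: "(\<integral>\<^sup>+x. ennreal (\<bar>\<phi> n x\<bar> powr p) \<partial>lborel) \<le> ennreal C" for n
  proof -
    obtain M where M: "M > 0" "\<And>x. \<bar>\<phi> n x\<bar> \<le> M" using test_fun_bounded[OF \<phi>t] by metis
    have "integrable lborel (\<lambda>x. \<bar>\<phi> n x\<bar> powr p)"
    proof (rule bounded_support_integrable[of _ "M powr p" "R + 1"])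
      show "\<bar>\<bar>\<phi> n x\<bar> powr p\<bar> \<le> M powr p" for x using M p by (auto intro!: powr_mono2)
      show "norm x \<le> R + 1" if "\<bar>\<phi> n x\<bar> powr p \<noteq> 0" for x using \<phi>R[of n x] that by auto
    qed measurable
    then have "(\<integral>\<^sup>+x. ennreal (\<bar>\<phi> n x\<bar> powr p) \<partial>lborel) = ennreal (LINT x|lborel. \<bar>\<phi> n x\<bar> powr p)"
      by (intro nn_integral_eq_integral) auto
    also have "\<dots> \<le> ennreal ((2 * p * (R + 1)) powr p * (LINT x|lborel. \<bar>pd j (\<phi> n) x\<bar> powr p))"
      using poincare_test_fun[OF \<phi>t \<phi>R _ p] R(2) by (intro ennreal_leI) auto
    also have "\<dots> \<le> ennreal C" unfolding C_def
      using integral_le_of_nn_integral(2)[OF _ _ pdle I0, of n] by (intro ennreal_leI mult_left_mono) (auto simp: pdm)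
    finally show ?thesis .
  qed
  have di: "integrable lborel (\<lambda>x. \<phi> n x - u x)" for n using test_fun_integrable[OF \<phi>t] ui by auto
  have dle: "(LINT x|lborel. norm (\<phi> n x - u x)) \<le> inverse (real (Suc n))" for n
    using ku[of n] unfolding \<phi>_def[symmetric] by (intro integral_le_of_nn_integral(2)) auto
  have "(\<lambda>n. LINT x|lborel. norm (\<phi> n x - u x)) \<longlonglongrightarrow> 0"
    by (rule tendsto_sandwich[OF _ _ tendsto_const LIMSEQ_inverse_real_of_nat]) (use dle in auto)
  from tendsto_L1_AE_subseq[OF di this]
  obtain r where r: "strict_mono r" "AE x in lborel. (\<lambda>n. \<phi> (r n) x - u x) \<longlonglongrightarrow> 0" by blast
  have "(\<integral>\<^sup>+x. ennreal (\<bar>u x\<bar> powr p) \<partial>lborel) \<le> (\<integral>\<^sup>+x. liminf (\<lambda>n. ennreal (\<bar>\<phi> (r n) x\<bar> powr p)) \<partial>lborel)"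
  proof (rule nn_integral_mono_AE)
    show "AE x in lborel. ennreal (\<bar>u x\<bar> powr p) \<le> liminf (\<lambda>n. ennreal (\<bar>\<phi> (r n) x\<bar> powr p))"
      using r(2)
    proof eventually_elim
      case (elim x)
      then have "(\<lambda>n. \<phi> (r n) x) \<longlonglongrightarrow> u x" by (rule LIM_zero_cancel)
      then have "(\<lambda>n. \<bar>\<phi> (r n) x\<bar> powr p) \<longlonglongrightarrow> \<bar>u x\<bar> powr p"
        using p by (intro tendsto_powr' tendsto_rabs tendsto_const) auto
      then have "(\<lambda>n. ennreal (\<bar>\<phi> (r n) x\<bar> powr p)) \<longlonglongrightarrow> ennreal (\<bar>u x\<bar> powr p)"
        by (intro tendsto_ennrealI)
      then have "liminf (\<lambda>n. ennreal (\<bar>\<phi> (r n) x\<bar> powr p)) = ennreal (\<bar>u x\<bar> powr p)"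
        by (rule lim_imp_Liminf[rotated]) simp
      then show ?case by simp
    qed
  qed
  also have "\<dots> \<le> liminf (\<lambda>n. \<integral>\<^sup>+x. ennreal (\<bar>\<phi> (r n) x\<bar> powr p) \<partial>lborel)"
    by (rule nn_integral_liminf) measurable
  also have "\<dots> \<le> liminf (\<lambda>n::nat. ennreal C)" by (intro Liminf_mono) (simp add: \<phi>le)
  also have "\<dots> = ennreal C" by (rule Liminf_const) simp
  finally show ?thesis by (intro integrableI_bounded) (auto intro: le_less_trans)
qed

lemma norm_powr_le_sum:
  fixes v :: "real^'n::finite"
  assumes "0 \<le> p" shows "norm v powr p \<le> real CARD('n) powr p * (\<Sum>j\<in>UNIV. \<bar>v $ j\<bar> powr p)"
proof -
  obtain j where j: "\<And>i. \<bar>v $ i\<bar> \<le> \<bar>v $ j\<bar>"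
  proof -
    have "Max (range (\<lambda>i. \<bar>v $ i\<bar>)) \<in> range (\<lambda>i. \<bar>v $ i\<bar>)" by (intro Max_in) auto
    then obtain j where "Max (range (\<lambda>i. \<bar>v $ i\<bar>)) = \<bar>v $ j\<bar>" by blast
    then show thesis using that[of j] Max_ge[of "range (\<lambda>i. \<bar>v $ i\<bar>)"] by simp
  qed
  have "norm v \<le> (\<Sum>i\<in>UNIV. \<bar>v $ i\<bar>)" by (rule norm_le_l1_cart)
  also have "\<dots> \<le> real CARD('n) * \<bar>v $ j\<bar>" using sum_bounded_above[of UNIV "\<lambda>i. \<bar>v $ i\<bar>" "\<bar>v $ j\<bar>"] j by simp
  finally have "norm v powr p \<le> (real CARD('n) * \<bar>v $ j\<bar>) powr p" using assms by (intro powr_mono2) auto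
  also have "\<dots> = real CARD('n) powr p * \<bar>v $ j\<bar> powr p" by (simp add: powr_mult)
  also have "\<dots> \<le> real CARD('n) powr p * (\<Sum>j\<in>UNIV. \<bar>v $ j\<bar> powr p)"
    by (intro mult_left_mono member_le_sum) auto
  finally show ?thesis .
qed

text \<open>The equation is tested with the solution itself. The weight is at least 1 where t >= 1,
  so the energy controls the gradient in L^2; Young's inequality, weighted with the Poincare
  constant \<open>P\<close>, lets the right-hand side be absorbed. The bounds involve only
  \<open>D\<close>, \<open>\<alpha>\<close> and \<open>p\<close>, apart from the decay 1/k.\<close>

lemma energy_estimate:
  fixes \<Omega> :: "((real, 'n::{finite,linorder}) vec) set" and A :: "(real, 'n) vec \<Rightarrow> ((real, 'n) vec, 'n) vec"
    and y f :: "(real, 'n) vec \<Rightarrow> real" and F :: "real \<Rightarrow> real" and k :: real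
  defines "w \<equiv> wgrad \<Omega> y"
  defines "t \<equiv> \<lambda>x. (norm (msqrt (A x) *v w x))\<^sup>2"
  assumes O: "open \<Omega>" "bounded \<Omega>" and p: "2 \<le> p" and \<xi>2: "Linf \<Omega> \<xi>2" and \<alpha>: "0 < \<alpha>"
    and \<xi>: "AE x in lebesgue_on \<Omega>. \<alpha> \<le> \<xi>1 x \<and> \<xi>1 x \<le> \<xi>2 x"
    and mono: "mono_on {0..} F" and Fid: "\<And>s. 0 \<le> s \<Longrightarrow> s \<le> k\<^sup>2 \<Longrightarrow> F s = s" and Fc: "\<And>s. k\<^sup>2 + 1 < s \<Longrightarrow> F s = k\<^sup>2 + 1"
    and \<epsilon>: "0 < \<epsilon>" and k: "1 \<le> k" and A: "admissible \<Omega> \<xi>1 \<xi>2 \<gamma> A" and f: "Lp \<Omega> 2 f" and y: "sob0 \<Omega> 2 y"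
    and eq: "(LINT x|lebesgue_on \<Omega>. (\<epsilon> + F (t x)) powr ((p - 2) / 2) * ((A x *v w x) \<bullet> w x)) = (LINT x|lebesgue_on \<Omega>. f x * y x)"
    and P: "0 < P" "(LINT x|lebesgue_on \<Omega>. (y x)\<^sup>2) \<le> P * (LINT x|lebesgue_on \<Omega>. (norm (w x))\<^sup>2)"
    and D: "D = measure (lebesgue_on \<Omega>) (space (lebesgue_on \<Omega>)) + P / (2 * \<alpha>\<^sup>2) * (LINT x|lebesgue_on \<Omega>. (f x)\<^sup>2)"
  shows "(LINT x|lebesgue_on \<Omega>. (norm (w x))\<^sup>2) \<le> 2 * D / \<alpha>\<^sup>2"
    and "\<exists>g. g \<in> borel_measurable (lebesgue_on \<Omega>) \<and> integrable (lebesgue_on \<Omega>) (\<lambda>x. norm (g x) powr p) \<and>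
      (LINT x|lebesgue_on \<Omega>. norm (g x) powr p) \<le> 2 * D / \<alpha> powr p \<and>
      integrable (lebesgue_on \<Omega>) (\<lambda>x. w x - g x) \<and> (LINT x|lebesgue_on \<Omega>. norm (w x - g x)) \<le> 3 * D / \<alpha> / k"
proof -
  let ?M = "lebesgue_on \<Omega>"
  define q where "q = (p - 2) / 2"
  have q: "0 \<le> q" using p by (simp add: q_def)
  interpret finite_measure ?M by (rule finite_measure_lebesgue_on[OF O])
  note sq = sob0_2_square_integrable[OF O(1) y, folded w_def]
  note ym[measurable] = sq(1) and wm[measurable] = sq(3)
  have fm[measurable]: "f \<in> borel_measurable ?M" and f2: "integrable ?M (\<lambda>x. (f x)\<^sup>2)"
    using f by (auto simp: Lp_def abs_powr_2)
  have wc[measurable]: "(\<lambda>x. w x $ j) \<in> borel_measurable ?M" for j by measurable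
  have Am: "A \<in> borel_measurable ?M" using A by (simp add: admissible_def)
  have Ac[measurable]: "(\<lambda>x. A x $ i $ j) \<in> borel_measurable ?M" for i j
  proof -
    have "(\<lambda>X::((real, 'n) vec, 'n) vec. X $ i $ j) \<in> borel_measurable borel"
      by (intro borel_measurable_continuous_onI continuous_intros)
    from measurable_compose[OF Am this] show ?thesis .
  qed
  have Bc[measurable]: "(\<lambda>x. msqrt (A x) $ i $ j) \<in> borel_measurable ?M" for i j
    using A by (auto simp: admissible_def BV_def)
  have "(\<lambda>x. msqrt (A x) *v w x) \<in> borel_measurable ?M"
    by (rule borel_measurable_vec_components) (simp add: matrix_vector_mult_def)
  then have tm[measurable]: "t \<in> borel_measurable ?M" unfolding t_def by measurable
  have t0: "0 \<le> t x" for x by (simp add: t_def)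
  \<comment> \<open>\<open>F\<close> is monotone on the half-line only; freezing it at
    \<open>F 0\<close> on the left gives a function monotone everywhere, hence Borel.\<close>
  define F' where "F' s = F (max 0 s)" for s
  have "mono F'" using mono by (auto simp: F'_def mono_def mono_on_def)
  then have F'm[measurable]: "F' \<in> borel_measurable borel" by (rule borel_measurable_mono)
  have FF: "F (t x) = F' (t x)" for x using t0 by (simp add: F'_def)
  have Fle: "F s \<le> k\<^sup>2 + 1" if "0 \<le> s" for s
  proof -
    have "F s \<le> F (max s (k\<^sup>2 + 2))" using mono that by (auto simp: mono_on_def)
    also have "\<dots> = k\<^sup>2 + 1" by (intro Fc) auto
    finally show ?thesis .
  qed
  have Fge: "min s (k\<^sup>2) \<le> F s" if "0 \<le> s" for s
  proof (cases "s \<le> k\<^sup>2")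
    case False
    then have "F (k\<^sup>2) \<le> F s" using mono that unfolding mono_on_def by auto
    then show ?thesis using Fid[of "k\<^sup>2"] by simp
  qed (use Fid[of s] that in simp)
  define E where "E x = (\<epsilon> + F' (t x)) powr q * t x" for x
  have Em[measurable]: "E \<in> borel_measurable ?M" unfolding E_def[abs_def] by measurable
  obtain C2 where C2: "AE x in ?M. \<bar>\<xi>2 x\<bar> \<le> C2" using \<xi>2 by (auto simp: Linf_def)
  \<comment> \<open>The lower bound drives the estimates; the upper one, from the essential bound of
    \<open>\<xi>2\<close>, secures integrability of \<open>t\<close>.\<close>
  have tA: "AE x in ?M. t x = w x \<bullet> (A x *v w x) \<and> \<alpha>\<^sup>2 * (norm (w x))\<^sup>2 \<le> t x \<and> t x \<le> C2\<^sup>2 * (norm (w x))\<^sup>2"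
  proof -
    have "AE x in ?M. transpose (A x) = A x"
      and "AE x in ?M. \<forall>\<eta>. (\<xi>1 x)\<^sup>2 * (norm \<eta>)\<^sup>2 \<le> \<eta> \<bullet> (A x *v \<eta>) \<and> \<eta> \<bullet> (A x *v \<eta>) \<le> (\<xi>2 x)\<^sup>2 * (norm \<eta>)\<^sup>2"
      using A by (auto simp: admissible_def)
    then show ?thesis using \<xi> C2
    proof eventually_elim
      case (elim x)
      have x1: "0 < \<xi>1 x" "\<alpha> \<le> \<xi>1 x" "\<xi>1 x \<le> \<xi>2 x" using elim(3) \<alpha> by auto
      have sqs: "\<alpha>\<^sup>2 \<le> (\<xi>1 x)\<^sup>2" "(\<xi>1 x)\<^sup>2 \<le> (\<xi>2 x)\<^sup>2" "(\<xi>2 x)\<^sup>2 \<le> C2\<^sup>2"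
        using x1 \<alpha> elim(4) by (auto intro!: power_mono)
      have te: "t x = w x \<bullet> (A x *v w x)" unfolding t_def
        by (rule norm_msqrt_mult[where a="(\<xi>1 x)\<^sup>2" and c="(\<xi>2 x)\<^sup>2"]) (use elim(1,2) x1 sqs in auto)
      have "\<alpha>\<^sup>2 * (norm (w x))\<^sup>2 \<le> (\<xi>1 x)\<^sup>2 * (norm (w x))\<^sup>2" "(\<xi>2 x)\<^sup>2 * (norm (w x))\<^sup>2 \<le> C2\<^sup>2 * (norm (w x))\<^sup>2"
        using sqs by (auto intro!: mult_right_mono)
      moreover have "(\<xi>1 x)\<^sup>2 * (norm (w x))\<^sup>2 \<le> t x" "t x \<le> (\<xi>2 x)\<^sup>2 * (norm (w x))\<^sup>2" using elim(2) te by auto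
      ultimately show ?case using te by linarith
    qed
  qed
  have ti: "integrable ?M t"
  proof (rule Bochner_Integration.integrable_bound)
    show "integrable ?M (\<lambda>x. C2\<^sup>2 * (norm (w x))\<^sup>2)" using sq by simp
    show "AE x in ?M. norm (t x) \<le> norm (C2\<^sup>2 * (norm (w x))\<^sup>2)"
      unfolding real_norm_def abs_of_nonneg[OF t0] using tA
      by eventually_elim (rule order_trans[OF _ abs_ge_self], blast)
  qed measurable
  have E0: "0 \<le> E x" for x using t0 by (simp add: E_def)
  \<comment> \<open>The weight is bounded because \<open>F\<close> is at most k^2 + 1. Without
    integrability the integral of \<open>E\<close> could be the default value 0.\<close>
  have Ei: "integrable ?M E"
  proof (rule Bochner_Integration.integrable_bound)
    show "integrable ?M (\<lambda>x. (\<epsilon> + (k\<^sup>2 + 1)) powr q * t x)" using ti by simp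
    show "AE x in ?M. norm (E x) \<le> norm ((\<epsilon> + (k\<^sup>2 + 1)) powr q * t x)"
    proof (rule AE_I2)
      fix x
      have "min (t x) (k\<^sup>2) \<le> F (t x)" "0 \<le> min (t x) (k\<^sup>2)" using Fge[OF t0[of x]] t0[of x] by auto
      then have "0 \<le> F' (t x)" using FF[of x] by linarith
      then have "(\<epsilon> + F' (t x)) powr q \<le> (\<epsilon> + (k\<^sup>2 + 1)) powr q"
        using \<epsilon> q Fle[OF t0[of x]] FF[of x] by (intro powr_mono2) auto
      then have "E x \<le> (\<epsilon> + (k\<^sup>2 + 1)) powr q * t x" unfolding E_def using t0 by (intro mult_right_mono) auto
      then show "norm (E x) \<le> norm ((\<epsilon> + (k\<^sup>2 + 1)) powr q * t x)" using E0[of x] by simp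
    qed
  qed measurable
  have Eeq: "(LINT x|?M. E x) = (LINT x|?M. f x * y x)"
  proof -
    have "(LINT x|?M. E x) = (LINT x|?M. (\<epsilon> + F (t x)) powr ((p - 2) / 2) * ((A x *v w x) \<bullet> w x))"
    proof (rule integral_cong_AE)
      have "(\<lambda>x. (A x *v w x) \<bullet> w x) \<in> borel_measurable ?M"
        unfolding inner_vec_def matrix_vector_mult_def by simp
      then show "(\<lambda>x. (\<epsilon> + F (t x)) powr ((p - 2) / 2) * ((A x *v w x) \<bullet> w x)) \<in> borel_measurable ?M"
        unfolding FF by measurable
      show "AE x in ?M. E x = (\<epsilon> + F (t x)) powr ((p - 2) / 2) * ((A x *v w x) \<bullet> w x)"
        using tA
      proof eventually_elim
        case (elim x)
        then have "(A x *v w x) \<bullet> w x = t x" by (simp add: inner_commute)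
        then show ?case unfolding E_def FF q_def by simp
      qed
    qed measurable
    then show ?thesis using eq by simp
  qed
  have Emin: "min (t x) (k\<^sup>2) powr q * t x \<le> E x" for x
    unfolding E_def FF[symmetric] using Fge[OF t0[of x]] t0[of x] \<epsilon> q by (intro mult_right_mono powr_mono2) auto
  have k2: "1 \<le> k\<^sup>2" using k by (simp add: one_le_power)
  \<comment> \<open>Where t >= 1, the assumption \<open>1 \<le> k\<close> makes min(t, k^2), and
    with it the weight, at least 1; elsewhere t - 1 is negative.\<close>
  have Et: "t x - 1 \<le> E x" for x
  proof (cases "t x \<ge> 1")
    case True
    have "1 \<le> min (t x) (k\<^sup>2) powr q" using True k2 q by (intro ge_one_powr_ge_zero) auto
    then have "1 * t x \<le> min (t x) (k\<^sup>2) powr q * t x" using t0 by (intro mult_right_mono) auto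
    then show ?thesis using Emin[of x] by linarith
  qed (use E0[of x] in linarith)
  define m where "m = measure ?M (space ?M)"
  define W where "W = (LINT x|?M. (norm (w x))\<^sup>2)"
  have m0: "0 \<le> m" by (simp add: m_def)
  have fyi: "integrable ?M (\<lambda>x. f x * y x)" by (rule integrable_mult_of_squares[OF f2 sq(2) fm ym])
  have T_le: "(LINT x|?M. t x) \<le> m + (LINT x|?M. E x)"
  proof -
    have "(LINT x|?M. t x) \<le> (LINT x|?M. 1 + E x)" using ti Ei Et by (intro integral_mono) (auto simp: algebra_simps)
    then show ?thesis using Ei by (simp add: m_def)
  qed
  have W_le: "\<alpha>\<^sup>2 * W \<le> (LINT x|?M. t x)"
  proof -
    have "(LINT x|?M. \<alpha>\<^sup>2 * (norm (w x))\<^sup>2) \<le> (LINT x|?M. t x)"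
      using ti sq(4) by (intro integral_mono_AE) (use tA in \<open>auto elim!: eventually_mono\<close>)
    then show ?thesis by (simp add: W_def)
  qed
  \<comment> \<open>Young's inequality is balanced so that, after Poincare, the term with y^2
    becomes half of \<alpha>^2 W.\<close>
  have fy_le: "(LINT x|?M. f x * y x) \<le> P / (2 * \<alpha>\<^sup>2) * (LINT x|?M. (f x)\<^sup>2) + \<alpha>\<^sup>2 / 2 * W"
  proof -
    have "(LINT x|?M. f x * y x) \<le> (LINT x|?M. P / (2 * \<alpha>\<^sup>2) * (f x)\<^sup>2 + \<alpha>\<^sup>2 / (2 * P) * (y x)\<^sup>2)"
    proof (intro integral_mono fyi)
      show "integrable ?M (\<lambda>x. P / (2 * \<alpha>\<^sup>2) * (f x)\<^sup>2 + \<alpha>\<^sup>2 / (2 * P) * (y x)\<^sup>2)"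
        by (intro Bochner_Integration.integrable_add integrable_mult_right f2 sq(2))
      fix x
      have "0 \<le> (P / \<alpha>\<^sup>2 * f x - y x)\<^sup>2 * (\<alpha>\<^sup>2 / (2 * P))" using P by simp
      also have "\<dots> = P / (2 * \<alpha>\<^sup>2) * (f x)\<^sup>2 + \<alpha>\<^sup>2 / (2 * P) * (y x)\<^sup>2 - f x * y x"
        using P \<alpha> by (simp add: power2_eq_square field_simps)
      finally show "f x * y x \<le> P / (2 * \<alpha>\<^sup>2) * (f x)\<^sup>2 + \<alpha>\<^sup>2 / (2 * P) * (y x)\<^sup>2" by simp
    qed
    also have "\<dots> = P / (2 * \<alpha>\<^sup>2) * (LINT x|?M. (f x)\<^sup>2) + \<alpha>\<^sup>2 / (2 * P) * (LINT x|?M. (y x)\<^sup>2)"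
      using f2 sq(2) by (subst Bochner_Integration.integral_add) auto
    also have "\<dots> \<le> P / (2 * \<alpha>\<^sup>2) * (LINT x|?M. (f x)\<^sup>2) + \<alpha>\<^sup>2 / (2 * P) * (P * W)"
      using P unfolding W_def by (intro add_left_mono mult_left_mono) auto
    also have "\<dots> = P / (2 * \<alpha>\<^sup>2) * (LINT x|?M. (f x)\<^sup>2) + \<alpha>\<^sup>2 / 2 * W" using P by simp
    finally show ?thesis .
  qed
  define X where "X = P / (2 * \<alpha>\<^sup>2) * (LINT x|?M. (f x)\<^sup>2)"
  define V where "V = \<alpha>\<^sup>2 / 2 * W"
  have X0: "0 \<le> X" using P by (simp add: X_def)
  have D': "D = m + X" using D by (simp add: m_def X_def)
  have V2: "\<alpha>\<^sup>2 * W = 2 * V" by (simp add: V_def)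
  note fy_le' = fy_le[folded X_def V_def]
  have Dm: "m \<le> D" using X0 unfolding D' by simp
  \<comment> \<open>The chain 2 V <= m + X + V, with m + X = D, absorbs \<open>V\<close>.\<close>
  have V_le: "V \<le> D" using W_le T_le fy_le' unfolding D' Eeq V2 by linarith
  then have aW: "\<alpha>\<^sup>2 / 2 * W \<le> D" by (simp add: V_def)
  then show "(LINT x|?M. (norm (w x))\<^sup>2) \<le> 2 * D / \<alpha>\<^sup>2"
    unfolding W_def[symmetric] using \<alpha> by (simp add: field_simps)
  have E_le: "(LINT x|?M. E x) \<le> 2 * D" unfolding Eeq
    by (rule order_trans[OF fy_le']) (use V_le m0 D' in linarith)
  have t_le: "(LINT x|?M. t x) \<le> 3 * D" using T_le E_le Dm by linarith
  \<comment> \<open>The truncated gradient: on {t <= k^2} the function \<open>F\<close> is the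
    identity, so there the energy density is at least t^(p/2).\<close>
  define g where "g x = indicator {s. s \<le> k\<^sup>2} (t x) *\<^sub>R w x" for x
  have gm[measurable]: "g \<in> borel_measurable ?M" unfolding g_def[abs_def] by measurable
  have ap: "0 < \<alpha> powr p" using \<alpha> by simp
  have gE: "AE x in ?M. norm (g x) powr p \<le> E x / \<alpha> powr p"
    using tA
  proof eventually_elim
    case (elim x)
    show ?case
    proof (cases "t x \<le> k\<^sup>2 \<and> w x \<noteq> 0")
      case True
      have t1: "0 < t x"
      proof -
        have "0 < \<alpha>\<^sup>2 * (norm (w x))\<^sup>2" using \<alpha> True by simp
        with elim show ?thesis by linarith
      qed
      have "\<alpha> * norm (w x) \<le> sqrt (t x)"
        using elim \<alpha> by (intro real_le_rsqrt) (simp add: power_mult_distrib)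
      then have "(\<alpha> * norm (w x)) powr p \<le> sqrt (t x) powr p" using \<alpha> p by (intro powr_mono2) auto
      also have "\<dots> = t x powr (p / 2)" using t1 by (simp add: powr_half_sqrt[symmetric] powr_powr)
      also have "\<dots> = t x powr (q + 1)" by (simp add: q_def field_simps)
      also have "\<dots> = min (t x) (k\<^sup>2) powr q * t x" using t1 True by (simp add: powr_add)
      also have "\<dots> \<le> E x" by (rule Emin)
      finally have "\<alpha> powr p * norm (w x) powr p \<le> E x" using \<alpha> by (simp add: powr_mult)
      then have "norm (w x) powr p \<le> E x / \<alpha> powr p" using ap by (simp add: pos_le_divide_eq mult.commute)
      then show ?thesis using True by (simp add: g_def)
    next
      case False
      then have "g x = 0" by (auto simp: g_def)
      then show ?thesis using E0[of x] by simp
    qed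
  qed
  have gi: "integrable ?M (\<lambda>x. norm (g x) powr p)"
  proof (rule Bochner_Integration.integrable_bound)
    show "integrable ?M (\<lambda>x. E x / \<alpha> powr p)" using Ei by simp
    show "AE x in ?M. norm (norm (g x) powr p) \<le> norm (E x / \<alpha> powr p)" using gE by eventually_elim (simp add: E0)
  qed measurable
  have "(LINT x|?M. norm (g x) powr p) \<le> (LINT x|?M. E x / \<alpha> powr p)" using gi Ei gE by (intro integral_mono_AE) auto
  also have "\<dots> \<le> 2 * D / \<alpha> powr p" using E_le ap by (simp add: divide_right_mono)
  finally have gle: "(LINT x|?M. norm (g x) powr p) \<le> 2 * D / \<alpha> powr p" .
  have hE: "AE x in ?M. norm (w x - g x) \<le> t x / (\<alpha> * k)"
    using tA
  proof eventually_elim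
    case (elim x)
    show ?case
    proof (cases "t x \<le> k\<^sup>2")
      case True
      then have "w x - g x = 0" by (simp add: g_def)
      then show ?thesis using t0[of x] \<alpha> k by simp
    next
      case False
      have "\<alpha> * norm (w x) \<le> sqrt (t x)"
        using elim \<alpha> by (intro real_le_rsqrt) (simp add: power_mult_distrib)
      moreover have "k \<le> sqrt (t x)" using False k by (intro real_le_rsqrt) auto
      ultimately have "(\<alpha> * norm (w x)) * k \<le> sqrt (t x) * sqrt (t x)" using k t0[of x] by (intro mult_mono) auto
      then have "norm (w x) * (\<alpha> * k) \<le> t x" using t0[of x] by (simp add: mult_ac)
      then have "norm (w x) \<le> t x / (\<alpha> * k)" using \<alpha> k by (simp add: pos_le_divide_eq)
      then show ?thesis using False by (simp add: g_def)
    qed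
  qed
  have hi: "integrable ?M (\<lambda>x. w x - g x)"
  proof (rule Bochner_Integration.integrable_bound)
    show "integrable ?M (\<lambda>x. t x / (\<alpha> * k))" using ti by simp
    show "AE x in ?M. norm (w x - g x) \<le> norm (t x / (\<alpha> * k))"
      unfolding real_norm_def using hE by eventually_elim (erule order_trans[OF _ abs_ge_self])
  qed measurable
  have "(LINT x|?M. norm (w x - g x)) \<le> (LINT x|?M. t x / (\<alpha> * k))" using hi ti hE by (intro integral_mono_AE) auto
  also have "\<dots> \<le> 3 * D / (\<alpha> * k)" using t_le \<alpha> k by (simp add: divide_right_mono)
  finally have "(LINT x|?M. norm (w x - g x)) \<le> 3 * D / \<alpha> / k" by simp
  then show "\<exists>g. g \<in> borel_measurable ?M \<and> integrable ?M (\<lambda>x. norm (g x) powr p) \<and>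
      (LINT x|?M. norm (g x) powr p) \<le> 2 * D / \<alpha> powr p \<and>
      integrable ?M (\<lambda>x. w x - g x) \<and> (LINT x|?M. norm (w x - g x)) \<le> 3 * D / \<alpha> / k"
    using gm gi gle hi by blast
qed

text \<open>Function and gradient are replaced by Borel versions extended by zero. These form weak
  derivatives on the whole space because \<open>y\<close> lies in H^1_0; \<open>weak_pd_Lp\<close>
  puts the function into L^p, and \<open>test_fun_dense_Lp\<close> supplies approximants with errors
  1/(n+1).\<close>

lemma sob0_of_wgrad_Lp:
  fixes \<Omega> :: "(real^'n::finite) set"
  assumes O: "open \<Omega>" "bounded \<Omega>" "lipschitz_boundary \<Omega>" and p: "1 < p" and y: "sob0 \<Omega> 2 y"
    and wp: "integrable (lebesgue_on \<Omega>) (\<lambda>x. norm (wgrad \<Omega> y x) powr p)"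
  shows "sob0 \<Omega> p y"
proof -
  let ?M = "lebesgue_on \<Omega>" and ?w = "wgrad \<Omega> y"
  have Ob[measurable]: "\<Omega> \<in> sets borel" using O(1) by simp
  note sq = sob0_2_square_integrable[OF O(1) y]
  note ym[measurable] = sq(1) and wm[measurable] = sq(3)
  have wg: "weak_grad \<Omega> y ?w" by (rule sob0_weak_grad[OF y])
  have wc: "(\<lambda>x. ?w x $ j) \<in> borel_measurable ?M" for j by measurable
  obtain u where um[measurable]: "u \<in> borel_measurable borel" and uy: "AE x in ?M. u x = y x"
    and u0: "\<And>x. x \<notin> \<Omega> \<Longrightarrow> u x = 0"
    by (rule borel_extension[OF Ob sq(1)]) (rule that)
  define ext where "ext j g \<longleftrightarrow> g \<in> borel_measurable borel \<and> (AE x in ?M. g x = ?w x $ j) \<and> (\<forall>x. x \<notin> \<Omega> \<longrightarrow> g x = 0)" for j and g :: "real^'n \<Rightarrow> real"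
  have ex: "\<exists>g. ext j g" for j
    by (rule borel_extension[OF Ob wc[of j]]) (auto simp: ext_def)
  define G where "G j = (SOME g. ext j g)" for j
  have "ext j (G j)" for j unfolding G_def by (rule someI_ex[OF ex])
  then have Gm[measurable]: "G j \<in> borel_measurable borel" and Gw: "AE x in ?M. G j x = ?w x $ j"
    and G0: "x \<notin> \<Omega> \<Longrightarrow> G j x = 0" for j x
    unfolding ext_def by simp_all
  have wpd: "weak_pd j u (G j)" for j
    by (rule sob0_2_weak_pd[OF O(1,2) y um uy u0 Gm Gw G0])
  have uM[measurable]: "u \<in> borel_measurable ?M" and GM[measurable]: "G j \<in> borel_measurable ?M" for j
    by (auto intro: borel_lebesgue_on)
  have p0: "0 \<le> p" "p \<noteq> 0" using p by auto
  have Gp: "integrable lborel (\<lambda>x. \<bar>G j x\<bar> powr p)" for j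
  proof -
    have "integrable ?M (\<lambda>x. \<bar>G j x\<bar> powr p)"
    proof (rule Bochner_Integration.integrable_bound[OF wp])
      show "AE x in ?M. norm (\<bar>G j x\<bar> powr p) \<le> norm (norm (?w x) powr p)"
        using Gw[of j]
      proof eventually_elim
        case (elim x)
        then show ?case using component_le_norm_cart[of "?w x" j] p0 by (simp add: powr_mono2)
      qed
    qed measurable
    then show ?thesis using G0 p0 by (subst (asm) lebesgue_on_eq_lborel) auto
  qed
  obtain R where R: "R > 0" "\<And>x. x \<in> \<Omega> \<Longrightarrow> norm x \<le> R" using O(2) by (auto simp: bounded_pos)
  have uR: "norm x \<le> R" if "u x \<noteq> 0" for x using u0[of x] R(2)[of x] that by blast
  have up: "integrable lborel (\<lambda>x. \<bar>u x\<bar> powr p)"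
    by (rule weak_pd_Lp[OF wpd[of undefined] uR R(1) Gp p])
  then have upM: "integrable ?M (\<lambda>x. \<bar>u x\<bar> powr p)" using u0 p0 by (subst lebesgue_on_eq_lborel) auto
  have yp: "integrable ?M (\<lambda>x. \<bar>y x\<bar> powr p)"
    using upM by (rule integrable_cong_AE_imp) (use uy in \<open>auto elim!: eventually_mono\<close>)
  have sob: "sob \<Omega> p y"
    unfolding sob_def Lp_def using yp wp wg by (auto intro!: exI[of _ ?w])
  define close where "close n \<phi> \<longleftrightarrow> test_fun \<Omega> \<phi> \<and>
     (\<integral>\<^sup>+x. ennreal (\<bar>\<phi> x - u x\<bar> powr p) \<partial>lborel) \<le> ennreal (inverse (real (Suc n))) \<and>
     (\<forall>j. (\<integral>\<^sup>+x. ennreal (\<bar>pd j \<phi> x - G j x\<bar> powr p) \<partial>lborel) \<le> ennreal (inverse (real (Suc n))))" for n \<phi>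
  have exc: "\<exists>\<phi>. close n \<phi>" for n
  proof -
    have p1: "1 \<le> p" and e: "0 < inverse (real (Suc n))" using p by auto
    show ?thesis
      by (rule test_fun_dense_Lp[OF O p1 wpd u0 G0 up Gp e]) (auto simp: close_def)
  qed
  define \<phi> where "\<phi> n = (SOME \<phi>. close n \<phi>)" for n
  have "close n (\<phi> n)" for n unfolding \<phi>_def by (rule someI_ex[OF exc])
  then have t: "test_fun \<Omega> (\<phi> n)"
    and \<phi>u: "(\<integral>\<^sup>+x. ennreal (\<bar>\<phi> n x - u x\<bar> powr p) \<partial>lborel) \<le> ennreal (inverse (real (Suc n)))"
    and \<phi>G: "(\<integral>\<^sup>+x. ennreal (\<bar>pd j (\<phi> n) x - G j x\<bar> powr p) \<partial>lborel) \<le> ennreal (inverse (real (Suc n)))" for n j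
    unfolding close_def by simp_all
  have \<phi>m[measurable]: "\<phi> n \<in> borel_measurable borel" "pd j (\<phi> n) \<in> borel_measurable borel" for n j
    using t by (auto intro: smooth_fun_borel test_fun_smooth test_fun_pd)
  have \<phi>M[measurable]: "\<phi> n \<in> borel_measurable ?M" "pd j (\<phi> n) \<in> borel_measurable ?M" "grad (\<phi> n) \<in> borel_measurable ?M" for n j
    by (auto intro!: borel_lebesgue_on smooth_fun_grad_borel test_fun_smooth[OF t])
  have le1: "(LINT x|?M. \<bar>\<phi> n x - y x\<bar> powr p) \<le> inverse (real (Suc n))" for n
  proof -
    have "(LINT x|?M. \<bar>\<phi> n x - y x\<bar> powr p) = (LINT x|?M. \<bar>\<phi> n x - u x\<bar> powr p)"
      by (rule integral_cong_AE) (use uy in \<open>auto elim!: eventually_mono\<close>)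
    also have "\<dots> = (LINT x|lborel. \<bar>\<phi> n x - u x\<bar> powr p)"
      using u0 test_fun_zero_outside[OF t] p0 by (intro lebesgue_on_eq_lborel(2)) auto
    also have "\<dots> \<le> inverse (real (Suc n))"
      by (rule integral_le_of_nn_integral(2)[OF _ _ \<phi>u]) auto
    finally show ?thesis .
  qed
  define N where "N = real CARD('n)"
  \<comment> \<open>The vector error is reduced to its components: N^p comes from
    \<open>norm_powr_le_sum\<close>, the further factor N from their number.\<close>
  have le2: "(LINT x|?M. norm (grad (\<phi> n) x - ?w x) powr p) \<le> (N powr p * N) * inverse (real (Suc n))" for n
  proof -
    have gi: "integrable ?M (\<lambda>x. \<bar>pd j (\<phi> n) x - G j x\<bar> powr p)"
      and gle: "(LINT x|?M. \<bar>pd j (\<phi> n) x - G j x\<bar> powr p) \<le> inverse (real (Suc n))" for j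
    proof -
      have z: "\<bar>pd j (\<phi> n) x - G j x\<bar> powr p = 0" if "x \<notin> \<Omega>" for x
        using G0[OF that] test_fun_zero_outside[OF test_fun_pd[OF t] that] p0 by simp
      have b: "(\<lambda>x. \<bar>pd j (\<phi> n) x - G j x\<bar> powr p) \<in> borel_measurable borel" by measurable
      have "integrable lborel (\<lambda>x. \<bar>pd j (\<phi> n) x - G j x\<bar> powr p)" "(LINT x|lborel. \<bar>pd j (\<phi> n) x - G j x\<bar> powr p) \<le> inverse (real (Suc n))"
        by (rule integral_le_of_nn_integral[OF _ _ \<phi>G]; simp)+
      then show "integrable ?M (\<lambda>x. \<bar>pd j (\<phi> n) x - G j x\<bar> powr p)"
        "(LINT x|?M. \<bar>pd j (\<phi> n) x - G j x\<bar> powr p) \<le> inverse (real (Suc n))"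
        using lebesgue_on_eq_lborel[OF Ob b z] by auto
    qed
    have "AE x in ?M. \<forall>j\<in>UNIV. G j x = ?w x $ j" using Gw by (intro AE_finite_allI) auto
    then have ae: "AE x in ?M. norm (grad (\<phi> n) x - ?w x) powr p \<le> N powr p * (\<Sum>j\<in>UNIV. \<bar>pd j (\<phi> n) x - G j x\<bar> powr p)"
    proof eventually_elim
      case (elim x)
      show ?case using norm_powr_le_sum[OF p0(1), of "grad (\<phi> n) x - ?w x"] elim by (simp add: N_def grad_nth)
    qed
    have si: "integrable ?M (\<lambda>x. N powr p * (\<Sum>j\<in>UNIV. \<bar>pd j (\<phi> n) x - G j x\<bar> powr p))"
      by (intro integrable_mult_right Bochner_Integration.integrable_sum gi)
    have "integrable ?M (\<lambda>x. norm (grad (\<phi> n) x - ?w x) powr p)"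
    proof (rule Bochner_Integration.integrable_bound[OF si])
      show "AE x in ?M. norm (norm (grad (\<phi> n) x - ?w x) powr p) \<le> norm (N powr p * (\<Sum>j\<in>UNIV. \<bar>pd j (\<phi> n) x - G j x\<bar> powr p))"
        unfolding real_norm_def abs_of_nonneg[OF powr_ge_zero] using ae by eventually_elim (erule order_trans[OF _ abs_ge_self])
    qed measurable
    then have "(LINT x|?M. norm (grad (\<phi> n) x - ?w x) powr p) \<le> (LINT x|?M. N powr p * (\<Sum>j\<in>UNIV. \<bar>pd j (\<phi> n) x - G j x\<bar> powr p))"
      by (rule integral_mono_AE[OF _ si ae])
    also have "\<dots> = N powr p * (\<Sum>j\<in>UNIV. LINT x|?M. \<bar>pd j (\<phi> n) x - G j x\<bar> powr p)"
      using gi by (simp add: Bochner_Integration.integral_sum)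
    also have "\<dots> \<le> N powr p * (\<Sum>j\<in>(UNIV::'n set). inverse (real (Suc n)))"
      by (intro mult_left_mono sum_mono gle) auto
    finally show ?thesis by (simp add: N_def)
  qed
  have "(\<lambda>n. LINT x|?M. \<bar>\<phi> n x - y x\<bar> powr p) \<longlonglongrightarrow> 0"
    by (rule tendsto_sandwich[OF _ _ tendsto_const LIMSEQ_inverse_real_of_nat]) (use le1 in auto)
  moreover have "(\<lambda>n. LINT x|?M. norm (grad (\<phi> n) x - ?w x) powr p) \<longlonglongrightarrow> 0"
    by (rule tendsto_sandwich[OF _ _ tendsto_const tendsto_mult_right_zero[OF LIMSEQ_inverse_real_of_nat, of "N powr p * N"]])
      (use le2 in auto)
  ultimately show ?thesis unfolding sob0_def using sob t by blast
qed

theorem mainTheorem11: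
  fixes \<Omega> :: "((real, 'n::{finite,linorder}) vec) set"
    and p \<gamma> \<alpha> \<delta> :: real
    and \<xi>1 \<xi>2 :: "(real, 'n) vec \<Rightarrow> real"
    and F :: "nat \<Rightarrow> real \<Rightarrow> real"
    and \<epsilon> :: "nat \<Rightarrow> real" and k :: "nat \<Rightarrow> nat"
    and A :: "nat \<Rightarrow> (real, 'n) vec \<Rightarrow> ((real, 'n) vec, 'n) vec"
    and f :: "(real, 'n) vec \<Rightarrow> real"
    and y :: "nat \<Rightarrow> (real, 'n) vec \<Rightarrow> real" and y0 :: "(real, 'n) vec \<Rightarrow> real"
  assumes "open \<Omega>" and "bounded \<Omega>" and "lipschitz_boundary \<Omega>"
    and "2 \<le> p"
    and "Linf \<Omega> \<xi>1" and "BV \<Omega> \<xi>1" and "Linf \<Omega> \<xi>2" and "BV \<Omega> \<xi>2"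
    and "0 < \<alpha>"
    and "AE x in lebesgue_on \<Omega>. \<alpha> \<le> \<xi>1 x \<and> \<xi>1 x \<le> \<xi>2 x"
    and "0 < \<gamma>"
    and "0 < \<delta>" and "\<delta> < 1"
    and "\<And>m. mono_on {0..} (F m)"
    and "\<And>m. \<exists>D. (\<forall>t\<ge>0. (F m has_real_derivative D t) (at t within {0..})) \<and> continuous_on {0..} D"
    and "\<And>m t. 0 \<le> t \<Longrightarrow> 0 \<le> F m t"
    and "\<And>m t. 0 \<le> t \<Longrightarrow> t \<le> (real m)\<^sup>2 \<Longrightarrow> F m t = t"
    and "\<And>m t. (real m)\<^sup>2 + 1 < t \<Longrightarrow> F m t = (real m)\<^sup>2 + 1"
    and "\<And>m t. (real m)\<^sup>2 \<le> t \<Longrightarrow> t < (real m)\<^sup>2 + 1 \<Longrightarrow> t \<le> F m t \<and> F m t \<le> t + \<delta>"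
    and "\<And>i. 0 < \<epsilon> i" and "\<epsilon> \<longlonglongrightarrow> 0"
    and "filterlim k at_top sequentially"
    and "\<And>i. admissible \<Omega> \<xi>1 \<xi>2 \<gamma> (A i)"
    and "Lp \<Omega> 2 f"
    and "\<And>i. sob0 \<Omega> 2 (y i)"
    and "\<And>i v. sob0 \<Omega> 2 v \<Longrightarrow>
       (LINT x|lebesgue_on \<Omega>.
          (\<epsilon> i + F (k i) ((norm (msqrt (A i x) *v wgrad \<Omega> (y i) x))\<^sup>2)) powr ((p - 2) / 2)
          * ((A i x *v wgrad \<Omega> (y i) x) \<bullet> wgrad \<Omega> v x))
       = (LINT x|lebesgue_on \<Omega>. f x * v x)"
    and "weak_conv_H10 \<Omega> y y0"
  shows "sob0 \<Omega> p y0"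
proof -
  let ?M = "lebesgue_on \<Omega>"
  \<comment> \<open>\<open>eqn\<close> is the weak equation with the solutions themselves as test
    functions.\<close>
  note O = assms(1-3) and p = assms(4) and \<xi>2 = assms(7) and \<alpha> = assms(9) and \<xi> = assms(10)
    and F = assms(14,17,18) and \<epsilon> = assms(20) and k = assms(22) and A = assms(23) and f = assms(24)
    and y = assms(25) and eqn = assms(26)[OF assms(25)]
  have y0: "sob0 \<Omega> 2 y0" and
    wlim: "\<And>v. sob0 \<Omega> 2 v \<Longrightarrow> (\<lambda>i. LINT x|?M. y i x * v x + wgrad \<Omega> (y i) x \<bullet> wgrad \<Omega> v x)
          \<longlonglongrightarrow> (LINT x|?M. y0 x * v x + wgrad \<Omega> y0 x \<bullet> wgrad \<Omega> v x)"
    using assms(27) by (auto simp: weak_conv_H10_def)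
  obtain R where R: "R > 0" "\<And>x. x \<in> \<Omega> \<Longrightarrow> norm x \<le> R" using O(2) by (auto simp: bounded_pos)
  then have OR: "\<Omega> \<subseteq> cball 0 R" by auto
  define P where "P = 4 * (4 * R)\<^sup>2"
  have P: "P > 0" using R by (simp add: P_def)
  define D where "D = measure ?M (space ?M) + P / (2 * \<alpha>\<^sup>2) * (LINT x|?M. (f x)\<^sup>2)"
  have poinc: "(LINT x|?M. (y i x)\<^sup>2) \<le> P * (LINT x|?M. (norm (wgrad \<Omega> (y i) x))\<^sup>2)" for i
    unfolding P_def by (rule sob0_2_poincare[OF O(1) y OR R(1)])
  \<comment> \<open>The energy estimate asks for k i >= 1, which is guaranteed only for large i;
    \<open>Q\<close> carries this restriction into the subsequence selection of
    \<open>weak_limit_Lp\<close>.\<close>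
  define Q where "Q i \<longleftrightarrow> 1 \<le> k i" for i
  have evQ: "eventually Q sequentially" using k unfolding Q_def[abs_def] filterlim_at_top by blast
  have Qk: "1 \<le> real (k i)" if "Q i" for i using that unfolding Q_def by linarith
  \<comment> \<open>Measurability is demanded for every \<open>i\<close>, the bounds only under
    \<open>Q\<close>; the zero function fills the remaining indices.\<close>
  define good where "good i g \<longleftrightarrow> g \<in> borel_measurable ?M \<and> (Q i \<longrightarrow> integrable ?M (\<lambda>x. norm (g x) powr p) \<and>
      (LINT x|?M. norm (g x) powr p) \<le> 2 * D / \<alpha> powr p \<and>
      integrable ?M (\<lambda>x. wgrad \<Omega> (y i) x - g x) \<and> (LINT x|?M. norm (wgrad \<Omega> (y i) x - g x)) \<le> 3 * D / \<alpha> / real (k i))"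
    for i and g :: "(real, 'n) vec \<Rightarrow> (real, 'n) vec"
  have Wle: "(LINT x|?M. (norm (wgrad \<Omega> (y i) x))\<^sup>2) \<le> 2 * D / \<alpha>\<^sup>2" if "Q i" for i
    by (rule energy_estimate(1)[OF O(1,2) p \<xi>2 \<alpha> \<xi> F \<epsilon> Qk[OF that] A f y eqn P poinc D_def])
  have ex: "\<exists>g. good i g" for i
  proof (cases "Q i")
    case True
    from energy_estimate(2)[OF O(1,2) p \<xi>2 \<alpha> \<xi> F \<epsilon> Qk[OF True] A f y eqn P poinc D_def]
    show ?thesis unfolding good_def by blast
  next
    case False
    then show ?thesis by (intro exI[of _ "\<lambda>x. 0"]) (simp add: good_def)
  qed
  define g where "g i = (SOME g. good i g)" for i
  have "good i (g i)" for i unfolding g_def by (rule someI_ex[OF ex])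
  then have gm: "\<And>i. g i \<in> borel_measurable ?M" and gQ: "\<And>i. Q i \<Longrightarrow> integrable ?M (\<lambda>x. norm (g i x) powr p)"
    "\<And>i. Q i \<Longrightarrow> (LINT x|?M. norm (g i x) powr p) \<le> 2 * D / \<alpha> powr p"
    "\<And>i. Q i \<Longrightarrow> integrable ?M (\<lambda>x. wgrad \<Omega> (y i) x - g i x)"
    "\<And>i. Q i \<Longrightarrow> (LINT x|?M. norm (wgrad \<Omega> (y i) x - g i x)) \<le> 3 * D / \<alpha> / real (k i)"
    unfolding good_def by simp_all
  \<comment> \<open>One common bound for the functions (via Poincare), the gradients and the
    truncated gradients.\<close>
  define C where "C = max (2 * D / \<alpha> powr p) (max (2 * D / \<alpha>\<^sup>2) (P * (2 * D / \<alpha>\<^sup>2)))"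
  have C1: "(LINT x|?M. (y i x)\<^sup>2) \<le> C" if "Q i" for i
  proof -
    have "(LINT x|?M. (y i x)\<^sup>2) \<le> P * (2 * D / \<alpha>\<^sup>2)"
      using poinc[of i] Wle[OF that] P by (meson mult_left_mono less_imp_le order_trans)
    then show ?thesis by (simp add: C_def)
  qed
  have C2: "(LINT x|?M. (norm (wgrad \<Omega> (y i) x))\<^sup>2) \<le> C" if "Q i" for i
    using Wle[OF that] by (simp add: C_def)
  have C3: "(LINT x|?M. norm (g i x) powr p) \<le> C" if "Q i" for i
    using gQ(2)[OF that] by (simp add: C_def)
  have blim: "(\<lambda>i. 3 * D / \<alpha> / real (k i)) \<longlonglongrightarrow> 0"
    by (intro tendsto_divide_0[OF tendsto_const] filterlim_at_top_imp_at_infinity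
        filterlim_compose[OF filterlim_real_sequentially k])
  note sq = sob0_2_square_integrable[OF O(1) y] and sq0 = sob0_2_square_integrable[OF O(1) y0]
  have "integrable ?M (\<lambda>x. norm (wgrad \<Omega> y0 x) powr p)"
    by (rule weak_limit_Lp[OF finite_measure_lebesgue_on[OF O(1,2)] _ sq(1) sq0(1) sq(3) sq0(3) gm
          sq(2) sq0(2) sq(4) sq0(4) wlim[OF y] wlim[OF y0] evQ C1 C2 gQ(1) C3 gQ(3) blim gQ(4)])
      (use p in auto)
  then show ?thesis by (intro sob0_of_wgrad_Lp[OF O _ y0]) (use p in auto)
qed

end
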